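(* Let $G$ be an $n$-vertex graph given together with a refined variant of a nice tree decomposition of $G$ of width at most $p$ (with $O(pn)$ nodes). Then the $VCP_3$ problem in $G$ can be solved in time $O(3^{p}\cdot p\,n^{6})$.
   Context: Graphs are finite, simple and undirected. $P_3$ is the path on $3$ vertices. A set $F\subseteq V(G)$ is a vertex cover $P_3$ set ($VCP_3$ set) of $G$ if every path on $3$ vertices in $G$ (as a subgraph, not necessarily induced) contains at least one vertex of $F$; equivalently, $G[V\setminus F]$ has maximum degree at most one. The $VCP_3$ problem asks for a $VCP_3$ set of minimum size. A tree decomposition of $G=(V,E)$ is a pair $(T,\{X_i : i\in I\})$, where $T$ is a rooted tree with node set $I$ and each bag $X_i\subseteq V$, such that $\bigcup_{i} X_i=V$; every edge $uv\in E$ satisfies $u,v\in X_i$ for some $i$; and whenever $j$ lies on the path from $i$ to $k$ in $T$, $X_i\cap X_k\subseteq X_j$. Its width is $\max_i |X_i|-1$. A refined variant of a nice tree decomposition of $G$ is a tree decomposition in which $T$ is rooted and binary, the root and all leaves have empty bags, and every non-leaf node $t$ is of one of the following types. - Introduce node: $t$ has exactly one child $t'$, and $X_t=X_{t'}\cup\{v\}$ for some $v\notin X_{t'}$. - Forget node: $t$ has exactly one child $t'$, and $X_t=X_{t'}\setminus\{v\}$ for some $v\in X_{t'}$. - Join node: $t$ has exactly two children $t_1,t_2$, and $X_t=X_{t_1}=X_{t_2}$. - Introduce edge node: $t$ is labeled with an edge $uv\in E(G)$ and has exactly one child $t'$, with $u,v\in X_t=X_{t'}$; one says that $uv$ is introduced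 at $t$. In addition, every edge of $G$ is introduced at exactly one introduce edge node. *)

theory Defs
  imports Main "HOL-Library.Log_Nat"
begin

section \<open>Graphs and vertex cover $P_3$ sets\<close>

record 'a graph =
  verts :: "'a set"
  edges :: "'a set set"

definition simple_graph :: "'a graph \<Rightarrow> bool" where
  "simple_graph G \<longleftrightarrow>
     finite (verts G) \<and> (\<forall>e\<in>edges G. e \<subseteq> verts G \<and> card e = 2)"

definition P3_in :: "'a graph \<Rightarrow> 'a \<Rightarrow> 'a \<Rightarrow> 'a \<Rightarrow> bool" where
  "P3_in G u v w \<longleftrightarrow> distinct [u, v, w] \<and> {u, v} \<in> edges G \<and> {v, w} \<in> edges G"

definition vcp3_set :: "'a graph \<Rightarrow> 'a set \<Rightarrow> bool" where
  "vcp3_set G F \<longleftrightarrow>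
     F \<subseteq> verts G \<and> (\<forall>u v w. P3_in G u v w \<longrightarrow> {u, v, w} \<inter> F \<noteq> {})"

definition minimum_vcp3_set :: "'a graph \<Rightarrow> 'a set \<Rightarrow> bool" where
  "minimum_vcp3_set G F \<longleftrightarrow> is_arg_min card (vcp3_set G) F"


section \<open>Refined nice tree decompositions\<close>

text \<open>
  The rooted tree is given by parent pointers; the value of \<open>parent\<close> at the root is irrelevant.
  The field \<open>edge_label\<close> is only used by the introduce edge nodes and is \<open>None\<close> at all others.
\<close>

record ('i, 'a) tree_decomp =
  nodes :: "'i set"
  tree_root :: 'i
  parent :: "'i \<Rightarrow> 'i"
  bag :: "'i \<Rightarrow> 'a set"
  edge_label :: "'i \<Rightarrow> 'a set option"

definition rooted_tree :: "('i, 'a) tree_decomp \<Rightarrow> bool" where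
  "rooted_tree D \<longleftrightarrow>
     finite (nodes D) \<and> tree_root D \<in> nodes D \<and>
     (\<forall>i\<in>nodes D - {tree_root D}. parent D i \<in> nodes D) \<and>
     (\<forall>i\<in>nodes D. \<exists>k. (parent D ^^ k) i = tree_root D)"

definition children :: "('i, 'a) tree_decomp \<Rightarrow> 'i \<Rightarrow> 'i set" where
  "children D i = {j \<in> nodes D. j \<noteq> tree_root D \<and> parent D j = i}"

definition tree_adj :: "('i, 'a) tree_decomp \<Rightarrow> 'i \<Rightarrow> 'i \<Rightarrow> bool" where
  "tree_adj D i j \<longleftrightarrow>
     i \<in> nodes D \<and> j \<in> nodes D \<and> (i \<in> children D j \<or> j \<in> children D i)"

definition on_tree_path :: "('i, 'a) tree_decomp \<Rightarrow> 'i \<Rightarrow> 'i \<Rightarrow> 'i \<Rightarrow> bool" where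
  "on_tree_path D i k j \<longleftrightarrow>
     (\<exists>xs. xs \<noteq> [] \<and> set xs \<subseteq> nodes D \<and> distinct xs \<and> successively (tree_adj D) xs \<and>
           hd xs = i \<and> last xs = k \<and> j \<in> set xs)"

definition tree_decomposition :: "'a graph \<Rightarrow> ('i, 'a) tree_decomp \<Rightarrow> bool" where
  "tree_decomposition G D \<longleftrightarrow>
     rooted_tree D \<and>
     (\<forall>i\<in>nodes D. bag D i \<subseteq> verts G) \<and>
     (\<Union>i\<in>nodes D. bag D i) = verts G \<and>
     (\<forall>u v. {u, v} \<in> edges G \<longrightarrow> (\<exists>i\<in>nodes D. u \<in> bag D i \<and> v \<in> bag D i)) \<and>
     (\<forall>i\<in>nodes D. \<forall>k\<in>nodes D. \<forall>j. on_tree_path D i k j \<longrightarrow>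
        bag D i \<inter> bag D k \<subseteq> bag D j)"

text \<open>Integer-valued, because the width is \<open>-1\<close> when all bags are empty.\<close>

definition td_width :: "('i, 'a) tree_decomp \<Rightarrow> int" where
  "td_width D = int (Max ((\<lambda>i. card (bag D i)) ` nodes D)) - 1"

definition leaf_node :: "('i, 'a) tree_decomp \<Rightarrow> 'i \<Rightarrow> bool" where
  "leaf_node D t \<longleftrightarrow> children D t = {} \<and> bag D t = {} \<and> edge_label D t = None"

definition introduce_node :: "('i, 'a) tree_decomp \<Rightarrow> 'i \<Rightarrow> bool" where
  "introduce_node D t \<longleftrightarrow> edge_label D t = None \<and>
     (\<exists>t' v. children D t = {t'} \<and> v \<notin> bag D t' \<and> bag D t = bag D t' \<union> {v})"

definition forget_node :: "('i, 'a) tree_decomp \<Rightarrow> 'i \<Rightarrow> bool" where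
  "forget_node D t \<longleftrightarrow> edge_label D t = None \<and>
     (\<exists>t' v. children D t = {t'} \<and> v \<in> bag D t' \<and> bag D t = bag D t' - {v})"

definition join_node :: "('i, 'a) tree_decomp \<Rightarrow> 'i \<Rightarrow> bool" where
  "join_node D t \<longleftrightarrow> edge_label D t = None \<and>
     (\<exists>t1 t2. t1 \<noteq> t2 \<and> children D t = {t1, t2} \<and> bag D t = bag D t1 \<and> bag D t = bag D t2)"

definition introduce_edge_node :: "'a graph \<Rightarrow> ('i, 'a) tree_decomp \<Rightarrow> 'i \<Rightarrow> bool" where
  "introduce_edge_node G D t \<longleftrightarrow>
     (\<exists>t' u v. edge_label D t = Some {u, v} \<and> {u, v} \<in> edges G \<and>
        children D t = {t'} \<and> u \<in> bag D t \<and> v \<in> bag D t \<and> bag D t = bag D t')"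

definition refined_nice_tree_decomposition :: "'a graph \<Rightarrow> ('i, 'a) tree_decomp \<Rightarrow> bool" where
  "refined_nice_tree_decomposition G D \<longleftrightarrow>
     tree_decomposition G D \<and>
     (\<forall>t\<in>nodes D. card (children D t) \<le> 2) \<and>
     bag D (tree_root D) = {} \<and>
     (\<forall>t\<in>nodes D. leaf_node D t \<or> introduce_node D t \<or> forget_node D t \<or> join_node D t \<or>
        introduce_edge_node G D t) \<and>
     (\<forall>e\<in>edges G. \<exists>!t. t \<in> nodes D \<and> edge_label D t = Some e)"


section \<open>A random access machine with logarithmic cost\<close>

text \<open>
  A program is a structured command over unbounded arrays of natural numbers, the
  arrays being addressed by name and the cells of an array by computed indices. As a
  program mentions only finitely many arrays, they can be interleaved into the single memory
  of a random access machine, at the price of a constant factor in the running time.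

  Arithmetic works on arbitrarily large numbers, so unit cost would be too generous. The
  logarithmic cost criterion is used instead: every subexpression that is
  evaluated, array indices included, is charged the length of the binary representation of
  its value. In particular, every evaluation step costs at least 1, so a bound on this cost is
  also a bound on the number of steps.
\<close>

type_synonym state = "string \<Rightarrow> nat \<Rightarrow> nat"

text \<open>\<open>Sub\<close> is truncated at 0 and \<open>Div\<close> rounds down, as on type \<^typ>\<open>nat\<close>.\<close>

datatype binop = Add | Sub | Mul | Div

datatype exp = Const nat | Load string exp | Arith binop exp exp

datatype com =
    Skip
  | Store string exp exp
  | Seq com com
  | If exp com com
  | While exp com

fun apply_binop :: "binop \<Rightarrow> nat \<Rightarrow> nat \<Rightarrow> nat" where
  "apply_binop Add x y = x + y"
| "apply_binop Sub x y = x - y"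
| "apply_binop Mul x y = x * y"
| "apply_binop Div x y = x div y"

fun exp_val :: "exp \<Rightarrow> state \<Rightarrow> nat" where
  "exp_val (Const c) s = c"
| "exp_val (Load a e) s = s a (exp_val e s)"
| "exp_val (Arith f e1 e2) s = apply_binop f (exp_val e1 s) (exp_val e2 s)"

definition bit_length :: "nat \<Rightarrow> nat" where
  "bit_length x = max 1 (floorlog 2 x)"

fun exp_cost :: "exp \<Rightarrow> state \<Rightarrow> nat" where
  "exp_cost (Const c) s = bit_length c"
| "exp_cost (Load a e) s = exp_cost e s + bit_length (exp_val (Load a e) s)"
| "exp_cost (Arith f e1 e2) s =
     exp_cost e1 s + exp_cost e2 s + bit_length (exp_val (Arith f e1 e2) s)"

text \<open>
  \<open>runs c s t s'\<close>: started in \<open>s\<close>, the command \<open>c\<close> terminates in \<open>s'\<close> with total cost \<open>t\<close>.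
  \<open>Store a e1 e2\<close> assigns the value of \<open>e2\<close> to cell \<open>e1\<close> of array \<open>a\<close>; a condition holds
  if its value is nonzero.
\<close>

inductive runs :: "com \<Rightarrow> state \<Rightarrow> nat \<Rightarrow> state \<Rightarrow> bool" where
  Skip: "runs Skip s 1 s"
| Store: "runs (Store a e1 e2) s (exp_cost e1 s + exp_cost e2 s)
    (s(a := (s a)(exp_val e1 s := exp_val e2 s)))"
| Seq: "runs c1 s t1 s1 \<Longrightarrow> runs c2 s1 t2 s2 \<Longrightarrow> runs (Seq c1 c2) s (t1 + t2) s2"
| IfTrue: "exp_val e s \<noteq> 0 \<Longrightarrow> runs c1 s t s' \<Longrightarrow> runs (If e c1 c2) s (exp_cost e s + t) s'"
| IfFalse: "exp_val e s = 0 \<Longrightarrow> runs c2 s t s' \<Longrightarrow> runs (If e c1 c2) s (exp_cost e s + t) s'"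
| WhileFalse: "exp_val e s = 0 \<Longrightarrow> runs (While e c) s (exp_cost e s) s"
| WhileTrue: "exp_val e s \<noteq> 0 \<Longrightarrow> runs c s t1 s1 \<Longrightarrow> runs (While e c) s1 t2 s2 \<Longrightarrow>
    runs (While e c) s (exp_cost e s + t1 + t2) s2"

inductive_cases SkipE: "runs Skip s t s'"
inductive_cases StoreE: "runs (Store a e1 e2) s t s'"
inductive_cases SeqE: "runs (Seq c1 c2) s t s'"
inductive_cases IfE: "runs (If e c1 c2) s t s'"
inductive_cases WhileE: "runs (While e c) s t s'"

lemma runs_deterministic:
  "runs c s t s' \<Longrightarrow> runs c s u s'' \<Longrightarrow> u = t \<and> s'' = s'"
proof (induction arbitrary: u s'' rule: runs.induct)
  case (Skip s)
  then show ?case by (elim SkipE) simp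
next
  case (Store a e1 e2 s)
  then show ?case by (elim StoreE) simp
next
  case (Seq c1 s t1 s1 c2 t2 s2)
  obtain v1 r1 v2 where r: "runs c1 s v1 r1" "runs c2 r1 v2 s''" "u = v1 + v2"
    using Seq.prems by (rule SeqE)
  have "v1 = t1" "r1 = s1"
    using Seq.IH(1)[OF r(1)] by simp_all
  then show ?case
    using Seq.IH(2)[of v2 s''] r(2,3) by simp
next
  case (IfTrue e s c1 t s' c2)
  obtain v where v: "runs c1 s v s''" "u = exp_cost e s + v"
    using IfTrue.prems by (rule IfE) (use IfTrue.hyps(1) in simp_all)
  show ?case using IfTrue.IH[OF v(1)] v(2) by simp
next
  case (IfFalse e s c2 t s' c1)
  obtain v where v: "runs c2 s v s''" "u = exp_cost e s + v"
    using IfFalse.prems by (rule IfE) (use IfFalse.hyps(1) in simp_all)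
  show ?case using IfFalse.IH[OF v(1)] v(2) by simp
next
  case (WhileFalse e s c)
  from WhileFalse.prems show ?case by (rule WhileE) (use WhileFalse.hyps in simp_all)
next
  case (WhileTrue e s c t1 s1 t2 s2)
  obtain v1 r1 v2 where
    r: "runs c s v1 r1" "runs (While e c) r1 v2 s''" "u = exp_cost e s + v1 + v2"
    using WhileTrue.prems by (rule WhileE) (use WhileTrue.hyps(1) in simp_all)
  have "v1 = t1" "r1 = s1"
    using WhileTrue.IH(1)[OF r(1)] by simp_all
  then show ?case
    using WhileTrue.IH(2)[of v2 s''] r(2,3) by simp
qed


section \<open>Input and output format\<close>

text \<open>
  The vertices are \<open>0, \<dots>, n - 1\<close> and the nodes are \<open>0, \<dots>, N - 1\<close>, in no particular
  order. The graph is given by its adjacency matrix, the tree by its root and the array of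
  parents (the root pointing to itself), and the bags and edge labels by one characteristic
  vector of length \<open>n\<close> per node, which is zero for a missing label. Matrices are stored row by
  row; all other cells are initially 0.
\<close>

definition input_state ::
    "nat \<Rightarrow> nat \<Rightarrow> nat graph \<Rightarrow> (nat, nat) tree_decomp \<Rightarrow> state" where
  "input_state n N G D = (\<lambda>_ _. 0)
     (''n'' := (\<lambda>_. 0)(0 := n),
      ''N'' := (\<lambda>_. 0)(0 := N),
      ''adj'' := (\<lambda>k. if k < n * n then of_bool ({k div n, k mod n} \<in> edges G) else 0),
      ''root'' := (\<lambda>_. 0)(0 := tree_root D),
      ''parent'' := (\<lambda>i. if i < N then if i = tree_root D then i else parent D i else 0),
      ''bag'' := (\<lambda>k. if k < N * n then of_bool (k mod n \<in> bag D (k div n)) else 0),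
      ''label'' := (\<lambda>k. if k < N * n
         then of_bool (\<exists>e. edge_label D (k div n) = Some e \<and> k mod n \<in> e) else 0))"

definition output_set :: "nat \<Rightarrow> state \<Rightarrow> nat set" where
  "output_set n s = {v. v < n \<and> s ''F'' v \<noteq> 0}"

end

theory Submission
  imports Defs "HOL-Library.FuncSet"
begin

text \<open>
  Every vertex gets one of three states: 0 (in the cover \<open>F\<close>), 1 (outside \<open>F\<close> without neighbour
  outside \<open>F\<close>) or 2 (outside \<open>F\<close>, no condition), of weight \<open>U\<close>, \<open>X (U - 1)\<close> and \<open>X\<close>. An edge
  has weight 1 if an end has state 0, \<open>U^2\<close> if both ends have state 2, and 0 otherwise. In the sum
  over all states, \<open>S = V - F\<close> contributes \<open>X^|S| U^(n + 2m - q)\<close>, where \<open>G[S]\<close> has \<open>m\<close> edges and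
  \<open>q\<close> non-isolated vertices. Since \<open>2m \<ge> q\<close>, with equality iff \<open>G[S]\<close> has maximum degree at most 1,
  the sum modulo \<open>U^(n + 1)\<close> is \<open>U^n\<close> times the generating function of the sizes of the complements
  of the \<open>VCP\<^sub>3\<close> sets, provided that \<open>U\<close> is large.

  The states are global, so at a join node the tables of the children are multiplied pointwise:
  no subset convolution is needed, and tables with \<open>3^|bag|\<close> entries of \<open>O(n^3)\<close> bits suffice.
  The size of the sum tells the maximum of \<open>|S|\<close>. Forcing one vertex after the other into \<open>F\<close>
  (weight 0 for the states 1 and 2) as long as this maximum persists yields an optimal \<open>F\<close>
  after \<open>n + 1\<close> evaluations of the sum.
\<close>


section \<open>The partition function\<close>

text \<open>The demand that a vertex outside \<open>F\<close> has at most one neighbour outside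
  \<open>F\<close> is awkward at a join: the neighbour may sit in either subtree, so states
  recording whether it has been met must be split between the children. Moving the demand into the
  exponent \<open>2m - q\<close> removes this memory, since every edge pays for itself where it is
  introduced. The price is large numbers with two nested encodings: \<open>X = 2^(n + 1)\<close>
  exceeds the number of vertex sets, so coefficients do not spill into each other, and
  \<open>U = X^(n + 1)\<close> exceeds the generating function, so the residue is its exact value.
  The modulus is therefore \<open>2^((n + 1)^3)\<close>.

  The bound comes from \<open>n + 1\<close> evaluations, O(pn) nodes, O(n) steps to scan a bag
  vector and O(n^3) per step under logarithmic cost; the 3^(p + 1) table entries per node even leave
  a factor \<open>n\<close> to spare. Nodes arrive unordered and with parent pointers only, so each
  child multiplies its contribution into the row of its parent, in the order of a computed
  height.\<close>

definition edge_factor :: "nat \<Rightarrow> 'a set \<Rightarrow> ('a \<Rightarrow> nat) \<Rightarrow> nat" where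
  "edge_factor U e f =
     (if \<exists>u\<in>e. f u = 0 then 1 else if \<forall>u\<in>e. f u = 2 then U\<^sup>2 else 0)"

definition vertex_weight :: "nat \<Rightarrow> nat \<Rightarrow> 'a set \<Rightarrow> 'a \<Rightarrow> nat \<Rightarrow> nat" where
  "vertex_weight X U M v d =
     (if d = 0 then U else if v \<in> M then 0 else if d = 1 then X * (U - 1) else X)"

definition isolated :: "'a set set \<Rightarrow> 'a set \<Rightarrow> 'a set" where
  "isolated E S = {v\<in>S. \<forall>e\<in>E. e \<subseteq> S \<longrightarrow> v \<notin> e}"

definition inner_edges :: "'a set set \<Rightarrow> 'a set \<Rightarrow> 'a set set" where
  "inner_edges E S = {e\<in>E. e \<subseteq> S}"

definition spin :: "'a set \<Rightarrow> 'a set \<Rightarrow> 'a set \<Rightarrow> 'a \<Rightarrow> nat" where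
  "spin V S I = (\<lambda>v\<in>V. if v \<in> S then if v \<in> I then 1 else 2 else 0)"

text \<open>A state function is the same data as a nested pair: its support \<open>S\<close>, the
  complement of the cover, and the set \<open>I\<close> of vertices in state 1. Summing over
  \<open>I\<close> inside a fixed \<open>S\<close> is what makes the weights collapse.\<close>

lemma sum_spins:
  fixes V :: "'a set"
  shows "(\<Sum>g\<in>V \<rightarrow>\<^sub>E {..<3}. \<Phi> g) = (\<Sum>(S, I)\<in>Sigma (Pow V) Pow. \<Phi> (spin V S I))"
proof (rule sum.reindex_bij_witness[where
      i = "\<lambda>(S, I). spin V S I" and
      j = "\<lambda>g. ({v\<in>V. g v \<noteq> 0}, {v\<in>V. g v = 1})"])
  fix g :: "'a \<Rightarrow> nat" assume g: "g \<in> V \<rightarrow>\<^sub>E {..<3}"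
  show *: "(case ({v\<in>V. g v \<noteq> 0}, {v\<in>V. g v = 1}) of (S, I) \<Rightarrow> spin V S I) = g"
  proof
    fix v
    show "(case ({v\<in>V. g v \<noteq> 0}, {v\<in>V. g v = 1}) of (S, I) \<Rightarrow> spin V S I) v = g v"
    proof (cases "v \<in> V")
      case True
      then have "g v < 3" using g by auto
      then show ?thesis using True by (auto simp: spin_def)
    next
      case False
      then show ?thesis using g by (auto simp: spin_def PiE_def extensional_def)
    qed
  qed
  show "(case ({v\<in>V. g v \<noteq> 0}, {v\<in>V. g v = 1}) of (S, I) \<Rightarrow> \<Phi> (spin V S I)) = \<Phi> g"
    using * by simp
qed (auto simp: spin_def split: if_splits)

text \<open>The factor \<open>X\<close> is common to the states 1 and 2 and hence depends on
  \<open>S\<close> alone; only \<open>U - 1\<close> sees \<open>I\<close>. This leaves a purely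
  binomial sum over \<open>I\<close>.\<close>

lemma prod_vertex_weight_spin:
  assumes "finite V" "S \<subseteq> V" "I \<subseteq> S"
  shows "(\<Prod>v\<in>V. vertex_weight X U M v (spin V S I v)) =
    (if S \<inter> M = {} then U ^ card (V - S) * (X ^ card S * (U - 1) ^ card I) else 0)"
proof -
  have if_then_1: "(\<Prod>v\<in>V. if v \<in> A then c else 1) = (\<Prod>v\<in>A. c)" if "A \<subseteq> V" for A and c :: nat
    using that assms(1) by (intro prod.mono_neutral_cong_right) auto
  show ?thesis
  proof (cases "S \<inter> M = {}")
    case True
    have "(\<Prod>v\<in>V. vertex_weight X U M v (spin V S I v)) =
      (\<Prod>v\<in>V. (if v \<in> V - S then U else 1) * ((if v \<in> S then X else 1) * (if v \<in> I then U - 1 else 1)))"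
      by (rule prod.cong) (use True assms in \<open>auto simp: vertex_weight_def spin_def\<close>)
    also have "\<dots> = (\<Prod>v\<in>V - S. U) * ((\<Prod>v\<in>S. X) * (\<Prod>v\<in>I. U - 1))"
      unfolding prod.distrib using assms
      by (simp only: if_then_1[of "V - S"] if_then_1[of S] if_then_1[of I] Diff_subset subset_trans[of I S V])
    finally show ?thesis using True by simp
  next
    case False
    then obtain v where v: "v \<in> S" "v \<in> M" by auto
    then have "vertex_weight X U M v (spin V S I v) = 0"
      using assms by (auto simp: vertex_weight_def spin_def)
    then show ?thesis using False v assms by (auto intro!: prod_zero)
  qed
qed

text \<open>State 1 is a claim of isolation that any edge inside \<open>S\<close> at this vertex
  refutes by its factor 0. Edges not contained in \<open>S\<close> are neutral.\<close>

lemma prod_edge_factor_spin: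
  assumes "finite E" "\<forall>e\<in>E. e \<subseteq> V" "S \<subseteq> V" "I \<subseteq> S"
  shows "(\<Prod>e\<in>E. edge_factor U e (spin V S I)) =
    (if I \<subseteq> isolated E S then U ^ (2 * card (inner_edges E S)) else 0)"
proof (cases "I \<subseteq> isolated E S")
  case True
  have "(\<Prod>e\<in>E. edge_factor U e (spin V S I)) = (\<Prod>e\<in>E. if e \<subseteq> S then U\<^sup>2 else 1)"
  proof (rule prod.cong)
    fix e assume e: "e \<in> E"
    show "edge_factor U e (spin V S I) = (if e \<subseteq> S then U\<^sup>2 else 1)"
    proof (cases "e \<subseteq> S")
      case eS: True
      then have "e \<inter> I = {}" using True e by (auto simp: isolated_def)
      then have "\<forall>u\<in>e. spin V S I u = 2" using eS assms by (auto simp: spin_def)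
      then show ?thesis using eS by (auto simp: edge_factor_def)
    next
      case False
      then obtain u where "u \<in> e" "u \<notin> S" by auto
      moreover have "u \<in> V" using \<open>u \<in> e\<close> e assms by auto
      ultimately have "\<exists>u\<in>e. spin V S I u = 0" by (auto simp: spin_def intro!: bexI[of _ u])
      then show ?thesis using False by (auto simp: edge_factor_def)
    qed
  qed simp
  also have "\<dots> = (\<Prod>e\<in>inner_edges E S. U\<^sup>2)"
    unfolding inner_edges_def using assms(1) by (rule prod.inter_filter[symmetric])
  finally show ?thesis using True by (simp add: power_mult)
next
  case False
  then obtain v e where v: "v \<in> I" "v \<in> e" "e \<in> E" "e \<subseteq> S"
    using assms by (auto simp: isolated_def)
  have "\<forall>u\<in>e. spin V S I u \<noteq> 0" using v assms by (auto simp: spin_def)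
  moreover have "spin V S I v = 1" using v assms by (auto simp: spin_def)
  ultimately have "edge_factor U e (spin V S I) = 0"
    using v by (auto simp: edge_factor_def)
  then show ?thesis using False v assms by (auto intro!: prod_zero)
qed

text \<open>By the binomial theorem the weights \<^term>\<open>U - 1\<close>, summed over all sets of isolated vertices,
  yield one factor \<^term>\<open>U\<close> per isolated vertex.\<close>

lemma partition_function:
  assumes "finite V" "finite E" "\<forall>e\<in>E. e \<subseteq> V" "U \<ge> 1"
  shows "(\<Sum>g\<in>V \<rightarrow>\<^sub>E {..<3}. (\<Prod>v\<in>V. vertex_weight X U M v (g v)) * (\<Prod>e\<in>E. edge_factor U e g)) =
    (\<Sum>S\<in>Pow (V - M). X ^ card S *
        U ^ (card (V - S) + card (isolated E S) + 2 * card (inner_edges E S)))"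
proof -
  have "(\<Sum>g\<in>V \<rightarrow>\<^sub>E {..<3}. (\<Prod>v\<in>V. vertex_weight X U M v (g v)) * (\<Prod>e\<in>E. edge_factor U e g)) =
    (\<Sum>S\<in>Pow V. \<Sum>I\<in>Pow S. (\<Prod>v\<in>V. vertex_weight X U M v (spin V S I v)) *
      (\<Prod>e\<in>E. edge_factor U e (spin V S I)))"
    unfolding sum_spins using assms(1) by (subst sum.Sigma) (auto intro: finite_subset)
  also have "\<dots> = (\<Sum>S\<in>Pow V. if S \<inter> M = {} then X ^ card S *
        U ^ (card (V - S) + card (isolated E S) + 2 * card (inner_edges E S)) else 0)"
  proof (rule sum.cong)
    fix S assume S: "S \<in> Pow V"
    have fS: "finite S" using S assms(1) by (auto intro: finite_subset)
    have iso: "isolated E S \<subseteq> S" by (auto simp: isolated_def)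
    have "(\<Sum>I\<in>Pow S. (\<Prod>v\<in>V. vertex_weight X U M v (spin V S I v)) *
        (\<Prod>e\<in>E. edge_factor U e (spin V S I))) =
      (\<Sum>I\<in>Pow S. if I \<subseteq> isolated E S then
        (if S \<inter> M = {} then U ^ card (V - S) * (X ^ card S * (U - 1) ^ card I) else 0) *
         U ^ (2 * card (inner_edges E S)) else 0)"
      by (rule sum.cong) (use S assms in \<open>auto simp: prod_vertex_weight_spin prod_edge_factor_spin\<close>)
    also have "\<dots> = (\<Sum>I\<in>Pow (isolated E S).
        (if S \<inter> M = {} then U ^ card (V - S) * (X ^ card S * (U - 1) ^ card I) else 0) *
         U ^ (2 * card (inner_edges E S)))"
      using fS iso by (intro sum.mono_neutral_cong_right) auto
    also have "\<dots> = (if S \<inter> M = {} then X ^ card S * U ^ card (V - S) *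
        U ^ (2 * card (inner_edges E S)) * (\<Sum>I\<in>Pow (isolated E S). (U - 1) ^ card I) else 0)"
      by (cases "S \<inter> M = {}") (simp_all add: sum_distrib_left ac_simps)
    also have "(\<Sum>I\<in>Pow (isolated E S). (U - 1) ^ card I) = U ^ card (isolated E S)"
      using prod_add[of "isolated E S" "\<lambda>_. U - 1" "\<lambda>_. 1"] iso fS assms(4)
      by (simp add: finite_subset)
    finally show "(\<Sum>I\<in>Pow S. (\<Prod>v\<in>V. vertex_weight X U M v (spin V S I v)) *
        (\<Prod>e\<in>E. edge_factor U e (spin V S I))) =
      (if S \<inter> M = {} then X ^ card S *
        U ^ (card (V - S) + card (isolated E S) + 2 * card (inner_edges E S)) else 0)"
      by (simp add: power_add mult_ac)
  qed simp
  also have "\<dots> = (\<Sum>S\<in>Pow (V - M). X ^ card S *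
        U ^ (card (V - S) + card (isolated E S) + 2 * card (inner_edges E S)))"
    using assms(1) by (intro sum.mono_neutral_cong_right) auto
  finally show ?thesis .
qed

section \<open>Dissociation sets and their generating function\<close>

definition dissociation :: "'a set set \<Rightarrow> 'a set \<Rightarrow> bool" where
  "dissociation E S \<longleftrightarrow> (\<forall>v\<in>S. card {e\<in>inner_edges E S. v \<in> e} \<le> 1)"

lemma sum_of_bool_card:
  assumes "finite A"
  shows "(\<Sum>x\<in>A. of_bool (P x)) = card {x\<in>A. P x}"
proof -
  have "{x\<in>A. P x} = A \<inter> {x. P x}" by auto
  then show ?thesis using assms by (simp only: sum_of_bool_eq of_nat_id)
qed

text \<open>Double counting of incidences turns twice the number of edges into the sum of the
  degrees, so the count is the sum over \<open>S\<close> of \<open>deg v\<close> with 1 in place of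
  0. Every summand is at least 1, and all are equal to 1 iff no degree exceeds 1: a local degree
  condition has become the extremal case of one global count.\<close>

lemma isolated_plus_edges:
  assumes "finite V" "finite E" "\<forall>e\<in>E. e \<subseteq> V \<and> card e = 2" "S \<subseteq> V"
  shows "card S \<le> card (isolated E S) + 2 * card (inner_edges E S)"
    and "card (isolated E S) + 2 * card (inner_edges E S) = card S \<longleftrightarrow> dissociation E S"
proof -
  define deg where "deg v = card {e\<in>inner_edges E S. v \<in> e}" for v
  have fS: "finite S" and fI: "finite (inner_edges E S)"
    using assms by (auto simp: inner_edges_def intro: finite_subset)
  have "(\<Sum>v\<in>S. deg v) = (\<Sum>v\<in>S. \<Sum>e\<in>inner_edges E S. of_bool (v \<in> e))"
    unfolding deg_def using fI by (simp only: sum_of_bool_card)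
  also have "\<dots> = (\<Sum>e\<in>inner_edges E S. \<Sum>v\<in>S. of_bool (v \<in> e))"
    by (rule sum.swap)
  also have "\<dots> = (\<Sum>e\<in>inner_edges E S. 2)"
  proof (rule sum.cong)
    fix e assume "e \<in> inner_edges E S"
    then have "{v\<in>S. v \<in> e} = e" "card e = 2" using assms by (auto simp: inner_edges_def)
    then show "(\<Sum>v\<in>S. of_bool (v \<in> e)) = (2::nat)" using sum_of_bool_card[OF fS, of "\<lambda>v. v \<in> e"] by simp
  qed simp
  finally have hs: "(\<Sum>v\<in>S. deg v) = 2 * card (inner_edges E S)" by simp
  have "isolated E S = {v\<in>S. deg v = 0}"
  proof -
    have "deg v = 0 \<longleftrightarrow> {e\<in>inner_edges E S. v \<in> e} = {}" for v
      unfolding deg_def using fI by (intro card_0_eq) simp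
    then have "deg v = 0 \<longleftrightarrow> (\<forall>e\<in>E. e \<subseteq> S \<longrightarrow> v \<notin> e)" for v
      unfolding inner_edges_def by blast
    then show ?thesis by (simp only: isolated_def)
  qed
  then have "card (isolated E S) = (\<Sum>v\<in>S. of_bool (deg v = 0))"
    using fS by (simp only: sum_of_bool_card)
  then have eq: "card (isolated E S) + 2 * card (inner_edges E S) =
      (\<Sum>v\<in>S. of_bool (deg v = 0) + deg v)"
    using hs by (simp add: sum.distrib)
  have le: "1 \<le> of_bool (deg v = 0) + deg v" for v by simp
  have "card S = (\<Sum>v\<in>S. 1)" by simp
  also have "\<dots> \<le> (\<Sum>v\<in>S. of_bool (deg v = 0) + deg v)"
    by (rule sum_mono) (rule le)
  finally show "card S \<le> card (isolated E S) + 2 * card (inner_edges E S)" using eq by simp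
  show "card (isolated E S) + 2 * card (inner_edges E S) = card S \<longleftrightarrow> dissociation E S"
  proof
    assume "dissociation E S"
    then have "(\<Sum>v\<in>S. of_bool (deg v = 0) + deg v) = (\<Sum>v\<in>S. 1)"
    proof (intro sum.cong refl)
      fix v assume "v \<in> S"
      then have "deg v \<le> 1" using \<open>dissociation E S\<close> by (simp add: dissociation_def deg_def)
      then show "of_bool (deg v = 0) + deg v = 1" by (cases "deg v") auto
    qed
    then show "card (isolated E S) + 2 * card (inner_edges E S) = card S" using eq by simp
  next
    assume a: "card (isolated E S) + 2 * card (inner_edges E S) = card S"
    show "dissociation E S"
      unfolding dissociation_def
    proof (rule ballI, rule ccontr)
      fix v assume v: "v \<in> S" "\<not> card {e\<in>inner_edges E S. v \<in> e} \<le> 1"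
      then have "1 < deg v" by (simp add: deg_def)
      then have "(\<Sum>v\<in>S. 1) < (\<Sum>v\<in>S. of_bool (deg v = 0) + deg v)"
        using fS le v(1) by (intro sum_strict_mono_ex1) (auto intro: bexI[of _ v])
      then show False using a eq by simp
    qed
  qed
qed

text \<open>The generating function by size, evaluated at one number. Once \<open>X\<close> exceeds
  the number of subsets of \<open>R\<close>, the value is a base-\<open>X\<close> numeral whose
  digits are the numbers of dissociation sets of each size.\<close>

definition dissociation_poly :: "nat \<Rightarrow> 'a set set \<Rightarrow> 'a set \<Rightarrow> nat" where
  "dissociation_poly X E R = (\<Sum>S\<in>{S. S \<subseteq> R \<and> dissociation E S}. X ^ card S)"

text \<open>There are at most \<open>2 ^ card R\<close> summands, each at most \<open>X ^ j\<close>,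
  and \<open>X\<close> exceeds their number, so nothing is carried into the next place.\<close>

lemma dissociation_poly_less:
  assumes "finite R" "\<And>S. S \<subseteq> R \<Longrightarrow> dissociation E S \<Longrightarrow> card S \<le> j" "2 ^ card R < X"
  shows "dissociation_poly X E R < X ^ Suc j"
proof -
  have "dissociation_poly X E R \<le> (\<Sum>S\<in>{S. S \<subseteq> R \<and> dissociation E S}. X ^ j)"
    unfolding dissociation_poly_def using assms by (intro sum_mono power_increasing) auto
  also have "\<dots> = card {S. S \<subseteq> R \<and> dissociation E S} * X ^ j" by simp
  also have "card {S. S \<subseteq> R \<and> dissociation E S} \<le> card (Pow R)"
    using assms(1) by (intro card_mono) auto
  also have "\<dots> = 2 ^ card R" using assms(1) by (rule card_Pow)
  also have "2 ^ card R * X ^ j < X ^ Suc j" using assms(3) by simp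
  finally show ?thesis by simp
qed

text \<open>The length of the numeral is the largest size. Comparisons with powers of
  \<open>X\<close> thus decide everything, and the program never has to extract a
  coefficient.\<close>

lemma dissociation_poly_ge_iff:
  assumes "finite R" "2 ^ card R < X"
  shows "X ^ j \<le> dissociation_poly X E R \<longleftrightarrow> (\<exists>S\<subseteq>R. dissociation E S \<and> j \<le> card S)"
proof
  assume "\<exists>S\<subseteq>R. dissociation E S \<and> j \<le> card S"
  then obtain S where S: "S \<subseteq> R" "dissociation E S" "j \<le> card S" by auto
  have "X ^ j \<le> X ^ card S" using S assms by (intro power_increasing) auto
  also have "\<dots> \<le> dissociation_poly X E R"
    unfolding dissociation_poly_def using S assms(1) by (intro member_le_sum) auto
  finally show "X ^ j \<le> dissociation_poly X E R" .
next
  assume a: "X ^ j \<le> dissociation_poly X E R"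
  show "\<exists>S\<subseteq>R. dissociation E S \<and> j \<le> card S"
  proof (rule ccontr)
    assume b: "\<not> ?thesis"
    \<comment> \<open>The empty set is a dissociation set of size 0, so a size that is not attained
      is positive and \<open>j - 1\<close> bounds all sizes.\<close>
    then have "j \<noteq> 0" by (auto simp: dissociation_def intro: exI[of _ "{}"])
    have "dissociation_poly X E R < X ^ Suc (j - 1)"
      by (rule dissociation_poly_less) (use assms b in \<open>auto simp: not_le\<close>)
    then show False using a \<open>j \<noteq> 0\<close> by simp
  qed
qed

text \<open>A set that is no dissociation set has exponent at least \<open>card V + 1\<close> and
  vanishes modulo \<open>U ^ Suc (card V)\<close>; any other set has exponent exactly
  \<open>card V\<close>. The remaining sum is smaller than the modulus because \<open>U\<close>
  exceeds the generating function, so no information is lost by the reduction.\<close>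

lemma partition_function_mod:
  assumes "finite V" "finite E" "\<forall>e\<in>E. e \<subseteq> V \<and> card e = 2"
    and X: "2 ^ card V < X" and U: "U = X ^ Suc (card V)"
  shows "(\<Sum>g\<in>V \<rightarrow>\<^sub>E {..<3}. (\<Prod>v\<in>V. vertex_weight X U M v (g v)) * (\<Prod>e\<in>E. edge_factor U e g))
      mod U ^ Suc (card V) = U ^ card V * dissociation_poly X E (V - M)"
proof -
  let ?n = "card V"
  have U1: "U \<ge> 1" using X U by (simp add: Suc_leI)
  define term' where "term' S = X ^ card S * U ^ (card (V - S) + card (isolated E S) + 2 * card (inner_edges E S))" for S
  have t: "term' S mod U ^ Suc ?n = (if dissociation E S then U ^ ?n * X ^ card S else 0) mod U ^ Suc ?n"
    if "S \<subseteq> V" for S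
  proof -
    have n: "card (V - S) + card S = ?n"
      using that assms(1) by (simp add: card_Diff_subset finite_subset card_mono)
    note * = isolated_plus_edges[OF assms(1-3) that]
    show ?thesis
    proof (cases "dissociation E S")
      case True
      then show ?thesis using * n by (simp add: term'_def mult.commute add.assoc)
    next
      case False
      then have "card S < card (isolated E S) + 2 * card (inner_edges E S)"
        using * by linarith
      then have "Suc ?n \<le> card (V - S) + card (isolated E S) + 2 * card (inner_edges E S)"
        using n by linarith
      then have "U ^ Suc ?n dvd term' S"
        unfolding term'_def by (intro dvd_mult le_imp_power_dvd)
      then show ?thesis using False by auto
    qed
  qed
  have fin: "finite (Pow (V - M))" using assms(1) by simp
  have "(\<Sum>S\<in>Pow (V - M). term' S) mod U ^ Suc ?n =
    (\<Sum>S\<in>Pow (V - M). term' S mod U ^ Suc ?n) mod U ^ Suc ?n"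
    by (simp only: mod_sum_eq)
  also have "\<dots> = (\<Sum>S\<in>Pow (V - M). (if dissociation E S then U ^ ?n * X ^ card S else 0) mod U ^ Suc ?n) mod U ^ Suc ?n"
    by (intro arg_cong[where f = "\<lambda>x. x mod _"] sum.cong t) auto
  also have "\<dots> = (\<Sum>S\<in>Pow (V - M). if dissociation E S then U ^ ?n * X ^ card S else 0) mod U ^ Suc ?n"
    by (simp only: mod_sum_eq)
  also have "(\<Sum>S\<in>Pow (V - M). if dissociation E S then U ^ ?n * X ^ card S else 0) =
      (\<Sum>S\<in>{S \<in> Pow (V - M). dissociation E S}. U ^ ?n * X ^ card S)"
    by (rule sum.inter_filter[symmetric]) (rule fin)
  also have "\<dots> = U ^ ?n * dissociation_poly X E (V - M)"
    by (simp add: dissociation_poly_def sum_distrib_left)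
  also have "\<dots> mod U ^ Suc ?n = \<dots>"
  proof -
    have "card (V - M) \<le> ?n" using assms(1) by (simp add: card_mono)
    then have "2 ^ card (V - M) < X" using X
      by (meson le_less_trans one_le_numeral power_increasing)
    then have "dissociation_poly X E (V - M) < U" unfolding U
      using assms(1) by (intro dissociation_poly_less) (auto intro!: card_mono)
    then have "U ^ ?n * dissociation_poly X E (V - M) < U ^ ?n * U"
      using U1 by simp
    then show ?thesis by (simp add: mult.commute)
  qed
  finally show ?thesis
    using partition_function[OF assms(1,2) _ U1, of X M] assms(3)
    unfolding term'_def by simp
qed

section \<open>Vertex cover P3 sets as complements of dissociation sets\<close>

lemma P3_in_inner_edges:
  assumes "simple_graph G"
  shows "(\<exists>u v w. P3_in G u v w \<and> {u, v, w} \<subseteq> S) \<longleftrightarrow> \<not> dissociation (edges G) S"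
proof -
  have fE: "finite (edges G)"
    using assms unfolding simple_graph_def by (meson Pow_iff finite_Pow_iff finite_subset subsetI)
  show ?thesis
  proof
    assume "\<exists>u v w. P3_in G u v w \<and> {u, v, w} \<subseteq> S"
    then obtain u v w where p: "distinct [u, v, w]" "{u, v} \<in> edges G" "{v, w} \<in> edges G" "{u, v, w} \<subseteq> S"
      by (auto simp: P3_in_def)
    have "card {{u, v}, {v, w}} \<le> card {e \<in> inner_edges (edges G) S. v \<in> e}"
      using p fE by (intro card_mono) (auto simp: inner_edges_def)
    moreover have "card {{u, v}, {v, w}} = 2"
      using p by (auto simp: doubleton_eq_iff card_insert_if)
    ultimately have "\<not> card {e \<in> inner_edges (edges G) S. v \<in> e} \<le> 1" by linarith
    then show "\<not> dissociation (edges G) S" using p by (auto simp: dissociation_def)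
  next
    assume "\<not> dissociation (edges G) S"
    then obtain v where v: "v \<in> S" "\<not> card {e \<in> inner_edges (edges G) S. v \<in> e} \<le> Suc 0"
      by (auto simp: dissociation_def)
    moreover have "finite {e \<in> inner_edges (edges G) S. v \<in> e}"
      using fE by (auto simp: inner_edges_def)
    ultimately obtain e1 e2 where e: "e1 \<in> inner_edges (edges G) S" "e2 \<in> inner_edges (edges G) S"
      "v \<in> e1" "v \<in> e2" "e1 \<noteq> e2"
      by (auto simp: card_le_Suc0_iff_eq)
    have "card e1 = 2" "card e2 = 2"
      using e assms by (auto simp: inner_edges_def simple_graph_def)
    then obtain u w where uw: "e1 = {u, v}" "e2 = {v, w}" "u \<noteq> v" "w \<noteq> v"
      using e(3,4) by (auto simp: card_2_iff insert_commute)
    then have "P3_in G u v w" "{u, v, w} \<subseteq> S"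
      using e by (auto simp: P3_in_def inner_edges_def)
    then show "\<exists>u v w. P3_in G u v w \<and> {u, v, w} \<subseteq> S" by blast
  qed
qed

lemma vcp3_set_iff_dissociation:
  assumes "simple_graph G"
  shows "vcp3_set G F \<longleftrightarrow> F \<subseteq> verts G \<and> dissociation (edges G) (verts G - F)"
proof -
  have "{u, v, w} \<inter> F \<noteq> {} \<longleftrightarrow> \<not> {u, v, w} \<subseteq> verts G - F" if "P3_in G u v w" for u v w
  proof -
    have "{u, v, w} \<subseteq> verts G" using that assms by (auto simp: P3_in_def simple_graph_def)
    then show ?thesis by auto
  qed
  then show ?thesis
    unfolding vcp3_set_def using P3_in_inner_edges[OF assms, of "verts G - F"] by meson
qed


section \<open>Dynamic programming over the tree decomposition\<close>

text \<open>Marginalisation over the variables in \<open>Y\<close>. With total functions and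
  \<open>override_on\<close>, \<open>f\<close> supplies the states outside \<open>Y\<close> and its
  values on \<open>Y\<close> are discarded, so partial assignments need no bookkeeping of
  domains.\<close>

definition sum_out :: "'a set \<Rightarrow> (('a \<Rightarrow> nat) \<Rightarrow> nat) \<Rightarrow> ('a \<Rightarrow> nat) \<Rightarrow> nat" where
  "sum_out Y h f = (\<Sum>g\<in>Y \<rightarrow>\<^sub>E {..<3}. h (override_on f g Y))"

text \<open>The scope of a factor, in a semantic sense: \<open>A\<close> may be any set containing
  the relevant variables, so scopes can be enlarged freely.\<close>

definition depends_on :: "'a set \<Rightarrow> (('a \<Rightarrow> nat) \<Rightarrow> nat) \<Rightarrow> bool" where
  "depends_on A h \<longleftrightarrow> (\<forall>f f'. (\<forall>x\<in>A. f x = f' x) \<longrightarrow> h f = h f')"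

lemma depends_onD: "depends_on A h \<Longrightarrow> (\<And>x. x \<in> A \<Longrightarrow> f x = f' x) \<Longrightarrow> h f = h f'"
  by (auto simp: depends_on_def)

lemma sum_out_empty [simp]: "sum_out {} h f = h f"
  by (simp add: sum_out_def)

lemma sum_out_insert:
  assumes "v \<notin> Y"
  shows "sum_out (insert v Y) h f = (\<Sum>d<3. sum_out Y h (f(v := d)))"
proof -
  have "sum_out (insert v Y) h f =
      (\<Sum>(d, g)\<in>{..<3} \<times> (Y \<rightarrow>\<^sub>E {..<3}). h (override_on f (g(v := d)) (insert v Y)))"
    unfolding sum_out_def PiE_insert_eq
    by (subst sum.reindex[OF inj_combinator[OF assms]]) (simp add: case_prod_unfold)
  also have "\<dots> = (\<Sum>d<3. sum_out Y h (f(v := d)))"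
    unfolding sum_out_def sum.cartesian_product using assms
    by (intro sum.cong) (auto intro!: arg_cong[where f = h] simp: override_on_def)
  finally show ?thesis .
qed

lemma sum_out_Un:
  assumes "finite A" "A \<inter> B = {}"
  shows "sum_out (A \<union> B) h f = sum_out A (sum_out B h) f"
  using assms
proof (induction A arbitrary: f rule: finite_induct)
  case (insert v A)
  then show ?case by (simp add: sum_out_insert)
qed simp

lemma sum_out_cong:
  assumes "\<And>f'. (\<And>x. x \<notin> Y \<Longrightarrow> f' x = f x) \<Longrightarrow> h f' = h' f'"
  shows "sum_out Y h f = sum_out Y h' f"
  unfolding sum_out_def by (intro sum.cong refl assms) (auto simp: override_on_def)

text \<open>Distributivity: a factor whose scope avoids \<open>Y\<close> is constant during the
  summation. All elimination of variables rests on this.\<close>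

lemma sum_out_mult_left:
  assumes "depends_on A h1" "A \<inter> Y = {}"
  shows "sum_out Y (\<lambda>f. h1 f * h2 f) f = h1 f * sum_out Y h2 f"
proof -
  have "h1 (override_on f g Y) = h1 f" for g
    by (rule depends_onD[OF assms(1)]) (use assms(2) in \<open>auto simp: override_on_def\<close>)
  then show ?thesis by (simp add: sum_out_def sum_distrib_left)
qed

lemma depends_on_sum_out:
  assumes "depends_on A h"
  shows "depends_on (A - Y) (sum_out Y h)"
  unfolding depends_on_def sum_out_def
proof (intro allI impI sum.cong refl)
  fix f f' :: "'a \<Rightarrow> nat" and g
  assume "\<forall>x\<in>A - Y. f x = f' x"
  then show "h (override_on f g Y) = h (override_on f' g Y)"
    by (intro depends_onD[OF assms]) (auto simp: override_on_def)
qed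

lemma depends_on_mono: "depends_on A h \<Longrightarrow> A \<subseteq> B \<Longrightarrow> depends_on B h"
  unfolding depends_on_def by blast

lemma depends_on_prod:
  assumes "\<And>i. i \<in> C \<Longrightarrow> depends_on A (h i)"
  shows "depends_on A (\<lambda>f. \<Prod>i\<in>C. h i f)"
  using assms unfolding depends_on_def by (metis (no_types, lifting) prod.cong)

lemma depends_on_mult:
  "depends_on A h1 \<Longrightarrow> depends_on A h2 \<Longrightarrow> depends_on A (\<lambda>f. h1 f * h2 f)"
  unfolding depends_on_def by metis

lemma depends_on_vertex: "v \<in> A \<Longrightarrow> depends_on A (\<lambda>f. w (f v))"
  unfolding depends_on_def by metis

lemma sum_out_mult:
  assumes "finite A" "A \<inter> B = {}" "depends_on V1 h1" "depends_on V2 h2"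
    "V1 \<inter> B = {}" "V2 \<inter> A = {}"
  shows "sum_out (A \<union> B) (\<lambda>f. h1 f * h2 f) f = sum_out A h1 f * sum_out B h2 f"
proof -
  have "sum_out (A \<union> B) (\<lambda>f. h1 f * h2 f) f = sum_out A (\<lambda>f. sum_out B h2 f * h1 f) f"
    unfolding sum_out_Un[OF assms(1,2)]
    by (intro sum_out_cong) (simp add: sum_out_mult_left[OF assms(3,5)] mult.commute)
  also have "\<dots> = sum_out B h2 f * sum_out A h1 f"
    by (rule sum_out_mult_left[OF depends_on_sum_out[OF assms(4)]]) (use assms(6) in auto)
  finally show ?thesis by (simp add: mult.commute)
qed

text \<open>The scopes \<open>W j\<close> may overlap, but no scope touches the private variables
  \<open>Z k\<close> of another factor. With the shared variables fixed by \<open>f\<close> the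
  factors are independent, and a sum of products becomes a product of sums. This is the algebra
  behind the join.\<close>

lemma sum_out_prod:
  assumes "finite C" "\<And>j. j \<in> C \<Longrightarrow> finite (Z j)" "\<And>j. j \<in> C \<Longrightarrow> depends_on (W j) (h j)"
    and "\<And>j k. j \<in> C \<Longrightarrow> k \<in> C \<Longrightarrow> j \<noteq> k \<Longrightarrow> W j \<inter> Z k = {}" "\<And>j. j \<in> C \<Longrightarrow> Z j \<subseteq> W j"
  shows "sum_out (\<Union>j\<in>C. Z j) (\<lambda>f. \<Prod>j\<in>C. h j f) f = (\<Prod>j\<in>C. sum_out (Z j) (h j) f)"
  using assms
proof (induction C rule: finite_induct)
  case (insert j C)
  have d: "depends_on (\<Union>k\<in>C. W k) (\<lambda>f. \<Prod>k\<in>C. h k f)"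
    using insert.prems(2) by (intro depends_on_prod) (auto intro: depends_on_mono)
  have jC: "j \<noteq> k" if "k \<in> C" for k using insert.hyps that by auto
  have WZ: "W j \<inter> Z k = {}" "W k \<inter> Z j = {}" if "k \<in> C" for k
    using insert.prems(3) jC[OF that] that by auto
  have "sum_out (Z j \<union> (\<Union>k\<in>C. Z k)) (\<lambda>f. h j f * (\<Prod>k\<in>C. h k f)) f =
      sum_out (Z j) (h j) f * sum_out (\<Union>k\<in>C. Z k) (\<lambda>f. \<Prod>k\<in>C. h k f) f"
  proof (rule sum_out_mult[OF _ _ insert.prems(2) d])
    show "finite (Z j)" using insert.prems by simp
    show "Z j \<inter> (\<Union>k\<in>C. Z k) = {}" using WZ insert.prems(4)[of j] by blast
    show "W j \<inter> (\<Union>k\<in>C. Z k) = {}" using WZ by blast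
    show "(\<Union>k\<in>C. W k) \<inter> Z j = {}" using WZ by blast
  qed simp
  then show ?case using insert by simp
qed simp


section \<open>Rooted trees given by parent pointers\<close>

locale decomposed_graph =
  fixes G :: "nat graph" and D :: "(nat, nat) tree_decomp" and n N :: nat
  assumes simple: "simple_graph G" and verts: "verts G = {..<n}"
    and refined: "refined_nice_tree_decomposition G D" and nodes: "nodes D = {..<N}"
begin

abbreviation "E \<equiv> edges G"
abbreviation "B \<equiv> bag D"
abbreviation "rt \<equiv> tree_root D"

text \<open>The root becomes a fixed point, as in the stored array. Climbing beyond the root is then
  harmless, and iterates can be counted up to a uniform bound.\<close>

definition par :: "nat \<Rightarrow> nat" where
  "par i = (if i = rt then i else parent D i)"

text \<open>This is \<open>N\<close> minus the depth. It rises by exactly one per step towards the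
  root and is computable from parent pointers alone, without lists of children.\<close>

definition height :: "nat \<Rightarrow> nat" where
  "height i = card {k. k < N \<and> (par ^^ k) i = rt}"

definition below :: "nat \<Rightarrow> nat set" where
  "below t = {i. i < N \<and> (\<exists>k. (par ^^ k) i = t)}"

lemma decomp: "tree_decomposition G D"
  using refined by (simp add: refined_nice_tree_decomposition_def)

lemma rooted: "rooted_tree D"
  using decomp by (simp add: tree_decomposition_def)

lemma root_less: "rt < N"
  using rooted nodes by (auto simp: rooted_tree_def)

lemma par_root [simp]: "par rt = rt"
  by (simp add: par_def)

lemma funpow_par_root [simp]: "(par ^^ k) rt = rt"
  by (induction k) auto

lemma par_less: "i < N \<Longrightarrow> par i < N"
  using rooted nodes by (auto simp: rooted_tree_def par_def)

lemma funpow_par_less: "i < N \<Longrightarrow> (par ^^ k) i < N"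
  by (induction k) (auto intro: par_less)

lemma funpow_par_mono: "(par ^^ k) i = rt \<Longrightarrow> k \<le> l \<Longrightarrow> (par ^^ l) i = rt"
  by (metis funpow_add funpow_par_root le_add_diff_inverse2 o_apply)

text \<open>\<open>rooted_tree\<close> speaks of \<open>parent\<close>, whose value at the root is
  arbitrary, so its iterates may pass through the root and wander on. Stopping at the first visit
  gives an iterate of \<open>par\<close>.\<close>

lemma ex_funpow_par_root:
  assumes "i < N" shows "\<exists>k. (par ^^ k) i = rt"
proof -
  have "\<exists>k. (parent D ^^ k) i = rt" using assms rooted nodes by (auto simp: rooted_tree_def)
  then obtain k where "(parent D ^^ k) i = rt" ..
  then show ?thesis
  proof (induction k arbitrary: i)
    case 0
    then have "(par ^^ 0) i = rt" by simp
    then show ?case by blast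
  next
    case (Suc k)
    show ?case
    proof (cases "i = rt")
      case True
      then have "(par ^^ 0) i = rt" by simp
      then show ?thesis by blast
    next
      case False
      have "(parent D ^^ k) (parent D i) = rt" using Suc.prems by (simp add: funpow_swap1)
      then obtain l where "(par ^^ l) (parent D i) = rt" using Suc.IH by blast
      then have "(par ^^ Suc l) i = rt" using False by (simp add: funpow_swap1 par_def)
      then show ?thesis by blast
    qed
  qed
qed

text \<open>The sets \<open>R k\<close> of nodes within distance \<open>k\<close> of the root grow
  by at least one node per step until they are complete, so \<open>N\<close> steps suffice.\<close>

lemma funpow_par_N:
  assumes "i < N" shows "(par ^^ N) i = rt"
proof -
  define R where "R k = {i. i < N \<and> (par ^^ k) i = rt}" for k
  have fin: "finite (R k)" for k by (simp add: R_def)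
  have sub: "R k \<subseteq> R (Suc k)" for k
    using funpow_par_mono[of k _ "Suc k"] by (auto simp: R_def)
  have stable: "R k = {..<N}" if "R (Suc k) = R k" for k
  proof -
    have "R (k + l) = R k" for l
    proof (induction l)
      case (Suc l)
      have "i \<in> R (k + l)" if i: "i \<in> R (k + Suc l)" for i
      proof -
        have "par i \<in> R (k + l)" using i by (auto simp: R_def funpow_swap1 par_less)
        then have "i \<in> R (Suc k)" using i Suc by (auto simp: R_def funpow_swap1)
        then show ?thesis using Suc \<open>R (Suc k) = R k\<close> by simp
      qed
      then show ?case using Suc sub[of "k + l"] by auto
    qed simp
    moreover have "i \<in> R k \<or> (\<exists>l. i \<in> R (k + l))" if i: "i < N" for i
    proof -
      obtain l where "(par ^^ l) i = rt" using ex_funpow_par_root[OF i] by blast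
      then have "i \<in> R (k + l)" using i funpow_par_mono[of l i "k + l"] by (simp add: R_def)
      then show ?thesis by blast
    qed
    ultimately show ?thesis by (auto simp: R_def)
  qed
  have "min N (Suc k) \<le> card (R k)" for k
  proof (induction k)
    case 0
    have "rt \<in> R 0" using root_less by (simp add: R_def)
    then have "0 < card (R 0)" using fin card_gt_0_iff by blast
    then show ?case by simp
  next
    case (Suc k)
    show ?case
    proof (cases "R (Suc k) = R k")
      case True
      then show ?thesis using stable[OF True] by simp
    next
      case False
      then have "card (R k) < card (R (Suc k))" using sub fin by (intro psubset_card_mono) auto
      then show ?thesis using Suc by simp
    qed
  qed
  from this[of N] have "card {..<N} \<le> card (R N)" by simp
  then have "R N = {..<N}" by (intro card_seteq) (auto simp: R_def)
  then show ?thesis using assms by (auto simp: R_def)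
qed

lemma height_root: "height rt = N"
  by (simp add: height_def)

lemma height_less:
  assumes "i < N" "i \<noteq> rt" shows "height i < N"
proof -
  have "0 \<in> {..<N} - {k. k < N \<and> (par ^^ k) i = rt}" using assms by simp
  then have "{k. k < N \<and> (par ^^ k) i = rt} \<subset> {..<N}" by blast
  then have "height i < card {..<N}" unfolding height_def by (intro psubset_card_mono) auto
  then show ?thesis by simp
qed

lemma height_par:
  assumes "i < N" "i \<noteq> rt" shows "height (par i) = Suc (height i)"
proof -
  define S where "S = {k. k < N \<and> (par ^^ k) i = rt}"
  \<comment> \<open>Starting one step higher shifts all hits down by one. The shift brings in the
    index \<open>N\<close>, always a hit by \<open>funpow_par_N\<close>, and loses nothing, because
    0 is no hit for a node other than the root.\<close>
  have S: "insert N S = Suc ` {k. k < N \<and> (par ^^ k) (par i) = rt}"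
  proof (rule set_eqI)
    fix k
    show "k \<in> insert N S \<longleftrightarrow> k \<in> Suc ` {k. k < N \<and> (par ^^ k) (par i) = rt}"
    proof (cases k)
      case 0
      then show ?thesis using assms by (auto simp: S_def)
    next
      case (Suc l)
      then show ?thesis using funpow_par_N[OF assms(1)] by (auto simp: S_def funpow_swap1)
    qed
  qed
  have "finite S" "N \<notin> S" by (auto simp: S_def)
  then have "Suc (card S) = card (insert N S)" by simp
  also have "\<dots> = card {k. k < N \<and> (par ^^ k) (par i) = rt}"
    unfolding S by (rule card_image) simp
  finally show ?thesis by (simp add: height_def S_def)
qed

lemma children_eq: "children D t = {j. j < N \<and> j \<noteq> rt \<and> par j = t}"
  by (auto simp: children_def nodes par_def)

lemma below_height:
  assumes "i \<in> below t" shows "height i \<le> height t"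
proof -
  obtain k where "i < N" "(par ^^ k) i = t" using assms by (auto simp: below_def)
  then show ?thesis
  proof (induction k arbitrary: i)
    case (Suc k)
    have "height (par i) \<le> height t"
      using Suc.prems by (intro Suc.IH) (auto simp: funpow_swap1 par_less)
    then show ?case using height_par[of i] Suc.prems by (cases "i = rt") auto
  qed simp
qed

lemma child_height: "j \<in> children D t \<Longrightarrow> height t = Suc (height j)"
  using height_par by (auto simp: children_eq)

lemma finite_children [simp]: "finite (children D t)"
  by (rule finite_subset[of _ "{..<N}"]) (auto simp: children_eq)

lemma below_less: "i \<in> below t \<Longrightarrow> i < N"
  by (simp add: below_def)

lemma finite_below [simp]: "finite (below t)"
  by (rule finite_subset[of _ "{..<N}"]) (auto simp: below_def)

lemma below_root: "below rt = {..<N}"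
  using ex_funpow_par_root by (auto simp: below_def)

lemma self_below: "t < N \<Longrightarrow> t \<in> below t"
  by (auto simp: below_def intro!: exI[of _ 0])

lemma below_eq:
  assumes "t < N" shows "below t = insert t (\<Union>j\<in>children D t. below j)"
proof (intro equalityI subsetI)
  fix i assume "i \<in> below t"
  then obtain k where k: "i < N" "(par ^^ k) i = t" by (auto simp: below_def)
  then show "i \<in> insert t (\<Union>j\<in>children D t. below j)"
  proof (induction k)
    case (Suc k)
    define j where "j = (par ^^ k) i"
    have j: "j < N" "par j = t" using Suc.prems by (auto simp: j_def intro: funpow_par_less)
    show ?case
    proof (cases "j = rt")
      \<comment> \<open>A climb may linger at the root, which \<open>par\<close> fixes. In this case
        \<open>t\<close> is the root itself, and one step fewer leads there too.\<close>
      case True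
      then show ?thesis using Suc j by (simp add: j_def)
    next
      case False
      then have "j \<in> children D t" using j by (simp add: children_eq)
      moreover have "i \<in> below j" using Suc.prems by (auto simp: below_def j_def)
      ultimately show ?thesis by blast
    qed
  qed simp
next
  fix i assume i: "i \<in> insert t (\<Union>j\<in>children D t. below j)"
  show "i \<in> below t"
  proof (cases "i = t")
    case True
    then show ?thesis using assms self_below by simp
  next
    case False
    then obtain j k where "j \<in> children D t" "i < N" "(par ^^ k) i = j"
      using i by (auto simp: below_def)
    then have "(par ^^ Suc k) i = t" by (simp add: children_eq)
    then show ?thesis using \<open>i < N\<close> unfolding below_def by blast
  qed
qed

lemma not_below_child: "j \<in> children D t \<Longrightarrow> t \<notin> below j"
  using below_height child_height by fastforce

text \<open>On a climb through both \<open>j\<close> and \<open>k\<close>, the later one would be a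
  proper ancestor of the earlier. The climb would go through \<open>t\<close> and come back to a
  child of \<open>t\<close>, against the heights.\<close>

lemma below_disjoint:
  assumes "j \<in> children D t" "k \<in> children D t" "j \<noteq> k"
  shows "below j \<inter> below k = {}"
proof -
  have no: "(par ^^ Suc d) j \<noteq> k" if "j \<in> children D t" "k \<in> children D t" for d j k
  proof
    assume "(par ^^ Suc d) j = k"
    then have "(par ^^ d) t = k" using that by (simp add: children_eq funpow_swap1)
    moreover have "t < N" using that par_less by (auto simp: children_eq)
    ultimately have "t \<in> below k" by (auto simp: below_def)
    then show False using not_below_child that by simp
  qed
  have False if "i \<in> below j" "i \<in> below k" for i
  proof -
    obtain a b where ab: "(par ^^ a) i = j" "(par ^^ b) i = k"
      using \<open>i \<in> below j\<close> \<open>i \<in> below k\<close> unfolding below_def by blast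
    consider "a = b" | d where "b = Suc d + a" | d where "a = Suc d + b"
      by (metis add.commute add_Suc less_imp_Suc_add linorder_neqE_nat)
    then show False
    proof cases
      case 1
      then show ?thesis using ab assms by simp
    next
      case 2
      then have "(par ^^ Suc d) j = k" using ab by (metis comp_apply funpow_add)
      then show ?thesis using no assms by blast
    next
      case 3
      then have "(par ^^ Suc d) k = j" using ab by (metis comp_apply funpow_add)
      then show ?thesis using no assms by blast
    qed
  qed
  then show ?thesis by auto
qed

lemma bag_less: "i < N \<Longrightarrow> v \<in> B i \<Longrightarrow> v < n"
  using decomp verts nodes by (auto simp: tree_decomposition_def)

lemma finite_bag: "i < N \<Longrightarrow> finite (B i)"
  using bag_less by (meson finite_nat_set_iff_bounded)

lemma bag_path:
  assumes "i < N" "k < N" "on_tree_path D i k j" "v \<in> B i" "v \<in> B k"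
  shows "v \<in> B j"
  using decomp assms unfolding tree_decomposition_def nodes by blast

section \<open>Bags as separators\<close>

definition climb :: "nat \<Rightarrow> nat \<Rightarrow> nat list" where
  "climb i k = map (\<lambda>l. (par ^^ l) i) [0..<Suc k]"

text \<open>The nodes on the climb are distinct because their heights rise by one each time. This
  requires that the root is not met, which holds since the end \<open>j\<close> is a child and the
  root can never be left again.\<close>

lemma climb:
  assumes "j \<in> children D t" "i < N" "(par ^^ k) i = j"
  shows "climb i k \<noteq> []" "hd (climb i k) = i" "last (climb i k) = j" "set (climb i k) \<subseteq> below j"
    "distinct (climb i k)" "successively (tree_adj D) (climb i k)"
proof -
  show "climb i k \<noteq> []" "hd (climb i k) = i" "last (climb i k) = j"
    using assms(3) by (auto simp: climb_def hd_map simp del: upt_Suc) (simp add: last_map)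
  have "(par ^^ (k - l)) ((par ^^ l) i) = j" if "l < Suc k" for l
    using assms(3) that by (metis comp_apply funpow_add le_add_diff_inverse2 less_Suc_eq_le)
  then have "(par ^^ l) i \<in> below j" if "l < Suc k" for l
    using that funpow_par_less[OF assms(2)] unfolding below_def by blast
  then show "set (climb i k) \<subseteq> below j"
    by (auto simp: climb_def simp del: upt_Suc)
  have nr: "(par ^^ l) i \<noteq> rt" if "l \<le> k" for l
    using funpow_par_mono[OF _ that] assms by (auto simp: children_eq)
  have h: "height ((par ^^ l) i) = height i + l" if "l \<le> k" for l
    using that
  proof (induction l)
    case (Suc l)
    then show ?case using height_par[of "(par ^^ l) i"] nr[of l] funpow_par_less[OF assms(2)] by simp
  qed simp
  have "inj_on (\<lambda>l. (par ^^ l) i) {0..<Suc k}"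
  proof (rule inj_onI)
    fix a b assume ab: "a \<in> {0..<Suc k}" "b \<in> {0..<Suc k}" "(par ^^ a) i = (par ^^ b) i"
    have "height ((par ^^ a) i) = height i + a" "height ((par ^^ b) i) = height i + b"
      using ab(1,2) by (intro h; simp)+
    then show "a = b" unfolding ab(3) by linarith
  qed
  then show "distinct (climb i k)" by (simp add: climb_def distinct_map del: upt_Suc)
  show "successively (tree_adj D) (climb i k)"
  proof -
    have "tree_adj D ((par ^^ l) i) ((par ^^ Suc l) i)" if "l < k" for l
      using that nr[of l] funpow_par_less[OF assms(2)] par_less
      by (auto simp: tree_adj_def nodes children_eq)
    then show ?thesis
      unfolding successively_conv_nth by (auto simp: climb_def simp del: upt_Suc)
  qed
qed

lemma child_tree_adj: "j \<in> children D t \<Longrightarrow> tree_adj D j t"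
  using par_less by (auto simp: tree_adj_def nodes children_eq)

lemma tree_adj_sym: "tree_adj D i j \<Longrightarrow> tree_adj D j i"
  by (auto simp: tree_adj_def)

text \<open>The tree path from \<open>i\<close> to \<open>t\<close> is the climb to \<open>j\<close>
  extended by \<open>t\<close>. Whatever the subtree of \<open>j\<close> shares with
  \<open>B t\<close> is therefore visible in \<open>B j\<close>.\<close>

lemma bag_child_separates:
  assumes "j \<in> children D t" "i \<in> below j" "v \<in> B i" "v \<in> B t"
  shows "v \<in> B j"
proof -
  obtain k where k: "i < N" "(par ^^ k) i = j" using assms by (auto simp: below_def)
  have t: "t < N" using assms par_less by (auto simp: children_eq)
  note c = climb[OF assms(1) k]
  have "on_tree_path D i t j"
    unfolding on_tree_path_def
  proof (intro exI conjI)
    let ?xs = "climb i k @ [t]"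
    show "set ?xs \<subseteq> nodes D" using c(4) t below_less by (auto simp: nodes)
    show "distinct ?xs" using c(4,5) not_below_child[OF assms(1)] by auto
    show "successively (tree_adj D) ?xs"
      using c(1,3,6) child_tree_adj[OF assms(1)] by (simp add: successively_append_iff)
    show "hd ?xs = i" using c(1,2) by simp
    show "j \<in> set ?xs" using c(1,3) by (metis UnCI last_in_set set_append)
  qed auto
  then show ?thesis using bag_path k(1) t assms(3,4) by blast
qed

text \<open>The path consists of the climb from \<open>i\<close>, the node \<open>t\<close> and the
  reversed climb from \<open>i'\<close>. Hence vertices outside \<open>B t\<close> that occur below
  different children are distinct, which is what turns a join into a product.\<close>

lemma bag_parent_separates:
  assumes "j \<in> children D t" "j' \<in> children D t" "j \<noteq> j'" "i \<in> below j" "i' \<in> below j'"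
    "v \<in> B i" "v \<in> B i'"
  shows "v \<in> B t"
proof -
  obtain k where k: "i < N" "(par ^^ k) i = j" using assms by (auto simp: below_def)
  obtain k' where k': "i' < N" "(par ^^ k') i' = j'" using assms by (auto simp: below_def)
  have t: "t < N" using assms par_less by (auto simp: children_eq)
  note c = climb[OF assms(1) k] and c' = climb[OF assms(2) k']
  have "on_tree_path D i i' t"
    unfolding on_tree_path_def
  proof (intro exI conjI)
    let ?xs = "climb i k @ t # rev (climb i' k')"
    show "set ?xs \<subseteq> nodes D" using c(4) c'(4) t below_less by (auto simp: nodes)
    show "distinct ?xs"
      using c(4,5) c'(4,5) not_below_child assms(1,2) below_disjoint[OF assms(1-3)] by auto
    have "successively (tree_adj D) (rev (climb i' k'))"
      using c'(6) by (simp add: successively_rev) (auto elim: successively_mono intro: tree_adj_sym)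
    then show "successively (tree_adj D) ?xs"
      using c(1,3,6) c'(1,3) child_tree_adj[OF assms(1)] child_tree_adj[OF assms(2)]
      by (simp add: successively_append_iff successively_Cons hd_rev tree_adj_sym)
    show "hd ?xs = i" using c(1,2) by simp
    show "last ?xs = i'" using c'(1,2) by (simp add: last_rev)
  qed auto
  then show ?thesis using bag_path k(1) k'(1) assms(6,7) by blast
qed


section \<open>Partial sums over subtrees\<close>

definition region :: "nat \<Rightarrow> nat set" where
  "region t = (\<Union>i\<in>below t. B i)"

definition label_factor :: "nat \<Rightarrow> nat \<Rightarrow> (nat \<Rightarrow> nat) \<Rightarrow> nat" where
  "label_factor U t f = (case edge_label D t of None \<Rightarrow> 1 | Some e \<Rightarrow> edge_factor U e f)"

definition weight_on :: "nat \<Rightarrow> nat \<Rightarrow> nat set \<Rightarrow> nat set \<Rightarrow> (nat \<Rightarrow> nat) \<Rightarrow> nat" where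
  "weight_on X U M Y f = (\<Prod>v\<in>Y. vertex_weight X U M v (f v))"

text \<open>The part of the partition function belonging to the subtree of \<^term>\<open>t\<close>; the vertices of the
  bag of \<^term>\<open>t\<close> are neither summed out nor weighted yet, so that a join is a plain product.\<close>

definition table :: "nat \<Rightarrow> nat \<Rightarrow> nat set \<Rightarrow> nat \<Rightarrow> (nat \<Rightarrow> nat) \<Rightarrow> nat" where
  "table X U M t = sum_out (region t - B t)
     (\<lambda>f. weight_on X U M (region t - B t) f * (\<Prod>i\<in>below t. label_factor U i f))"

text \<open>The message sent from \<open>j\<close> to its parent \<open>t\<close>. A vertex is
  weighted and summed out exactly when it leaves the bag; at every other kind of node the difference
  is empty and the message is the table of the child itself.\<close>

definition transfer :: "nat \<Rightarrow> nat \<Rightarrow> nat set \<Rightarrow> nat \<Rightarrow> nat \<Rightarrow> (nat \<Rightarrow> nat) \<Rightarrow> nat" where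
  "transfer X U M t j = sum_out (B j - B t) (\<lambda>f. weight_on X U M (B j - B t) f * table X U M j f)"

lemma node_type:
  assumes "t < N"
  shows "leaf_node D t \<or> introduce_node D t \<or> forget_node D t \<or> join_node D t \<or>
    introduce_edge_node G D t"
proof -
  have "t \<in> nodes D" using assms by (simp add: nodes)
  then show ?thesis using refined by (simp add: refined_nice_tree_decomposition_def)
qed

lemma label_cases:
  assumes "t < N"
  obtains "edge_label D t = None"
  | u v where "edge_label D t = Some {u, v}" "{u, v} \<in> E" "u \<in> B t" "v \<in> B t"
proof -
  note t = node_type[OF assms]
  have "edge_label D t = None \<or>
      (\<exists>u v. edge_label D t = Some {u, v} \<and> {u, v} \<in> E \<and> u \<in> B t \<and> v \<in> B t)"
    using t unfolding leaf_node_def introduce_node_def forget_node_def join_node_def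
      introduce_edge_node_def by metis
  then show ?thesis using that by metis
qed

text \<open>The recursion sees the node types only through the difference of two adjacent bags:
  joins and introduce edge nodes both give equal bags, and a leaf is ruled out by the child.\<close>

lemma child_bag_cases:
  assumes "j \<in> children D t" "t < N"
  obtains "B t = B j"
  | v where "v \<notin> B j" "B t = insert v (B j)"
  | v where "v \<notin> B t" "B j = insert v (B t)"
proof -
  have "B t = B j \<or> (\<exists>v. v \<notin> B j \<and> B t = insert v (B j)) \<or>
      (\<exists>v. v \<in> B j \<and> B t = B j - {v})"
    using node_type[OF assms(2)]
  proof (elim disjE)
    assume "leaf_node D t"
    then show ?thesis using assms(1) by (simp add: leaf_node_def)
  next
    assume "introduce_node D t"
    then obtain k v where "children D t = {k}" "v \<notin> B k" "B t = B k \<union> {v}"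
      unfolding introduce_node_def by blast
    then show ?thesis using assms(1) by auto
  next
    assume "forget_node D t"
    then obtain k v where "children D t = {k}" "v \<in> B k" "B t = B k - {v}"
      unfolding forget_node_def by blast
    then show ?thesis using assms(1) by auto
  next
    assume "join_node D t"
    then obtain k l where "children D t = {k, l}" "B t = B k" "B t = B l"
      unfolding join_node_def by metis
    then have "j = k \<or> j = l" using assms(1) by simp
    then show ?thesis using \<open>B t = B k\<close> \<open>B t = B l\<close> by metis
  next
    assume "introduce_edge_node G D t"
    then obtain k where "children D t = {k}" "B t = B k"
      unfolding introduce_edge_node_def by blast
    then show ?thesis using assms(1) by auto
  qed
  then show ?thesis
  proof (elim disjE exE conjE)
    assume "B t = B j"
    then show ?thesis by (rule that(1))
  next
    fix v assume "v \<notin> B j" "B t = insert v (B j)"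
    then show ?thesis by (rule that(2))
  next
    fix v assume "v \<in> B j" "B t = B j - {v}"
    then show ?thesis by (intro that(3)[of v]) auto
  qed
qed

lemma finite_region [simp]: "finite (region t)"
  by (auto simp: region_def below_less finite_bag)

lemma region_mono: "i \<in> below t \<Longrightarrow> B i \<subseteq> region t"
  by (auto simp: region_def)

lemma child_less: "j \<in> children D t \<Longrightarrow> j < N"
  by (simp add: children_eq)

lemma region_eq: "t < N \<Longrightarrow> region t = B t \<union> (\<Union>j\<in>children D t. region j)"
  by (simp add: region_def below_eq)

lemma depends_on_label_factor:
  assumes "t < N" shows "depends_on (B t) (label_factor U t)"
  unfolding depends_on_def
proof (intro allI impI)
  fix f f' :: "nat \<Rightarrow> nat"
  assume f: "\<forall>x\<in>B t. f x = f' x"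
  show "label_factor U t f = label_factor U t f'"
  proof (rule label_cases[OF assms])
    fix u v assume "edge_label D t = Some {u, v}" "u \<in> B t" "v \<in> B t"
    then show ?thesis using f by (simp add: label_factor_def edge_factor_def)
  qed (simp add: label_factor_def)
qed

lemma depends_on_weight_on: "Y \<subseteq> A \<Longrightarrow> depends_on A (weight_on X U M Y)"
  unfolding weight_on_def by (intro depends_on_prod depends_on_vertex) auto

lemma depends_on_labels_below: "depends_on (region t) (\<lambda>f. \<Prod>i\<in>below t. label_factor U i f)"
  by (intro depends_on_prod depends_on_mono[OF depends_on_label_factor region_mono] below_less)

lemma depends_on_table:
  assumes "t < N"
  shows "depends_on (B t) (table X U M t)"
  unfolding table_def
  by (rule depends_on_mono, rule depends_on_sum_out, rule depends_on_mult,
      rule depends_on_weight_on[of _ "region t"], blast, rule depends_on_labels_below) auto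

lemma weight_on_Un:
  "finite A \<Longrightarrow> finite C \<Longrightarrow> A \<inter> C = {} \<Longrightarrow> weight_on X U M (A \<union> C) f = weight_on X U M A f * weight_on X U M C f"
  unfolding weight_on_def by (rule prod.union_disjoint)

text \<open>By the separator property, \<open>region j - B t\<close> splits into the vertices that
  leave the bag at \<open>t\<close> and those gone before. Summing in two stages moves the weights
  of the former in front of the inner sum, which is the table of \<open>j\<close>.\<close>

lemma transfer_eq:
  assumes "j \<in> children D t" "t < N"
  shows "transfer X U M t j f = sum_out (region j - B t)
    (\<lambda>f. weight_on X U M (region j - B t) f * (\<Prod>i\<in>below j. label_factor U i f)) f"
proof -
  have j: "j < N" using assms(1) by (rule child_less)
  have sep: "region j \<inter> B t \<subseteq> B j"
    using bag_child_separates[OF assms(1)] by (auto simp: region_def)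
  have Bj: "B j \<subseteq> region j" using j by (intro region_mono self_below)
  have split: "region j - B t = (B j - B t) \<union> (region j - B j)" using sep Bj by auto
  have disj: "(B j - B t) \<inter> (region j - B j) = {}" by auto
  have fin: "finite (B j - B t)" using finite_bag[OF j] by simp
  show ?thesis
    unfolding split sum_out_Un[OF fin disj] transfer_def table_def
  proof (rule sum_out_cong)
    fix f' :: "nat \<Rightarrow> nat"
    have "sum_out (region j - B j)
       (\<lambda>f. weight_on X U M (B j - B t \<union> (region j - B j)) f * (\<Prod>i\<in>below j. label_factor U i f)) f' =
      sum_out (region j - B j) (\<lambda>f. weight_on X U M (B j - B t) f *
        (weight_on X U M (region j - B j) f * (\<Prod>i\<in>below j. label_factor U i f))) f'"
      using disj fin by (intro sum_out_cong) (simp add: weight_on_Un)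
    also have "\<dots> = weight_on X U M (B j - B t) f' * sum_out (region j - B j)
        (\<lambda>f. weight_on X U M (region j - B j) f * (\<Prod>i\<in>below j. label_factor U i f)) f'"
      by (rule sum_out_mult_left[OF depends_on_weight_on[OF order_refl] disj])
    finally show "weight_on X U M (B j - B t) f' * sum_out (region j - B j)
        (\<lambda>f. weight_on X U M (region j - B j) f * (\<Prod>i\<in>below j. label_factor U i f)) f' =
      sum_out (region j - B j)
       (\<lambda>f. weight_on X U M (B j - B t \<union> (region j - B j)) f * (\<Prod>i\<in>below j. label_factor U i f)) f'"
      by simp
  qed
qed

text \<open>One recursion for all node types: the product is empty at a leaf, has one factor at a
  unary node and two at a join. The label factor comes out because its edge lies in
  \<open>B t\<close>; the rest factorises because the private vertices of the children are
  disjoint.\<close>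

lemma table_rec:
  assumes "t < N"
  shows "table X U M t f = label_factor U t f * (\<Prod>j\<in>children D t. transfer X U M t j f)"
proof -
  let ?C = "children D t"
  define Z where "Z j = region j - B t" for j
  define h where "h j f = weight_on X U M (Z j) f * (\<Prod>i\<in>below j. label_factor U i f)" for j f
  have RZ: "region j \<inter> Z k = {}" if "j \<in> ?C" "k \<in> ?C" "j \<noteq> k" for j k
    using bag_parent_separates[OF that] by (auto simp: Z_def region_def)
  have Y: "region t - B t = (\<Union>j\<in>?C. Z j)"
    using region_eq[OF assms] by (auto simp: Z_def)
  have finZ: "finite (Z j)" for j by (simp add: Z_def)
  have W: "weight_on X U M (\<Union>j\<in>?C. Z j) f = (\<Prod>j\<in>?C. weight_on X U M (Z j) f)" for f
    unfolding weight_on_def using finZ RZ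
    by (intro prod.UNION_disjoint) (auto simp: Z_def)
  have L: "(\<Prod>i\<in>below t. label_factor U i f) =
      label_factor U t f * (\<Prod>j\<in>?C. \<Prod>i\<in>below j. label_factor U i f)" for f
  proof -
    have "(\<Prod>i\<in>(\<Union>j\<in>?C. below j). label_factor U i f) = (\<Prod>j\<in>?C. \<Prod>i\<in>below j. label_factor U i f)"
      using below_disjoint by (intro prod.UNION_disjoint) auto
    moreover have "t \<notin> (\<Union>j\<in>?C. below j)" using not_below_child by auto
    ultimately show ?thesis by (simp add: below_eq[OF assms])
  qed
  have "table X U M t f = sum_out (\<Union>j\<in>?C. Z j) (\<lambda>f. label_factor U t f * (\<Prod>j\<in>?C. h j f)) f"
    unfolding table_def Y by (intro sum_out_cong) (simp add: W L h_def prod.distrib mult_ac)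
  also have "\<dots> = label_factor U t f * sum_out (\<Union>j\<in>?C. Z j) (\<lambda>f. \<Prod>j\<in>?C. h j f) f"
    by (rule sum_out_mult_left[OF depends_on_label_factor[OF assms]]) (auto simp: Z_def)
  also have "sum_out (\<Union>j\<in>?C. Z j) (\<lambda>f. \<Prod>j\<in>?C. h j f) f = (\<Prod>j\<in>?C. sum_out (Z j) (h j) f)"
  proof (rule sum_out_prod[where W = region])
    show "depends_on (region j) (h j)" for j
      unfolding h_def
      by (intro depends_on_mult depends_on_weight_on depends_on_labels_below) (auto simp: Z_def)
  qed (use RZ finZ in \<open>auto simp: Z_def\<close>)
  also have "(\<Prod>j\<in>?C. sum_out (Z j) (h j) f) = (\<Prod>j\<in>?C. transfer X U M t j f)"
    using assms by (intro prod.cong refl) (simp add: transfer_eq Z_def h_def[abs_def])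
  finally show ?thesis .
qed

lemma bag_root: "B rt = {}"
  using refined by (simp add: refined_nice_tree_decomposition_def)

lemma region_root: "region rt = {..<n}"
  using decomp by (simp add: region_def below_root tree_decomposition_def nodes verts)

lemma finite_E: "finite E"
  using simple unfolding simple_graph_def by (meson Pow_iff finite_Pow_iff finite_subset subsetI)

text \<open>Since every edge is introduced exactly once, labelled nodes and edges correspond
  bijectively, and no edge factor is missing or repeated.\<close>

lemma prod_labels: "(\<Prod>i<N. label_factor U i f) = (\<Prod>e\<in>E. edge_factor U e f)"
proof -
  define J where "J = {i. i < N \<and> edge_label D i \<noteq> None}"
  have u: "\<forall>e\<in>E. \<exists>!t. t < N \<and> edge_label D t = Some e"
    using refined unfolding refined_nice_tree_decomposition_def nodes by simp
  have "(\<Prod>i<N. label_factor U i f) = (\<Prod>i\<in>J. edge_factor U (the (edge_label D i)) f)"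
    by (rule prod.mono_neutral_cong_right) (auto simp: J_def label_factor_def)
  also have "\<dots> = (\<Prod>e\<in>E. edge_factor U e f)"
  proof (rule prod.reindex_bij_betw)
    show "bij_betw (\<lambda>i. the (edge_label D i)) J E"
      unfolding bij_betw_def
    proof
      have inE: "\<exists>e\<in>E. edge_label D i = Some e" if "i \<in> J" for i
        by (rule label_cases[of i]) (use that in \<open>auto simp: J_def\<close>)
      show "inj_on (\<lambda>i. the (edge_label D i)) J"
      proof (rule inj_onI)
        fix i j assume ij: "i \<in> J" "j \<in> J" "the (edge_label D i) = the (edge_label D j)"
        obtain e e' where "e \<in> E" "edge_label D i = Some e" "edge_label D j = Some e'"
          using inE ij by blast
        then show "i = j" using u ij by (auto simp: J_def)
      qed
      show "(\<lambda>i. the (edge_label D i)) ` J = E"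
      proof
        show "(\<lambda>i. the (edge_label D i)) ` J \<subseteq> E" using inE by fastforce
        show "E \<subseteq> (\<lambda>i. the (edge_label D i)) ` J"
        proof
          fix e assume "e \<in> E"
          then obtain t where "t < N" "edge_label D t = Some e" using u by blast
          then show "e \<in> (\<lambda>i. the (edge_label D i)) ` J"
            by (intro image_eqI[of _ _ t]) (auto simp: J_def)
        qed
      qed
    qed
  qed
  finally show ?thesis .
qed

text \<open>The bag of the root is empty, so all vertices have been weighted and summed out, and the
  table is the whole partition function, constant in \<open>f\<close>.\<close>

lemma table_root:
  assumes X: "2 ^ n < X" and U: "U = X ^ Suc n"
  shows "table X U M rt f mod U ^ Suc n = U ^ n * dissociation_poly X E ({..<n} - M)"
proof -
  have eq: "table X U M rt f = (\<Sum>g\<in>{..<n} \<rightarrow>\<^sub>E {..<3}.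
      (\<Prod>v<n. vertex_weight X U M v (g v)) * (\<Prod>e\<in>E. edge_factor U e g))"
    unfolding table_def region_root bag_root below_root Diff_empty sum_out_def prod_labels weight_on_def
  proof (rule sum.cong, rule refl)
    fix g :: "nat \<Rightarrow> nat"
    have "edge_factor U e (override_on f g {..<n}) = edge_factor U e g" if "e \<in> E" for e
    proof -
      have "e \<subseteq> {..<n}" using simple that verts by (auto simp: simple_graph_def)
      then have "override_on f g {..<n} u = g u" if "u \<in> e" for u using that by auto
      then show ?thesis by (simp add: edge_factor_def)
    qed
    then show "(\<Prod>v<n. vertex_weight X U M v (override_on f g {..<n} v)) *
        (\<Prod>e\<in>E. edge_factor U e (override_on f g {..<n})) =
      (\<Prod>v<n. vertex_weight X U M v (g v)) * (\<Prod>e\<in>E. edge_factor U e g)"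
      by simp
  qed
  have "\<forall>e\<in>E. e \<subseteq> {..<n} \<and> card e = 2"
    using simple by (simp add: simple_graph_def verts)
  then show ?thesis
    unfolding eq using partition_function_mod[of "{..<n}" E X U M] finite_E X U by simp
qed

end


section \<open>Table indices\<close>

definition rank :: "nat set \<Rightarrow> nat \<Rightarrow> nat" where
  "rank A v = card {u\<in>A. u < v}"

definition digit :: "nat \<Rightarrow> nat \<Rightarrow> nat" where
  "digit x r = (x div 3 ^ r) mod 3"

text \<open>The states on a bag are numbered in base 3, the digit positions being the vertices of
  the bag in increasing order. The numbering depends on the bag only, so rows of parent and child
  are translated by inserting or deleting one digit.\<close>

definition decode :: "nat set \<Rightarrow> nat \<Rightarrow> nat \<Rightarrow> nat" where
  "decode A x v = digit x (rank A v)"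

definition ins_digit :: "nat \<Rightarrow> nat \<Rightarrow> nat \<Rightarrow> nat" where
  "ins_digit r d x = (x div 3 ^ r) * (3 * 3 ^ r) + d * 3 ^ r + x mod 3 ^ r"

definition del_digit :: "nat \<Rightarrow> nat \<Rightarrow> nat" where
  "del_digit r x = (x div (3 * 3 ^ r)) * 3 ^ r + x mod 3 ^ r"

lemma digit_low:
  assumes "q < r" "lo < 3 ^ r"
  shows "digit (k * 3 ^ r + lo) q = digit lo q"
proof -
  obtain e where e: "r = q + Suc e" using assms(1) less_imp_Suc_add by fastforce
  have "k * 3 ^ r + lo = lo + (k * 3 ^ e * 3) * 3 ^ q" by (simp add: e power_add)
  then have "(k * 3 ^ r + lo) div 3 ^ q = k * 3 ^ e * 3 + lo div 3 ^ q"
    by (simp only: div_mult_self1) simp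
  then show ?thesis by (simp add: digit_def)
qed

lemma digit_ins_digit:
  assumes "d < 3"
  shows "digit (ins_digit r d x) q =
    (if q < r then digit x q else if q = r then d else digit x (q - 1))"
proof -
  have eq: "ins_digit r d x = (3 * (x div 3 ^ r) + d) * 3 ^ r + x mod 3 ^ r"
    by (simp add: ins_digit_def algebra_simps)
  have hi: "ins_digit r d x div 3 ^ r = 3 * (x div 3 ^ r) + d"
    unfolding eq by simp
  consider "q < r" | "q = r" | e where "q = r + Suc e"
    using less_imp_Suc_add by (metis add_Suc_right linorder_neqE_nat)
  then show ?thesis
  proof cases
    case 1
    have "digit x q = digit (x div 3 ^ r * 3 ^ r + x mod 3 ^ r) q"
      by (simp only: div_mult_mod_eq)
    also have "\<dots> = digit (x mod 3 ^ r) q" by (rule digit_low[OF 1]) simp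
    finally show ?thesis using 1 digit_low[OF 1, of "x mod 3 ^ r"] by (simp add: eq)
  next
    case 2
    then show ?thesis using assms by (simp add: digit_def hi)
  next
    case 3
    have "ins_digit r d x div 3 ^ q = ins_digit r d x div 3 ^ r div 3 div 3 ^ e"
      by (simp add: 3 power_add ac_simps flip: div_mult2_eq)
    also have "\<dots> = x div 3 ^ r div 3 ^ e"
      using assms by (simp add: hi)
    also have "\<dots> = x div 3 ^ (q - 1)" by (simp add: 3 power_add div_mult2_eq)
    finally show ?thesis using 3 by (simp add: digit_def)
  qed
qed

lemma ins_digit_less:
  assumes "x < 3 ^ c" "r \<le> c" "d < 3"
  shows "ins_digit r d x < 3 ^ Suc c"
proof -
  obtain e where c: "c = r + e" using assms(2) le_Suc_ex by blast
  have "x div 3 ^ r < 3 ^ e" using assms(1) by (simp add: c power_add less_mult_imp_div_less mult.commute)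
  then have "(x div 3 ^ r + 1) * (3 * 3 ^ r) \<le> 3 ^ e * (3 * 3 ^ r)" by (intro mult_right_mono) auto
  then have "x div 3 ^ r * (3 * 3 ^ r) + 3 * 3 ^ r \<le> 3 ^ e * (3 * 3 ^ r)" by (simp only: distrib_right mult_1)
  moreover have "d * 3 ^ r \<le> 2 * 3 ^ r" using assms(3) by (intro mult_right_mono) auto
  moreover have "x mod 3 ^ r < 3 ^ r" by simp
  ultimately have "ins_digit r d x < 3 ^ e * (3 * 3 ^ r)"
    unfolding ins_digit_def by linarith
  then show ?thesis by (simp add: c power_add mult_ac)
qed

lemma ins_del_digit: "ins_digit r (digit x r) (del_digit r x) = x"
proof -
  let ?P = "3 ^ r :: nat"
  have 1: "del_digit r x div ?P = x div (3 * ?P)" "del_digit r x mod ?P = x mod ?P"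
    by (simp_all add: del_digit_def)
  have 2: "x div ?P = 3 * (x div (3 * ?P)) + digit x r"
  proof -
    have "x div (3 * ?P) = x div ?P div 3" by (metis div_mult2_eq mult.commute)
    then show ?thesis by (simp add: digit_def)
  qed
  have "x = x div ?P * ?P + x mod ?P" by (simp only: div_mult_mod_eq)
  also have "\<dots> = ins_digit r (digit x r) (del_digit r x)"
    unfolding ins_digit_def 1 by (subst 2) (simp add: algebra_simps)
  finally show ?thesis by simp
qed

lemma del_digit_less:
  assumes "x < 3 ^ Suc c" "r \<le> c"
  shows "del_digit r x < 3 ^ c"
proof -
  obtain e where c: "c = r + e" using assms(2) le_Suc_ex by blast
  have "x div (3 * 3 ^ r) < 3 ^ e"
    using assms(1) by (intro less_mult_imp_div_less) (simp add: c power_add mult_ac)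
  then have "(x div (3 * 3 ^ r) + 1) * 3 ^ r \<le> 3 ^ e * 3 ^ r" by (intro mult_right_mono) auto
  then have "x div (3 * 3 ^ r) * 3 ^ r + 3 ^ r \<le> 3 ^ e * 3 ^ r" by (simp only: distrib_right mult_1)
  moreover have "x mod 3 ^ r < 3 ^ r" by simp
  ultimately have "del_digit r x < 3 ^ e * 3 ^ r"
    unfolding del_digit_def by linarith
  then show ?thesis by (simp add: c power_add mult_ac)
qed

lemma rank_le: "finite A \<Longrightarrow> rank A v \<le> card A"
  unfolding rank_def by (intro card_mono) auto

lemma rank_insert:
  assumes "finite A" "v \<notin> A"
  shows "rank (insert v A) u = (if v < u then Suc (rank A u) else rank A u)"
proof -
  have "{w\<in>insert v A. w < u} = (if v < u then insert v {w\<in>A. w < u} else {w\<in>A. w < u})" by auto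
  then show ?thesis using assms by (simp add: rank_def)
qed

lemma rank_mono: "finite A \<Longrightarrow> u \<le> v \<Longrightarrow> rank A u \<le> rank A v"
  unfolding rank_def by (intro card_mono) auto

lemma rank_strict_mono: "finite A \<Longrightarrow> u \<in> A \<Longrightarrow> u < v \<Longrightarrow> rank A u < rank A v"
  unfolding rank_def by (intro psubset_card_mono) auto

lemma rank_Suc: "finite A \<Longrightarrow> rank A (Suc v) = (if v \<in> A then Suc (rank A v) else rank A v)"
proof -
  assume "finite A"
  have "{w\<in>A. w < Suc v} = (if v \<in> A then insert v {w\<in>A. w < v} else {w\<in>A. w < v})"
    by (auto simp: less_Suc_eq)
  then show ?thesis using \<open>finite A\<close> by (simp add: rank_def)
qed

lemma rank_0 [simp]: "rank A 0 = 0"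
  by (simp add: rank_def)

lemma rank_card: "A \<subseteq> {..<n} \<Longrightarrow> rank A n = card A"
  unfolding rank_def by (rule arg_cong[where f = card]) auto

text \<open>A new vertex raises the rank of exactly the larger vertices by one, just as an inserted
  digit moves up exactly the digits from its position on.\<close>

lemma decode_insert:
  assumes "finite A" "v \<notin> A" "d < 3" "u \<in> insert v A"
  shows "decode (insert v A) (ins_digit (rank A v) d x) u = ((decode A x)(v := d)) u"
proof -
  consider "u = v" | "u < v" "u \<in> A" | "v < u" "u \<in> A" using assms(4) by force
  then show ?thesis
  proof cases
    case 2
    then show ?thesis
      using rank_strict_mono[OF assms(1), of u v] assms
      by (simp add: decode_def digit_ins_digit rank_insert)
  next
    case 3
    then show ?thesis
      using rank_mono[OF assms(1), of v u] assms
      by (simp add: decode_def digit_ins_digit rank_insert)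
  qed (use assms in \<open>simp add: decode_def digit_ins_digit rank_insert\<close>)
qed

text \<open>A table entry \<^term>\<open>x\<close> of the parent reads up to three entries of the child. One formula covers
  all kinds of nodes: with \<open>a = b = P = 1\<close> the base index is \<open>x\<close>, with \<open>a = 3 P\<close>, \<open>b = P\<close> a
  digit is deleted, with \<open>a = P\<close>, \<open>b = 3 P\<close> a digit is inserted.\<close>

fun gather :: "(nat \<Rightarrow> nat) \<Rightarrow> nat \<Rightarrow> nat \<times> nat \<times> nat \<times> nat \<times> nat \<times> nat \<Rightarrow> nat" where
  "gather T x (a, b, P, w0, w1, w2) =
     (let y = x div a * b + (x - x div P * P)
      in w0 * T y + w1 * T (y + P) + w2 * T (y + 2 * P))"

context decomposed_graph begin

text \<open>A vertex is not counted in its own rank, so the rank in the bag of the parent is the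
  right position in both cases: for an introduced vertex, whose digit is dropped to address the
  child, and for a forgotten one, whose three possible digits are inserted and weighted.
  \<open>U\<close> is the weight of state 0.\<close>

fun gather_params :: "nat \<Rightarrow> nat \<Rightarrow> nat set \<Rightarrow> nat \<Rightarrow> nat \<Rightarrow> nat \<times> nat \<times> nat \<times> nat \<times> nat \<times> nat" where
  "gather_params X U M t v = (let P = 3 ^ rank (B t) v in
     if v \<in> B t then (3 * P, P, P, 1, 0, 0)
     else (P, 3 * P, P, U, vertex_weight X U M v 1, vertex_weight X U M v 2))"

lemma gather_transfer:
  assumes "j \<in> children D t" "t < N" "x < 3 ^ card (B t)"
    and T: "\<And>y. y < 3 ^ card (B j) \<Longrightarrow> T y = table X U M j (decode (B j) y) mod m"
    and diff: "\<And>v. v \<in> B t - B j \<union> (B j - B t) \<Longrightarrow> ps = gather_params X U M t v"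
    and same: "B t = B j \<Longrightarrow> ps = (1, 1, 1, 1, 0, 0)"
  shows "gather T x ps mod m = transfer X U M t j (decode (B t) x) mod m"
proof (cases rule: child_bag_cases[OF assms(1,2)])
  case 1
  then show ?thesis using same T assms(3) by (simp add: transfer_def weight_on_def)
next
  case (2 v)
  define r where "r = rank (B j) v"
  have fin: "finite (B j)" using child_less[OF assms(1)] by (rule finite_bag)
  have "rank (B t) v = r" using 2 fin by (simp add: r_def rank_insert)
  then have ps: "ps = (3 * 3 ^ r, 3 ^ r, 3 ^ r, 1, 0, 0)"
    using diff[of v] 2 by (simp add: Let_def)
  have x: "x < 3 ^ Suc (card (B j))" using assms(3) 2 fin by simp
  have "gather T x ps = T (del_digit r x)"
    by (simp add: ps del_digit_def minus_div_mult_eq_mod)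
  also have "\<dots> = table X U M j (decode (B j) (del_digit r x)) mod m"
    using del_digit_less[OF x] rank_le[OF fin] by (intro T) (simp add: r_def)
  also have "table X U M j (decode (B j) (del_digit r x)) = table X U M j (decode (B t) x)"
  proof (rule depends_onD[OF depends_on_table[OF child_less[OF assms(1)]]])
    fix u assume u: "u \<in> B j"
    then have "u \<noteq> v" using 2 by auto
    then show "decode (B j) (del_digit r x) u = decode (B t) x u"
      using decode_insert[OF fin 2(1), of "digit x r" u "del_digit r x"] u
      by (simp add: 2 ins_del_digit flip: r_def) (simp add: digit_def)
  qed
  also have "table X U M j (decode (B t) x) = transfer X U M t j (decode (B t) x)"
    using 2 by (simp add: transfer_def weight_on_def Diff_eq_empty_iff[THEN iffD2])
  finally show ?thesis by simp
next
  case (3 v)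
  define r where "r = rank (B t) v"
  have fin: "finite (B t)" using assms(2) by (rule finite_bag)
  have ps: "ps = (3 ^ r, 3 * 3 ^ r, 3 ^ r, vertex_weight X U M v 0,
      vertex_weight X U M v 1, vertex_weight X U M v 2)"
    using diff[of v] 3 by (simp add: Let_def r_def vertex_weight_def)
  have Tm: "T (ins_digit r d x) = table X U M j ((decode (B t) x)(v := d)) mod m" if "d < 3" for d
  proof -
    have "T (ins_digit r d x) = table X U M j (decode (B j) (ins_digit r d x)) mod m"
      using ins_digit_less[OF assms(3) _ that] rank_le[OF fin] 3 fin
      by (intro T) (simp add: r_def)
    also have "table X U M j (decode (B j) (ins_digit r d x)) =
        table X U M j ((decode (B t) x)(v := d))"
      by (rule depends_onD[OF depends_on_table[OF child_less[OF assms(1)]]])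
        (use decode_insert[OF fin 3(1) that] 3 in \<open>simp add: r_def\<close>)
    finally show ?thesis .
  qed
  have B: "B j - B t = {v}" using 3 by auto
  have s3: "(\<Sum>d<3. F d) = F 0 + F 1 + F 2" for F :: "nat \<Rightarrow> nat"
    by (simp add: eval_nat_numeral)
  have 1: "transfer X U M t j (decode (B t) x) =
      (\<Sum>d<3. vertex_weight X U M v d * table X U M j ((decode (B t) x)(v := d)))"
    using sum_out_insert[of v "{}"] by (simp add: transfer_def B weight_on_def)
  have 2: "(\<Sum>d<3. vertex_weight X U M v d * table X U M j ((decode (B t) x)(v := d))) mod m =
      (\<Sum>d<3. vertex_weight X U M v d * T (ins_digit r d x)) mod m"
    unfolding s3 by (intro mod_add_cong) (simp_all add: Tm mod_mult_right_eq)
  have 3: "(\<Sum>d<3. vertex_weight X U M v d * T (ins_digit r d x)) = gather T x ps"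
  proof -
    \<comment> \<open>Inserting the digit 0 gives the base index, and the digit \<open>d\<close>
      merely adds \<open>d * 3 ^ r\<close>; hence the offsets \<open>P\<close> and
      \<open>2 * P\<close>.\<close>
    have y: "x div 3 ^ r * (3 * 3 ^ r) + (x - x div 3 ^ r * 3 ^ r) = ins_digit r 0 x"
      by (simp only: ins_digit_def minus_div_mult_eq_mod mult_0 add_0_right)
    have d: "ins_digit r d x = ins_digit r 0 x + d * 3 ^ r" for d
      unfolding ins_digit_def by linarith
    have "gather T x ps = vertex_weight X U M v 0 * T (ins_digit r 0 x) +
        vertex_weight X U M v 1 * T (ins_digit r 0 x + 3 ^ r) +
        vertex_weight X U M v 2 * T (ins_digit r 0 x + 2 * 3 ^ r)"
      by (simp only: ps gather.simps Let_def y)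
    then show ?thesis by (simp only: s3 d[of 1] d[of 2] mult_1)
  qed
  show ?thesis by (simp only: 1 2 3)
qed

lemma bag_diff_unique:
  assumes "j \<in> children D t" "t < N"
    "v \<in> B t - B j \<union> (B j - B t)" "v' \<in> B t - B j \<union> (B j - B t)"
  shows "v = v'"
  by (rule child_bag_cases[OF assms(1,2)]) (use assms(3,4) in auto)

end


section \<open>Timed program logic\<close>

definition bounded :: "nat \<Rightarrow> state \<Rightarrow> bool" where
  "bounded L s \<longleftrightarrow> (\<forall>a i. s a i < 2 ^ L)"

text \<open>The number of blocks of \<open>L\<close> bits that hold the value. Widths are added at
  every operation because multiplication adds lengths. \<open>Suc c\<close> is a crude bound for a
  constant, but a fixed program has fixed constants.\<close>

fun exp_width :: "exp \<Rightarrow> nat" where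
  "exp_width (Const c) = Suc c"
| "exp_width (Load a e) = 1"
| "exp_width (Arith f e1 e2) = exp_width e1 + exp_width e2"

fun exp_time :: "exp \<Rightarrow> nat" where
  "exp_time (Const c) = Suc c"
| "exp_time (Load a e) = exp_time e + 1"
| "exp_time (Arith f e1 e2) = exp_time e1 + exp_time e2 + exp_width (Arith f e1 e2)"

lemma exp_width_pos: "exp_width e \<ge> 1"
  by (induction e) auto

lemma exp_val_less:
  assumes "L \<ge> 1" "bounded L s"
  shows "exp_val e s < 2 ^ (L * exp_width e)"
proof (induction e)
  case (Const c)
  have "c < 2 ^ Suc c" using less_exp[of "Suc c"] by linarith
  also have "(2::nat) ^ Suc c \<le> 2 ^ (L * Suc c)" using assms(1) mult_le_mono1[of 1 L "Suc c"] by (intro power_increasing) simp_all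
  finally show ?case by simp
next
  case (Load a e)
  then show ?case using assms(2) by (simp add: bounded_def)
next
  case (Arith f e1 e2)
  define x y where "x = exp_val e1 s" and "y = exp_val e2 s"
  define a b where "a = (2::nat) ^ (L * exp_width e1)" and "b = (2::nat) ^ (L * exp_width e2)"
  have xy: "x < a" "y < b" using Arith by (auto simp: x_def y_def a_def b_def)
  \<comment> \<open>Bounds of at least 2 make their sum at most their product, so multiplication is
    the worst case and covers the other operations.\<close>
  have "L * exp_width e \<ge> 1" for e using assms(1) exp_width_pos[of e] by simp
  then have "2 \<le> a" "2 \<le> b"
    unfolding a_def b_def by (metis one_le_numeral power_increasing power_one_right)+
  then have "a * 2 \<le> a * b" "2 * b \<le> a * b" by (simp_all only: mult_le_mono order_refl)
  then have ab: "a + b \<le> a * b" by linarith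
  have "apply_binop f x y < a * b"
  proof (cases f)
    case Add
    then show ?thesis using xy ab by simp
  next
    case Sub
    then show ?thesis using xy ab by simp
  next
    case Mul
    then show ?thesis using xy by (simp add: mult_strict_mono')
  next
    case Div
    then show ?thesis using xy ab div_le_dividend[of x y] by (simp del: div_le_dividend)
  qed
  then show ?case by (simp add: x_def y_def a_def b_def algebra_simps power_add)
qed

lemma bit_length_le: "x < 2 ^ w \<Longrightarrow> w \<ge> 1 \<Longrightarrow> bit_length x \<le> w"
  by (auto simp: bit_length_def floorlog_leD intro: floorlog_leI)

lemma exp_cost_le:
  assumes "L \<ge> 1" "bounded L s"
  shows "exp_cost e s \<le> exp_time e * L"
proof -
  have bl: "bit_length (exp_val e s) \<le> exp_width e * L" for e
    using exp_val_less[OF assms, of e] assms(1) exp_width_pos[of e]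
    by (intro bit_length_le) (simp_all add: mult.commute)
  show ?thesis
  proof (induction e)
    case (Const c)
    then show ?case using bl[of "Const c"] by simp
  next
    case (Load a e)
    then show ?case using bl[of "Load a e"] by simp
  next
    case (Arith f e1 e2)
    then show ?case using bl[of "Arith f e1 e2"] by (simp add: algebra_simps)
  qed
qed

text \<open>A total correctness triple with cost in units of \<open>L\<close>. While all cells stay
  below \<open>2 ^ L\<close>, every evaluation costs at most a constant times \<open>L\<close>, so
  the analysis of the program only counts steps. Boundedness is carried along by the triple;
  assignments are the only place where it has to be established.\<close>

definition timed :: "nat \<Rightarrow> nat \<Rightarrow> com \<Rightarrow> state \<Rightarrow> (state \<Rightarrow> bool) \<Rightarrow> bool" where
  "timed L T c s Q \<longleftrightarrow> (bounded L s \<longrightarrow> L \<ge> 1 \<longrightarrow>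
     (\<exists>t s'. runs c s t s' \<and> t \<le> T * L \<and> bounded L s' \<and> Q s'))"

lemma timedI:
  assumes "bounded L s \<Longrightarrow> L \<ge> 1 \<Longrightarrow> \<exists>t s'. runs c s t s' \<and> t \<le> T * L \<and> bounded L s' \<and> Q s'"
  shows "timed L T c s Q"
  using assms by (simp add: timed_def)

lemma timedE:
  assumes "timed L T c s Q" "bounded L s" "L \<ge> 1"
  obtains t s' where "runs c s t s'" "t \<le> T * L" "bounded L s'" "Q s'"
  using assms by (auto simp: timed_def)

lemma timed_weaken:
  assumes "timed L T c s Q" "T \<le> T'" "\<And>s'. Q s' \<Longrightarrow> Q' s'"
  shows "timed L T' c s Q'"
proof (rule timedI)
  assume "bounded L s" "L \<ge> 1"
  with assms(1) obtain t s' where "runs c s t s'" "t \<le> T * L" "bounded L s'" "Q s'" by (rule timedE)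
  moreover have "T * L \<le> T' * L" using assms(2) by simp
  ultimately show "\<exists>t s'. runs c s t s' \<and> t \<le> T' * L \<and> bounded L s' \<and> Q' s'"
    using assms(3) order_trans by blast
qed

lemma timed_Seq:
  assumes "timed L T1 c1 s R" "\<And>s1. R s1 \<Longrightarrow> timed L T2 c2 s1 Q"
  shows "timed L (T1 + T2) (Seq c1 c2) s Q"
proof (rule timedI)
  assume b: "bounded L s" "L \<ge> 1"
  from assms(1) b obtain t1 s1 where 1: "runs c1 s t1 s1" "t1 \<le> T1 * L" "bounded L s1" "R s1"
    by (rule timedE)
  from assms(2)[OF 1(4)] 1(3) b(2) obtain t2 s2
    where 2: "runs c2 s1 t2 s2" "t2 \<le> T2 * L" "bounded L s2" "Q s2" by (rule timedE)
  have "runs (Seq c1 c2) s (t1 + t2) s2" using 1(1) 2(1) by (rule runs.Seq)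
  moreover have "t1 + t2 \<le> (T1 + T2) * L" using 1(2) 2(2) by (simp add: distrib_right)
  ultimately show "\<exists>t s'. runs (Seq c1 c2) s t s' \<and> t \<le> (T1 + T2) * L \<and> bounded L s' \<and> Q s'"
    using 2(3,4) by blast
qed

text \<open>The times of both branches are added, but each premise may assume the outcome of the
  test. If the outcome is known, the other branch can be given time 0.\<close>

lemma timed_If:
  assumes "exp_val e s \<noteq> 0 \<Longrightarrow> timed L T1 c1 s Q" "exp_val e s = 0 \<Longrightarrow> timed L T2 c2 s Q"
  shows "timed L (exp_time e + T1 + T2) (If e c1 c2) s Q"
proof (rule timedI)
  assume b: "bounded L s" "L \<ge> 1"
  note e = exp_cost_le[OF b(2,1), of e]
  show "\<exists>t s'. runs (If e c1 c2) s t s' \<and> t \<le> (exp_time e + T1 + T2) * L \<and> bounded L s' \<and> Q s'"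
  proof (cases "exp_val e s = 0")
    case True
    from assms(2)[OF True] b obtain t s' where "runs c2 s t s'" "t \<le> T2 * L" "bounded L s'" "Q s'"
      by (rule timedE)
    moreover from this have "exp_cost e s + t \<le> (exp_time e + T1 + T2) * L"
      using e by (simp add: distrib_right)
    ultimately show ?thesis using runs.IfFalse[OF True] by blast
  next
    case False
    from assms(1)[OF False] b obtain t s' where "runs c1 s t s'" "t \<le> T1 * L" "bounded L s'" "Q s'"
      by (rule timedE)
    moreover from this have "exp_cost e s + t \<le> (exp_time e + T1 + T2) * L"
      using e by (simp add: distrib_right)
    ultimately show ?thesis using runs.IfTrue[OF False] by blast
  qed
qed

lemma timed_Store:
  assumes "exp_val e2 s < 2 ^ L" "Q (s(a := (s a)(exp_val e1 s := exp_val e2 s)))"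
  shows "timed L (exp_time e1 + exp_time e2) (Store a e1 e2) s Q"
proof (rule timedI)
  assume b: "bounded L s" "L \<ge> 1"
  have "exp_cost e1 s + exp_cost e2 s \<le> (exp_time e1 + exp_time e2) * L"
    using exp_cost_le[OF b(2,1), of e1] exp_cost_le[OF b(2,1), of e2] by (simp add: distrib_right)
  moreover have "bounded L (s(a := (s a)(exp_val e1 s := exp_val e2 s)))"
    using b(1) assms(1) by (simp add: bounded_def)
  ultimately show "\<exists>t s'. runs (Store a e1 e2) s t s' \<and> t \<le> (exp_time e1 + exp_time e2) * L \<and>
      bounded L s' \<and> Q s'"
    using runs.Store assms(2) by blast
qed

lemma timed_Skip: "Q s \<Longrightarrow> timed L 1 Skip s Q"
  using runs.Skip by (force intro!: timedI)

text \<open>Meant for loop-free code, whose time is a constant that simplification computes.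
  \<open>False\<close> at \<open>While\<close> excludes loops, which makes the value 0 of
  \<open>com_time\<close> there harmless.\<close>

fun wp :: "nat \<Rightarrow> com \<Rightarrow> (state \<Rightarrow> bool) \<Rightarrow> state \<Rightarrow> bool" where
  "wp L Skip Q s = Q s"
| "wp L (Store a e1 e2) Q s =
    (exp_val e2 s < 2 ^ L \<and> Q (s(a := (s a)(exp_val e1 s := exp_val e2 s))))"
| "wp L (Seq c1 c2) Q s = wp L c1 (wp L c2 Q) s"
| "wp L (If e c1 c2) Q s = (if exp_val e s \<noteq> 0 then wp L c1 Q s else wp L c2 Q s)"
| "wp L (While e c) Q s = False"

fun com_time :: "com \<Rightarrow> nat" where
  "com_time Skip = 1"
| "com_time (Store a e1 e2) = exp_time e1 + exp_time e2"
| "com_time (Seq c1 c2) = com_time c1 + com_time c2"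
| "com_time (If e c1 c2) = exp_time e + com_time c1 + com_time c2"
| "com_time (While e c) = 0"

lemma timed_wp: "wp L c Q s \<Longrightarrow> timed L (com_time c) c s Q"
proof (induction c arbitrary: s Q)
  case (Seq c1 c2)
  have "wp L c1 (wp L c2 Q) s" using Seq.prems by simp
  then show ?case unfolding com_time.simps by (rule timed_Seq[OF Seq.IH(1) Seq.IH(2)])
next
  case (If e c1 c2)
  then show ?case by (auto intro!: timed_If)
qed (auto simp: timed_Skip[simplified] intro: timed_Store[simplified])

abbreviation var :: "string \<Rightarrow> exp" where "var a \<equiv> Load a (Const 0)"
abbreviation assign :: "string \<Rightarrow> exp \<Rightarrow> com" (infix \<open>::=\<close> 61) where "a ::= e \<equiv> Store a (Const 0) e"
abbreviation seq :: "com \<Rightarrow> com \<Rightarrow> com" (infixr \<open>;;\<close> 60) where "c1 ;; c2 \<equiv> Seq c1 c2"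
abbreviation add :: "exp \<Rightarrow> exp \<Rightarrow> exp" (infixl \<open>[+]\<close> 65) where "e1 [+] e2 \<equiv> Arith Add e1 e2"
abbreviation sub :: "exp \<Rightarrow> exp \<Rightarrow> exp" (infixl \<open>[-]\<close> 65) where "e1 [-] e2 \<equiv> Arith Sub e1 e2"
abbreviation mul :: "exp \<Rightarrow> exp \<Rightarrow> exp" (infixl \<open>[*]\<close> 70) where "e1 [*] e2 \<equiv> Arith Mul e1 e2"
abbreviation quo :: "exp \<Rightarrow> exp \<Rightarrow> exp" (infixl \<open>[div]\<close> 70) where "e1 [div] e2 \<equiv> Arith Div e1 e2"

abbreviation set_var :: "state \<Rightarrow> string \<Rightarrow> nat \<Rightarrow> state" where
  "set_var s a x \<equiv> s(a := (s a)(0 := x))"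

text \<open>The machine has no test for equality. With truncated subtraction at least one of the two
  summands is 0, and the sum is the distance of the values.\<close>

definition differ :: "exp \<Rightarrow> exp \<Rightarrow> exp" where
  "differ e1 e2 = (e1 [-] e2) [+] (e2 [-] e1)"

definition For :: "string \<Rightarrow> exp \<Rightarrow> com \<Rightarrow> com" where
  "For i b c = (i ::= Const 0 ;; While (b [-] var i) (c ;; i ::= var i [+] Const 1))"

lemma exp_val_differ [simp]: "exp_val (differ e1 e2) s = 0 \<longleftrightarrow> exp_val e1 s = exp_val e2 s"
  by (auto simp: differ_def)

text \<open>The time of the body may vary with the iteration, as needed where few iterations are
  expensive. The body must leave the counter alone and establish the invariant for the state with
  the counter already increased. The bound \<open>b\<close> is evaluated anew in every round, so the
  invariant has to pin down its value.\<close>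

lemma timed_For_sum:
  assumes init: "I 0 (set_var s i 0)"
    and bound: "\<And>k s. I k s \<Longrightarrow> k \<le> m \<Longrightarrow> exp_val b s = m"
    and body: "\<And>k s. k < m \<Longrightarrow> I k s \<Longrightarrow> s i 0 = k \<Longrightarrow>
      timed L (T k) c s (\<lambda>s'. s' i 0 = k \<and> I (Suc k) (set_var s' i (Suc k)))"
    and post: "\<And>s. I m s \<Longrightarrow> Q s"
    and small: "m < 2 ^ L"
    and time: "(m + 1) * (exp_time b + exp_width b + 20) + (\<Sum>k<m. T k) \<le> T'"
  shows "timed L T' (For i b c) s Q"
proof -
  let ?e = "b [-] var i" and ?c = "c ;; i ::= var i [+] Const 1"
  let ?t = "exp_time ?e + 9"
  have loop: "timed L (exp_time ?e + d * ?t + (\<Sum>l\<in>{k..<m}. T l)) (While ?e ?c) s Q"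
    if "I k s" "s i 0 = k" "k + d = m" for k d s
    using that
  proof (induction d arbitrary: k s)
    case 0
    show ?case
    proof (rule timedI)
      assume b: "bounded L s" "L \<ge> 1"
      have "exp_val ?e s = 0" using bound[OF 0(1)] 0 by simp
      then have "runs (While ?e ?c) s (exp_cost ?e s) s" by (rule runs.WhileFalse)
      moreover have "Q s" using 0 post by simp
      moreover have "exp_cost ?e s \<le> (exp_time ?e + 0 * ?t + (\<Sum>l\<in>{k..<m}. T l)) * L"
        using exp_cost_le[OF b(2,1), of ?e] 0 by simp
      ultimately show "\<exists>t s'. runs (While ?e ?c) s t s' \<and>
          t \<le> (exp_time ?e + 0 * ?t + (\<Sum>l\<in>{k..<m}. T l)) * L \<and> bounded L s' \<and> Q s'"
        using b(1) by blast
    qed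
  next
    case (Suc d)
    have sum: "(\<Sum>l\<in>{k..<m}. T l) = T k + (\<Sum>l\<in>{Suc k..<m}. T l)"
      using Suc.prems by (intro sum.atLeast_Suc_lessThan) simp
    show ?case
    proof (rule timedI)
      assume b: "bounded L s" "L \<ge> 1"
      have "exp_val ?e s \<noteq> 0" using bound[OF Suc(2)] Suc.prems by simp
      moreover have "timed L (T k + com_time (i ::= var i [+] Const 1)) ?c s
          (\<lambda>s'. s' i 0 = Suc k \<and> I (Suc k) s')"
      proof (rule timed_Seq[OF body timed_wp])
        show "k < m" "I k s" "s i 0 = k" using Suc.prems by auto
        fix s1 assume "s1 i 0 = k \<and> I (Suc k) (set_var s1 i (Suc k))"
        then show "wp L (i ::= var i [+] Const 1) (\<lambda>s'. s' i 0 = Suc k \<and> I (Suc k) s') s1"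
          using small Suc.prems by simp
      qed
      from this b obtain t1 s1 where 1: "runs ?c s t1 s1" "t1 \<le> (T k + 9) * L" "bounded L s1"
        "s1 i 0 = Suc k" "I (Suc k) s1" by (auto elim!: timedE simp: algebra_simps)
      have "timed L (exp_time ?e + d * ?t + (\<Sum>l\<in>{Suc k..<m}. T l)) (While ?e ?c) s1 Q"
        using Suc.IH[OF 1(5,4)] Suc.prems by simp
      from this 1(3) b(2) obtain t2 s2 where 2: "runs (While ?e ?c) s1 t2 s2"
        "t2 \<le> (exp_time ?e + d * ?t + (\<Sum>l\<in>{Suc k..<m}. T l)) * L" "bounded L s2" "Q s2"
        by (rule timedE)
      ultimately have "runs (While ?e ?c) s (exp_cost ?e s + t1 + t2) s2"
        using 1(1) by (intro runs.WhileTrue)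
      moreover have "exp_cost ?e s + t1 + t2 \<le> (exp_time ?e + Suc d * ?t + (\<Sum>l\<in>{k..<m}. T l)) * L"
        using exp_cost_le[OF b(2,1), of ?e] 1(2) 2(2) unfolding sum
        by (simp add: algebra_simps)
      ultimately show "\<exists>t s'. runs (While ?e ?c) s t s' \<and>
          t \<le> (exp_time ?e + Suc d * ?t + (\<Sum>l\<in>{k..<m}. T l)) * L \<and> bounded L s' \<and> Q s'"
        using 2 by blast
    qed
  qed
  have "timed L (com_time (i ::= Const 0) + (exp_time ?e + m * ?t + (\<Sum>l\<in>{0..<m}. T l)))
      (For i b c) s Q"
    unfolding For_def
  proof (rule timed_Seq[OF timed_wp])
    show "wp L (i ::= Const 0) (\<lambda>s. I 0 s \<and> s i 0 = 0) s" using init by simp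
    fix s1 assume "I 0 s1 \<and> s1 i 0 = 0"
    then show "timed L (exp_time ?e + m * ?t + (\<Sum>l\<in>{0..<m}. T l)) (While ?e ?c) s1 Q"
      using loop[of 0 s1 m] by simp
  qed
  moreover have "com_time (i ::= Const 0) + (exp_time ?e + m * ?t + (\<Sum>l\<in>{0..<m}. T l)) \<le>
      (m + 1) * (exp_time b + exp_width b + 20) + (\<Sum>k<m. T k)"
    by (simp add: algebra_simps lessThan_atLeast0)
  ultimately show ?thesis using time by (rule timed_weaken[OF _ order_trans]) assumption
qed

lemma timed_For:
  assumes "I 0 (set_var s i 0)"
    and "\<And>k s. I k s \<Longrightarrow> k \<le> m \<Longrightarrow> exp_val b s = m"
    and "\<And>k s. k < m \<Longrightarrow> I k s \<Longrightarrow> s i 0 = k \<Longrightarrow>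
      timed L T c s (\<lambda>s'. s' i 0 = k \<and> I (Suc k) (set_var s' i (Suc k)))"
    and "\<And>s. I m s \<Longrightarrow> Q s"
    and "m < 2 ^ L"
    and "(m + 1) * (T + exp_time b + exp_width b + 20) \<le> T'"
  shows "timed L T' (For i b c) s Q"
proof (rule timed_For_sum[where I = I and T = "\<lambda>_. T"])
  show "(m + 1) * (exp_time b + exp_width b + 20) + (\<Sum>k<m. T) \<le> T'"
    using assms(6) by (simp add: algebra_simps)
qed (use assms(1-5) in auto)


section \<open>The program\<close>

text \<open>Powers are built by repeated multiplication. \<open>W\<close> is \<open>U^n\<close>, the
  unit in which the final sum is measured, \<open>m\<close> is the modulus \<open>U^(n + 1)\<close>,
  and \<open>Q\<close> is \<open>3^n\<close>, the common length reserved for the rows of the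
  tables.\<close>

definition setup_prog :: com where
  "setup_prog = (
    ''X'' ::= Const 2 ;; ''Q'' ::= Const 1 ;;
    For ''i'' (var ''n'') (''X'' ::= var ''X'' [*] Const 2 ;; ''Q'' ::= var ''Q'' [*] Const 3) ;;
    ''U'' ::= var ''X'' ;;
    For ''i'' (var ''n'') (''U'' ::= var ''U'' [*] var ''X'') ;;
    ''W'' ::= Const 1 ;;
    For ''i'' (var ''n'') (''W'' ::= var ''W'' [*] var ''U'') ;;
    ''m'' ::= var ''W'' [*] var ''U'')"

definition height_step :: com where
  "height_step = (
    If (differ (var ''j'') (var ''root'')) Skip (''c'' ::= var ''c'' [+] Const 1) ;;
    ''j'' ::= Load ''parent'' (var ''j''))"

text \<open>Each node climbs \<open>N\<close> steps and counts its visits to the root; the steps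
  spent at the root after arrival are what make up the height.\<close>

definition height_prog :: com where
  "height_prog = For ''i'' (var ''N'') (
    ''j'' ::= var ''i'' ;; ''c'' ::= Const 0 ;;
    For ''k'' (var ''N'') height_step ;;
    Store ''h'' (var ''i'') (var ''c''))"

abbreviation matrix :: "string \<Rightarrow> exp \<Rightarrow> exp \<Rightarrow> exp" where
  "matrix a i x \<equiv> Load a (i [*] var ''n'' [+] x)"

abbreviation cell :: "string \<Rightarrow> exp \<Rightarrow> exp" where
  "cell i x \<equiv> var i [*] var ''Q'' [+] x"

text \<open>Remainders are no machine operation. They are expressed through rounded division, here
  as well as in \<open>reduced\<close>.\<close>

abbreviation digit_exp :: "string \<Rightarrow> exp" where
  "digit_exp p \<equiv> var ''k'' [div] var p [-] var ''k'' [div] var p [div] Const 3 [*] Const 3"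

abbreviation reduced :: "string \<Rightarrow> exp" where
  "reduced z \<equiv> var z [-] var z [div] var ''m'' [*] var ''m''"

text \<open>The vertices are scanned in increasing order while \<open>pw\<close> holds 3 to the rank
  of the current vertex. \<open>pu\<close> and \<open>pv\<close> form a shift register that ends up
  with the positional values of the two ends of the label.\<close>

definition label_step :: com where
  "label_step = (
    If (matrix ''label'' (var ''i'') (var ''x'')) (''pu'' ::= var ''pv'' ;; ''pv'' ::= var ''pw'') Skip ;;
    If (matrix ''bag'' (var ''i'') (var ''x'')) (''pw'' ::= var ''pw'' [*] Const 3) Skip)"

text \<open>The product of the two digits determines the edge factor: 0 means that an end has state
  0, 4 that both have state 2, and 1 and 2 are the combinations of weight 0.\<close>

definition entry_step :: com where
  "entry_step = (
    ''e'' ::= digit_exp ''pu'' [*] digit_exp ''pv'' ;;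
    If (var ''e'')
      (If (differ (var ''e'') (Const 4)) (''z'' ::= Const 0) (''z'' ::= var ''U'' [*] var ''U''))
      (''z'' ::= Const 1) ;;
    Store ''T'' (cell ''i'' (var ''k'')) (reduced ''z''))"

definition init_node :: com where
  "init_node = (
    (''pw'' ::= Const 1 ;; ''pu'' ::= Const 0 ;; ''pv'' ::= Const 0) ;;
    For ''x'' (var ''n'') label_step ;;
    For ''k'' (var ''pw'') entry_step)"

definition params_step :: com where
  "params_step =
    If (matrix ''bag'' (var ''t'') (var ''x''))
      (If (matrix ''bag'' (var ''i'') (var ''x'')) Skip
         (''A'' ::= Const 3 [*] var ''pw'' ;; ''B'' ::= var ''pw'' ;; ''P'' ::= var ''pw'' ;;
          ''w0'' ::= Const 1 ;; ''w1'' ::= Const 0 ;; ''w2'' ::= Const 0) ;;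
       ''pw'' ::= var ''pw'' [*] Const 3)
      (If (matrix ''bag'' (var ''i'') (var ''x''))
         (''A'' ::= var ''pw'' ;; ''B'' ::= Const 3 [*] var ''pw'' ;; ''P'' ::= var ''pw'' ;;
          ''w0'' ::= var ''U'' ;;
          ''w1'' ::= (Const 1 [-] Load ''F'' (var ''x'')) [*] (var ''X'' [*] (var ''U'' [-] Const 1)) ;;
          ''w2'' ::= (Const 1 [-] Load ''F'' (var ''x'')) [*] var ''X'')
         Skip)"

abbreviation base_exp :: exp where
  "base_exp \<equiv> var ''k'' [div] var ''A'' [*] var ''B'' [+] (var ''k'' [-] var ''k'' [div] var ''P'' [*] var ''P'')"

text \<open>All three reads take place at every node. Where only one entry of the child is meant,
  \<open>w1\<close> and \<open>w2\<close> are 0 and erase whatever the other two cells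
  contain.\<close>

definition push_step :: com where
  "push_step = (
    ''z'' ::= Load ''T'' (cell ''t'' (var ''k'')) [*]
      (var ''w0'' [*] Load ''T'' (cell ''i'' base_exp) [+]
       var ''w1'' [*] Load ''T'' (cell ''i'' (base_exp [+] var ''P'')) [+]
       var ''w2'' [*] Load ''T'' (cell ''i'' (base_exp [+] Const 2 [*] var ''P''))) ;;
    Store ''T'' (cell ''t'' (var ''k'')) (reduced ''z''))"

definition push_node :: com where
  "push_node = (
    (''t'' ::= Load ''parent'' (var ''i'') ;;
     ''A'' ::= Const 1 ;; ''B'' ::= Const 1 ;; ''P'' ::= Const 1 ;;
     ''w0'' ::= Const 1 ;; ''w1'' ::= Const 0 ;; ''w2'' ::= Const 0 ;; ''pw'' ::= Const 1) ;;
    For ''x'' (var ''n'') params_step ;;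
    For ''k'' (var ''pw'') push_step)"

text \<open>Pass \<open>d\<close> pushes the nodes of height \<open>d\<close>, so a row is complete
  before it is read. The root has height \<open>N\<close> and is never pushed.\<close>

definition table_prog :: com where
  "table_prog = (
    For ''i'' (var ''N'') init_node ;;
    For ''d'' (var ''N'') (For ''i'' (var ''N'')
      (If (differ (Load ''h'' (var ''i'')) (var ''d'')) Skip push_node)))"

abbreviation result :: exp where
  "result \<equiv> Load ''T'' (cell ''root'' (Const 0))"

text \<open>A quotient with positive divisor is nonzero iff the divisor does not exceed the
  dividend. One loop raises \<open>q\<close> to the largest \<open>U^n X^j\<close> not above the
  sum, which fixes the optimal size \<open>j\<close>. The other is a self-reduction: each vertex is
  put into \<open>F\<close> on trial and taken out again if the sum falls below
  \<open>q\<close>.\<close>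

definition main_prog :: com where
  "main_prog = (
    setup_prog ;; height_prog ;; table_prog ;;
    ''q'' ::= var ''W'' ;;
    For ''v'' (var ''n'')
      (If (result [div] (var ''q'' [*] var ''X'')) (''q'' ::= var ''q'' [*] var ''X'') Skip) ;;
    For ''v'' (var ''n'') (
      Store ''F'' (var ''v'') (Const 1) ;; table_prog ;;
      If (result [div] var ''q'') Skip (Store ''F'' (var ''v'') (Const 0))))"

section \<open>Correctness and running time of the program\<close>

definition agree :: "string set \<Rightarrow> state \<Rightarrow> state \<Rightarrow> bool" where
  "agree A s s' \<longleftrightarrow> (\<forall>a. a \<notin> A \<longrightarrow> s' a = s a)"

lemma agreeD: "agree A s s' \<Longrightarrow> a \<notin> A \<Longrightarrow> s' a = s a"
  by (simp add: agree_def)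

lemma agree_refl [simp]: "agree A s s"
  by (simp add: agree_def)

lemma agree_upd: "agree A s s' \<Longrightarrow> a \<in> A \<Longrightarrow> agree A s (s'(a := f))"
  by (auto simp: agree_def)

lemma agree_trans: "agree A s s' \<Longrightarrow> agree A' s' s'' \<Longrightarrow> A \<union> A' \<subseteq> C \<Longrightarrow> agree C s s''"
  unfolding agree_def by (metis UnCI subsetD)

text \<open>The bounds on \<open>L\<close> name the largest intermediate values: before reduction,
  an entry times three products of a weight and an entry, at most \<open>3 * bm ^ 3\<close>; node
  numbers and heights; and powers of 3 one step beyond the largest rank.\<close>

locale dp_run = decomposed_graph +
  fixes L bX bU bm bQ :: nat
  assumes n_pos: "n > 0"
    and bX: "bX = 2 ^ Suc n" and bU: "bU = bX ^ Suc n" and bm: "bm = bU ^ Suc n" and bQ: "bQ = 3 ^ n"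
    and m_bound: "4 * bm ^ 3 < 2 ^ L" and N_bound: "N < 2 ^ L" and Q_bound: "3 * bQ < 2 ^ L"
begin

lemma bX_ge: "2 \<le> bX"
  by (simp add: bX)

lemma bX_le_bU: "bX \<le> bU"
  using bX_ge by (simp add: bU)

lemma bU_ge: "2 \<le> bU"
  using bX_ge bX_le_bU by simp

lemma bU2_le_bm: "bU * bU \<le> bm"
proof -
  have "bU ^ 2 \<le> bU ^ Suc n" using n_pos bU_ge by (intro power_increasing) auto
  then show ?thesis by (simp add: bm power2_eq_square)
qed

lemma bXU_le_bm: "bX * bU \<le> bm"
  using bU2_le_bm bX_le_bU by (meson mult_le_mono1 order_trans)

lemma bU_le_bm: "bU \<le> bm"
  using bU2_le_bm bU_ge by (metis le_trans mult_le_mono1 mult_1 one_le_numeral order.trans)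

lemma bm_pos: "0 < bm"
  using bU_le_bm bU_ge by simp

lemma less_bound: "x \<le> 4 * bm ^ 3 \<Longrightarrow> x < 2 ^ L"
  using m_bound by simp

lemma le_bm_less: "x \<le> bm \<Longrightarrow> x < 2 ^ L"
proof (rule less_bound)
  assume "x \<le> bm"
  also have "bm \<le> bm ^ 3" using bm_pos by (simp add: self_le_power)
  finally show "x \<le> 4 * bm ^ 3" by simp
qed

lemma n_less: "n < 2 ^ L"
proof -
  have "n < 3 ^ n" by (rule less_le_trans[OF less_exp]) (simp add: power_mono)
  then show ?thesis using Q_bound by (simp add: bQ)
qed

lemma card_bag_le: "t < N \<Longrightarrow> card (B t) \<le> n"
  using bag_less card_mono[of "{..<n}" "B t"] by fastforce

lemma pow_card_le: "t < N \<Longrightarrow> 3 ^ card (B t) \<le> bQ"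
  unfolding bQ by (intro power_increasing card_bag_le) auto

lemma pow_rank_le:
  assumes "t < N" shows "3 ^ rank (B t) k \<le> bQ"
  using rank_le[OF finite_bag[OF assms], of k] card_bag_le[OF assms] unfolding bQ
  by (intro power_increasing) auto

definition input_ok :: "state \<Rightarrow> bool" where
  "input_ok s \<longleftrightarrow> s ''n'' 0 = n \<and> s ''N'' 0 = N \<and> s ''root'' 0 = rt \<and>
     (\<forall>i<N. s ''parent'' i = par i) \<and>
     (\<forall>t<N. \<forall>x<n. s ''bag'' (t * n + x) = of_bool (x \<in> B t)) \<and>
     (\<forall>t<N. \<forall>x<n. s ''label'' (t * n + x) = of_bool (\<exists>e. edge_label D t = Some e \<and> x \<in> e))"

definition consts_ok :: "state \<Rightarrow> bool" where
  "consts_ok s \<longleftrightarrow> s ''X'' 0 = bX \<and> s ''U'' 0 = bU \<and> s ''W'' 0 = bU ^ n \<and> s ''m'' 0 = bm \<and> s ''Q'' 0 = bQ"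

definition ready :: "state \<Rightarrow> bool" where
  "ready s \<longleftrightarrow> input_ok s \<and> consts_ok s \<and> (\<forall>i<N. s ''h'' i = height i)"

lemma input_ok_agree:
  assumes "agree A s s'" "A \<inter> {''n'', ''N'', ''root'', ''parent'', ''bag'', ''label''} = {}" "input_ok s"
  shows "input_ok s'"
proof -
  have "s' a = s a" if "a \<in> {''n'', ''N'', ''root'', ''parent'', ''bag'', ''label''}" for a
    using agreeD[OF assms(1), of a] that assms(2) by blast
  then show ?thesis using assms(3) unfolding input_ok_def by simp
qed

lemma consts_ok_agree:
  assumes "agree A s s'" "A \<inter> {''X'', ''U'', ''W'', ''m'', ''Q''} = {}" "consts_ok s"
  shows "consts_ok s'"
proof -
  have "s' a = s a" if "a \<in> {''X'', ''U'', ''W'', ''m'', ''Q''}" for a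
    using agreeD[OF assms(1), of a] that assms(2) by blast
  then show ?thesis using assms(3) unfolding consts_ok_def by simp
qed

lemma ready_agree:
  assumes "agree A s s'" "ready s"
    "A \<inter> {''n'', ''N'', ''root'', ''parent'', ''bag'', ''label'', ''X'', ''U'', ''W'', ''m'', ''Q'', ''h''} = {}"
  shows "ready s'"
proof -
  have "s' ''h'' = s ''h''" using assms(1,3) by (intro agreeD) auto
  then show ?thesis
    using input_ok_agree[OF assms(1)] consts_ok_agree[OF assms(1)] assms(2,3)
    unfolding ready_def by auto
qed

lemma pow_bound: "k \<le> n \<Longrightarrow> bU ^ k < 2 ^ L" "k \<le> n \<Longrightarrow> bX ^ k < 2 ^ L" "k \<le> n \<Longrightarrow> (3::nat) ^ k < 2 ^ L"
proof -
  assume k: "k \<le> n"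
  have "bU ^ k \<le> bm" using k bU_ge unfolding bm by (intro power_increasing) auto
  then show "bU ^ k < 2 ^ L" by (rule le_bm_less)
  have "bX ^ k \<le> bU" using k bX_ge unfolding bU by (intro power_increasing) auto
  then show "bX ^ k < 2 ^ L" using bU_le_bm by (intro le_bm_less) simp
  have "(3::nat) ^ k \<le> bQ" using k unfolding bQ by (intro power_increasing) auto
  then show "(3::nat) ^ k < 2 ^ L" using Q_bound by simp
qed

lemma setup_spec:
  assumes "input_ok s"
  shows "timed L (600 * n) setup_prog s
    (\<lambda>s'. agree {''X'', ''U'', ''W'', ''m'', ''Q'', ''i''} s s' \<and> consts_ok s')"
proof -
  let ?A = "{''X'', ''U'', ''W'', ''m'', ''Q'', ''i''}"
  have n: "s' ''n'' 0 = n" if "agree ?A s s'" for s'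
    using agreeD[OF that, of "''n''"] assms by (simp add: input_ok_def)
  have X2: "2 ^ Suc k < (2::nat) ^ L" if "k \<le> n" for k
  proof (rule le_bm_less)
    have "(2::nat) ^ Suc k \<le> bX" using that unfolding bX by (intro power_increasing) auto
    then show "2 ^ Suc k \<le> bm" using bX_le_bU bU_le_bm by linarith
  qed
  have 0: "timed L 20 (''X'' ::= Const 2) s (\<lambda>s'. agree ?A s s' \<and> s' ''X'' 0 = 2)"
    by (rule timed_weaken[OF timed_wp]) (use X2[of 0] in \<open>auto simp: agree_upd\<close>)
  have 1: "timed L 20 (''Q'' ::= Const 1) s1 (\<lambda>s'. agree ?A s s' \<and> s' ''X'' 0 = 2 \<and> s' ''Q'' 0 = 1)"
    if "agree ?A s s1 \<and> s1 ''X'' 0 = 2" for s1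
    by (rule timed_weaken[OF timed_wp]) (use that pow_bound(3)[of 0] in \<open>auto simp: agree_upd\<close>)
  have 2: "timed L ((n + 1) * 50) (For ''i'' (var ''n'') (''X'' ::= var ''X'' [*] Const 2 ;; ''Q'' ::= var ''Q'' [*] Const 3)) s1
    (\<lambda>s'. agree ?A s s' \<and> s' ''X'' 0 = bX \<and> s' ''Q'' 0 = bQ)"
    if "agree ?A s s1 \<and> s1 ''X'' 0 = 2 \<and> s1 ''Q'' 0 = 1" for s1
  proof (rule timed_For[where m = n and
        I = "\<lambda>k s'. agree ?A s s' \<and> s' ''X'' 0 = 2 ^ Suc k \<and> s' ''Q'' 0 = 3 ^ k", OF _ _ timed_wp])
    fix k s' assume k: "k < n" and I: "agree ?A s s' \<and> s' ''X'' 0 = 2 ^ Suc k \<and> s' ''Q'' 0 = 3 ^ k" "s' ''i'' 0 = k"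
    show "wp L (''X'' ::= var ''X'' [*] Const 2 ;; ''Q'' ::= var ''Q'' [*] Const 3) (\<lambda>s'. s' ''i'' 0 = k \<and>
        agree ?A s (set_var s' ''i'' (Suc k)) \<and> set_var s' ''i'' (Suc k) ''X'' 0 = 2 ^ Suc (Suc k) \<and>
        set_var s' ''i'' (Suc k) ''Q'' 0 = 3 ^ Suc k) s'"
      using k I X2[of "Suc k"] pow_bound(3)[of "Suc k"] by (auto simp: agree_upd mult.commute)
  qed (use that n n_less in \<open>auto simp: agree_upd bX bQ\<close>)
  have 3: "timed L 20 (''U'' ::= var ''X'') s1 (\<lambda>s'. agree ?A s s' \<and> s' ''X'' 0 = bX \<and> s' ''Q'' 0 = bQ \<and> s' ''U'' 0 = bX)"
    if "agree ?A s s1 \<and> s1 ''X'' 0 = bX \<and> s1 ''Q'' 0 = bQ" for s1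
    by (rule timed_weaken[OF timed_wp]) (use that pow_bound(2)[of 1] n_pos in \<open>auto simp: agree_upd\<close>)
  have 4: "timed L ((n + 1) * 50) (For ''i'' (var ''n'') (''U'' ::= var ''U'' [*] var ''X'')) s1
    (\<lambda>s'. agree ?A s s' \<and> s' ''X'' 0 = bX \<and> s' ''Q'' 0 = bQ \<and> s' ''U'' 0 = bU)"
    if "agree ?A s s1 \<and> s1 ''X'' 0 = bX \<and> s1 ''Q'' 0 = bQ \<and> s1 ''U'' 0 = bX" for s1
  proof (rule timed_For[where m = n and
        I = "\<lambda>k s'. agree ?A s s' \<and> s' ''X'' 0 = bX \<and> s' ''Q'' 0 = bQ \<and> s' ''U'' 0 = bX ^ Suc k", OF _ _ timed_wp])
    fix k s' assume k: "k < n" and I: "agree ?A s s' \<and> s' ''X'' 0 = bX \<and> s' ''Q'' 0 = bQ \<and> s' ''U'' 0 = bX ^ Suc k" "s' ''i'' 0 = k"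
    have "bX ^ Suc (Suc k) \<le> bU" using k bX_ge unfolding bU by (intro power_increasing) auto
    then have "bX ^ Suc (Suc k) < 2 ^ L" using bU_le_bm by (intro le_bm_less) simp
    then show "wp L (''U'' ::= var ''U'' [*] var ''X'') (\<lambda>s'. s' ''i'' 0 = k \<and>
        agree ?A s (set_var s' ''i'' (Suc k)) \<and> set_var s' ''i'' (Suc k) ''X'' 0 = bX \<and>
        set_var s' ''i'' (Suc k) ''Q'' 0 = bQ \<and> set_var s' ''i'' (Suc k) ''U'' 0 = bX ^ Suc (Suc k)) s'"
      using I by (auto simp: agree_upd mult_ac)
  qed (use that n n_less in \<open>auto simp: agree_upd bU\<close>)
  have 5: "timed L 20 (''W'' ::= Const 1) s1 (\<lambda>s'. agree ?A s s' \<and> s' ''X'' 0 = bX \<and> s' ''Q'' 0 = bQ \<and> s' ''U'' 0 = bU \<and> s' ''W'' 0 = 1)"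
    if "agree ?A s s1 \<and> s1 ''X'' 0 = bX \<and> s1 ''Q'' 0 = bQ \<and> s1 ''U'' 0 = bU" for s1
    by (rule timed_weaken[OF timed_wp]) (use that pow_bound(3)[of 0] in \<open>auto simp: agree_upd\<close>)
  have 6: "timed L ((n + 1) * 50) (For ''i'' (var ''n'') (''W'' ::= var ''W'' [*] var ''U'')) s1
    (\<lambda>s'. agree ?A s s' \<and> s' ''X'' 0 = bX \<and> s' ''Q'' 0 = bQ \<and> s' ''U'' 0 = bU \<and> s' ''W'' 0 = bU ^ n)"
    if "agree ?A s s1 \<and> s1 ''X'' 0 = bX \<and> s1 ''Q'' 0 = bQ \<and> s1 ''U'' 0 = bU \<and> s1 ''W'' 0 = 1" for s1
  proof (rule timed_For[where m = n and
        I = "\<lambda>k s'. agree ?A s s' \<and> s' ''X'' 0 = bX \<and> s' ''Q'' 0 = bQ \<and> s' ''U'' 0 = bU \<and> s' ''W'' 0 = bU ^ k", OF _ _ timed_wp])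
    fix k s' assume k: "k < n" and I: "agree ?A s s' \<and> s' ''X'' 0 = bX \<and> s' ''Q'' 0 = bQ \<and> s' ''U'' 0 = bU \<and> s' ''W'' 0 = bU ^ k" "s' ''i'' 0 = k"
    show "wp L (''W'' ::= var ''W'' [*] var ''U'') (\<lambda>s'. s' ''i'' 0 = k \<and>
        agree ?A s (set_var s' ''i'' (Suc k)) \<and> set_var s' ''i'' (Suc k) ''X'' 0 = bX \<and>
        set_var s' ''i'' (Suc k) ''Q'' 0 = bQ \<and> set_var s' ''i'' (Suc k) ''U'' 0 = bU \<and>
        set_var s' ''i'' (Suc k) ''W'' 0 = bU ^ Suc k) s'"
      using I pow_bound(1)[of "Suc k"] k by (auto simp: agree_upd mult_ac)
  qed (use that n n_less in \<open>auto simp: agree_upd\<close>)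
  have 7: "timed L 20 (''m'' ::= var ''W'' [*] var ''U'') s1 (\<lambda>s'. agree ?A s s' \<and> consts_ok s')"
    if "agree ?A s s1 \<and> s1 ''X'' 0 = bX \<and> s1 ''Q'' 0 = bQ \<and> s1 ''U'' 0 = bU \<and> s1 ''W'' 0 = bU ^ n" for s1
  proof (rule timed_weaken[OF timed_wp])
    have "bU ^ n * bU = bm" by (simp add: bm)
    then show "wp L (''m'' ::= var ''W'' [*] var ''U'') (\<lambda>s'. agree ?A s s' \<and> consts_ok s') s1"
      using that le_bm_less[OF order_refl] by (simp add: agree_upd consts_ok_def)
  qed simp_all
  show ?thesis
    unfolding setup_prog_def
    by (rule timed_weaken, (rule timed_Seq 0 1 2 3 4 5 6 7 | assumption)+) (use n_pos in auto)
qed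


lemma height_step_spec:
  assumes "input_ok s" "i < N" "s ''j'' 0 = i" "s ''c'' 0 < N"
  shows "timed L 60 height_step s (\<lambda>s'. agree {''j'', ''c''} s s' \<and>
    s' ''j'' 0 = par i \<and> s' ''c'' 0 = (if i = rt then Suc (s ''c'' 0) else s ''c'' 0))"
  unfolding height_step_def
proof (rule timed_weaken[OF timed_wp])
  have "s ''root'' 0 = rt" "s ''parent'' i = par i" using assms(1,2) by (simp_all add: input_ok_def)
  then show "wp L (If (differ (var ''j'') (var ''root'')) Skip (''c'' ::= var ''c'' [+] Const 1) ;;
      ''j'' ::= Load ''parent'' (var ''j'')) (\<lambda>s'. agree {''j'', ''c''} s s' \<and>
    s' ''j'' 0 = par i \<and> s' ''c'' 0 = (if i = rt then Suc (s ''c'' 0) else s ''c'' 0)) s"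
    using assms(2-4) par_less[of i] root_less N_bound by (cases "i = rt") (simp_all add: agree_upd)
qed (simp_all add: differ_def)

lemma height_spec:
  assumes "input_ok s"
  shows "timed L (700 * (N * N)) height_prog s
    (\<lambda>s'. agree {''i'', ''j'', ''c'', ''k'', ''h''} s s' \<and> (\<forall>t<N. s' ''h'' t = height t))"
proof -
  let ?A = "{''i'', ''j'', ''c'', ''k'', ''h''}"
  have N: "N > 0" using root_less by simp
  have inp: "input_ok s'" if "agree ?A s s'" for s'
    using input_ok_agree[OF that _ assms] by simp
  have inN: "s' ''N'' 0 = N" if "agree ?A s s'" for s'
    using inp[OF that] by (simp add: input_ok_def)
  have body: "timed L (300 * N) (''j'' ::= var ''i'' ;; ''c'' ::= Const 0 ;;
      For ''k'' (var ''N'') height_step ;; Store ''h'' (var ''i'') (var ''c'')) s1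
    (\<lambda>s'. agree ?A s1 s' \<and> s' ''i'' 0 = t \<and> s' ''h'' = (s1 ''h'')(t := height t))"
    if s1: "agree ?A s s1" and t: "s1 ''i'' 0 = t" "t < N" for s1 t
  proof -
    define P where "P s' \<longleftrightarrow> agree {''j'', ''c'', ''k''} s1 s'" for s'
    have Pinp: "input_ok s'" if "P s'" for s'
      by (rule inp) (use that s1 in \<open>auto simp: P_def agree_def\<close>)
    have Pi: "s' ''i'' 0 = t" if "P s'" for s'
      using that t by (simp add: P_def agree_def)
    have 1: "timed L 20 (''j'' ::= var ''i'') s1 (\<lambda>s'. P s' \<and> s' ''j'' 0 = t)"
      by (rule timed_weaken[OF timed_wp]) (use t N_bound in \<open>auto simp: agree_upd P_def\<close>)
    have 2: "timed L 20 (''c'' ::= Const 0) s2 (\<lambda>s'. P s' \<and> s' ''j'' 0 = t \<and> s' ''c'' 0 = 0)"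
      if "P s2 \<and> s2 ''j'' 0 = t" for s2
      by (rule timed_weaken[OF timed_wp]) (use that in \<open>auto simp: agree_upd P_def\<close>)
    have 3: "timed L ((N + 1) * 90) (For ''k'' (var ''N'') height_step) s2
      (\<lambda>s'. P s' \<and> s' ''c'' 0 = height t)"
      if "P s2 \<and> s2 ''j'' 0 = t \<and> s2 ''c'' 0 = 0" for s2
    proof (rule timed_For[where m = N and I = "\<lambda>k s'. P s' \<and>
          s' ''j'' 0 = (par ^^ k) t \<and> s' ''c'' 0 = card {l. l < k \<and> (par ^^ l) t = rt}"])
      fix k s' assume k: "k < N" and I: "P s' \<and> s' ''j'' 0 = (par ^^ k) t \<and>
          s' ''c'' 0 = card {l. l < k \<and> (par ^^ l) t = rt}" and sk: "s' ''k'' 0 = k"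
      have "card {l. l < k \<and> (par ^^ l) t = rt} \<le> card {..<k}" by (intro card_mono) auto
      then have c: "card {l. l < k \<and> (par ^^ l) t = rt} < N" using k by simp
      have "{l. l < Suc k \<and> (par ^^ l) t = rt} =
          (if (par ^^ k) t = rt then insert k {l. l < k \<and> (par ^^ l) t = rt}
           else {l. l < k \<and> (par ^^ l) t = rt})"
        by (auto simp: less_Suc_eq)
      then have cs: "card {l. l < Suc k \<and> (par ^^ l) t = rt} =
          (if (par ^^ k) t = rt then Suc (card {l. l < k \<and> (par ^^ l) t = rt})
           else card {l. l < k \<and> (par ^^ l) t = rt})" by simp
      show "timed L 60 height_step s' (\<lambda>s'. s' ''k'' 0 = k \<and> P (set_var s' ''k'' (Suc k)) \<and>
          set_var s' ''k'' (Suc k) ''j'' 0 = (par ^^ Suc k) t \<and>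
          set_var s' ''k'' (Suc k) ''c'' 0 = card {l. l < Suc k \<and> (par ^^ l) t = rt})"
      proof (rule timed_weaken[OF height_step_spec])
        show "input_ok s'" using Pinp I by simp
        show "(par ^^ k) t < N" using t by (simp add: funpow_par_less)
        show "s' ''j'' 0 = (par ^^ k) t" "s' ''c'' 0 < N" using I c by auto
        fix s'' assume a: "agree {''j'', ''c''} s' s'' \<and> s'' ''j'' 0 = par ((par ^^ k) t) \<and>
          s'' ''c'' 0 = (if (par ^^ k) t = rt then Suc (s' ''c'' 0) else s' ''c'' 0)"
        moreover have "P (set_var s'' ''k'' (Suc k))"
          using a I by (auto simp: P_def agree_def)
        moreover have "s'' ''k'' = s' ''k''" using a by (intro agreeD) auto
        ultimately show "s'' ''k'' 0 = k \<and> P (set_var s'' ''k'' (Suc k)) \<and>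
          set_var s'' ''k'' (Suc k) ''j'' 0 = (par ^^ Suc k) t \<and>
          set_var s'' ''k'' (Suc k) ''c'' 0 = card {l. l < Suc k \<and> (par ^^ l) t = rt}"
          using I sk cs by simp
      qed simp
    next
      fix k s' assume "P s' \<and> s' ''j'' 0 = (par ^^ k) t \<and> s' ''c'' 0 = card {l. l < k \<and> (par ^^ l) t = rt}"
      then show "exp_val (var ''N'') s' = N" using Pinp by (simp add: input_ok_def)
    qed (use that N_bound in \<open>auto simp: P_def agree_upd height_def\<close>)
    have 4: "timed L 20 (Store ''h'' (var ''i'') (var ''c'')) s2
      (\<lambda>s'. agree ?A s1 s' \<and> s' ''i'' 0 = t \<and> s' ''h'' = (s1 ''h'')(t := height t))"
      if s2: "P s2 \<and> s2 ''c'' 0 = height t" for s2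
    proof (rule timed_weaken[OF timed_wp])
      have "s2 ''h'' = s1 ''h''" using s2 by (simp add: P_def agree_def)
      moreover have "height t < 2 ^ L"
        using height_less[of t] height_root t N_bound by (cases "t = rt") auto
      moreover have "agree ?A s1 s2" using s2 by (auto simp: P_def agree_def)
      ultimately show "wp L (Store ''h'' (var ''i'') (var ''c''))
         (\<lambda>s'. agree ?A s1 s' \<and> s' ''i'' 0 = t \<and> s' ''h'' = (s1 ''h'')(t := height t)) s2"
        using s2 Pi[of s2] by (simp add: agree_upd)
    qed simp_all
    show ?thesis
      by (rule timed_weaken, (rule timed_Seq 1 2 3 4 | assumption)+) (use N in auto)
  qed
  show ?thesis
    unfolding height_prog_def
  proof (rule timed_For[where m = N and
        I = "\<lambda>k s'. agree ?A s s' \<and> (\<forall>t<k. s' ''h'' t = height t)"])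
    fix k s' assume k: "k < N" and I: "agree ?A s s' \<and> (\<forall>t<k. s' ''h'' t = height t)" and sk: "s' ''i'' 0 = k"
    show "timed L (300 * N) (''j'' ::= var ''i'' ;; ''c'' ::= Const 0 ;;
      For ''k'' (var ''N'') height_step ;; Store ''h'' (var ''i'') (var ''c'')) s'
      (\<lambda>s'. s' ''i'' 0 = k \<and> agree ?A s (set_var s' ''i'' (Suc k)) \<and>
        (\<forall>t<Suc k. set_var s' ''i'' (Suc k) ''h'' t = height t))"
      by (rule timed_weaken[OF body[of s' k]])
        (use I sk k in \<open>auto simp: agree_def less_Suc_eq\<close>)
  next
    show "(N + 1) * (300 * N + exp_time (var ''N'') + exp_width (var ''N'') + 20) \<le> 700 * (N * N)"
    proof -
      obtain N' where "N = Suc N'" using N gr0_implies_Suc by blast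
      then show ?thesis by (simp add: algebra_simps)
    qed
  qed (use inN N_bound in \<open>auto simp: agree_upd\<close>)
qed

definition labelled :: "nat \<Rightarrow> nat set" where
  "labelled t = {x. \<exists>e. edge_label D t = Some e \<and> x \<in> e}"

text \<open>The shift register \<open>(pu, pv)\<close> after the scan of the vertices below
  \<open>k\<close>.\<close>

primrec marks :: "nat \<Rightarrow> nat \<Rightarrow> nat \<times> nat" where
  "marks t 0 = (0, 0)"
| "marks t (Suc k) = (if k \<in> labelled t then (snd (marks t k), 3 ^ rank (B t) k) else marks t k)"

lemma marks_le:
  assumes "t < N" shows "fst (marks t k) \<le> bQ" "snd (marks t k) \<le> bQ"
  by (induction k) (use pow_rank_le[OF assms] in auto)

lemma marks_unlabelled: "labelled t = {} \<Longrightarrow> marks t k = (0, 0)"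
  by (induction k) auto

lemma marks_labelled:
  assumes "labelled t = {u, v}" "u < v"
  shows "marks t k = (if v < k then 3 ^ rank (B t) u else 0,
    if v < k then 3 ^ rank (B t) v else if u < k then 3 ^ rank (B t) u else 0)"
  by (induction k) (use assms in \<open>auto simp: less_Suc_eq\<close>)

text \<open>The marks are 0 at a node without label, and division by 0 yields 0, so both digits and hence
  \<^term>\<open>e\<close> are 0 there.\<close>

lemma label_factor_digits:
  assumes "t < N" "e = (x div fst (marks t n) mod 3) * (x div snd (marks t n) mod 3)"
  shows "label_factor U t (decode (B t) x) = (if e = 0 then 1 else if e = 4 then U * U else 0)"
proof (rule label_cases[OF assms(1)])
  assume "edge_label D t = None"
  then show ?thesis using assms(2) by (simp add: label_factor_def labelled_def marks_unlabelled)
next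
  fix a b assume ab: "edge_label D t = Some {a, b}" "{a, b} \<in> E" "a \<in> B t" "b \<in> B t"
  have "card {a, b} = 2" using ab(2) simple by (simp add: simple_graph_def)
  then have "a \<noteq> b" by auto
  then obtain u v where uv: "{a, b} = {u, v}" "u < v"
    by (metis insert_commute linorder_neqE_nat)
  have "u \<in> {a, b}" "v \<in> {a, b}" unfolding uv(1) by auto
  then have "u \<in> B t" "v \<in> B t" using ab by auto
  then have n: "u < n" "v < n" using bag_less assms(1) by auto
  have "labelled t = {u, v}" using ab(1) unfolding uv(1) by (auto simp: labelled_def)
  then have e: "e = decode (B t) x u * decode (B t) x v"
    using assms(2) n uv(2) by (simp add: marks_labelled decode_def digit_def)
  have less: "decode (B t) x u < 3" "decode (B t) x v < 3" by (simp_all add: decode_def digit_def)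
  have lf: "label_factor U t (decode (B t) x) = edge_factor U {u, v} (decode (B t) x)"
    using ab(1) uv(1) by (simp add: label_factor_def)
  have "decode (B t) x u = 0 \<or> decode (B t) x u = 1 \<or> decode (B t) x u = 2"
    "decode (B t) x v = 0 \<or> decode (B t) x v = 1 \<or> decode (B t) x v = 2"
    using less by linarith+
  then show ?thesis unfolding lf e by (auto simp: edge_factor_def power2_eq_square)
qed

lemma input_okD:
  assumes "input_ok s"
  shows "s ''n'' 0 = n" "s ''N'' 0 = N" "s ''root'' 0 = rt" "i < N \<Longrightarrow> s ''parent'' i = par i"
    "t < N \<Longrightarrow> x < n \<Longrightarrow> s ''bag'' (t * n + x) = of_bool (x \<in> B t)"
    "t < N \<Longrightarrow> x < n \<Longrightarrow> s ''label'' (t * n + x) = of_bool (x \<in> labelled t)"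
  using assms by (simp_all add: input_ok_def labelled_def)

lemma consts_okD:
  assumes "consts_ok s"
  shows "s ''X'' 0 = bX" "s ''U'' 0 = bU" "s ''W'' 0 = bU ^ n" "s ''m'' 0 = bm" "s ''Q'' 0 = bQ"
  using assms by (simp_all add: consts_ok_def)

lemma le_bQ_less: "x \<le> bQ \<Longrightarrow> x < 2 ^ L" "x \<le> bQ \<Longrightarrow> x * 3 < 2 ^ L"
  using Q_bound by linarith+

lemma label_step_spec:
  assumes "input_ok s" "s ''i'' 0 = t" "t < N" "s ''x'' 0 = k" "k < n"
    "s ''pw'' 0 = 3 ^ rank (B t) k" "(s ''pu'' 0, s ''pv'' 0) = marks t k"
  shows "timed L 100 label_step s (\<lambda>s'. agree {''pw'', ''pu'', ''pv''} s s' \<and>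
    s' ''pw'' 0 = 3 ^ rank (B t) (Suc k) \<and> (s' ''pu'' 0, s' ''pv'' 0) = marks t (Suc k))"
  unfolding label_step_def
proof (rule timed_weaken[OF timed_wp])
  have pv: "s ''pv'' 0 < 2 ^ L"
    using marks_le(2)[OF assms(3), of k] assms(7) by (metis le_bQ_less(1) snd_conv)
  have pw: "s ''pw'' 0 < 2 ^ L" "s ''pw'' 0 * 3 < 2 ^ L"
    using le_bQ_less[OF pow_rank_le[OF assms(3)]] assms(6) by simp_all
  have m: "marks t k = (s ''pu'' 0, s ''pv'' 0)" using assms(7) by simp
  have r: "rank (B t) (Suc k) = (if k \<in> B t then Suc (rank (B t) k) else rank (B t) k)"
    by (rule rank_Suc[OF finite_bag[OF assms(3)]])
  note i = input_okD[OF assms(1)]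
  show "wp L (If (matrix ''label'' (var ''i'') (var ''x'')) (''pu'' ::= var ''pv'' ;; ''pv'' ::= var ''pw'') Skip ;;
    If (matrix ''bag'' (var ''i'') (var ''x'')) (''pw'' ::= var ''pw'' [*] Const 3) Skip)
    (\<lambda>s'. agree {''pw'', ''pu'', ''pv''} s s' \<and>
    s' ''pw'' 0 = 3 ^ rank (B t) (Suc k) \<and> (s' ''pu'' 0, s' ''pv'' 0) = marks t (Suc k)) s"
    using pv pw assms(2-6)
    by (cases "k \<in> labelled t"; cases "k \<in> B t") (simp_all add: i r m agree_upd)
qed simp_all

lemma entry_step_spec:
  assumes "ready s" "s ''i'' 0 = t" "t < N" "s ''k'' 0 = k"
    "(s ''pu'' 0, s ''pv'' 0) = marks t n" "\<And>a. s ''T'' a < bm"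
  shows "timed L 400 entry_step s (\<lambda>s'. agree {''e'', ''z'', ''T''} s s' \<and>
    s' ''T'' = (s ''T'')(t * bQ + k := label_factor bU t (decode (B t) k) mod bm))"
  unfolding entry_step_def
proof (rule timed_weaken[OF timed_wp])
  define e where "e = (k div s ''pu'' 0 mod 3) * (k div s ''pv'' 0 mod 3)"
  have lf: "label_factor bU t (decode (B t) k) = (if e = 0 then 1 else if e = 4 then bU * bU else 0)"
    using assms(5) by (intro label_factor_digits[OF assms(3)]) (simp add: e_def flip: assms(5))
  have "e \<le> 2 * 2"
    unfolding e_def by (intro mult_le_mono) (simp_all add: less_Suc_eq_le[symmetric])
  moreover have "1 \<le> bm ^ 3" using bm_pos by simp
  ultimately have eL: "e < 2 ^ L" by (intro less_bound) simp
  have UL: "bU * bU < 2 ^ L" using bU2_le_bm by (rule le_bm_less)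
  have one: "1 < (2::nat) ^ L" using bm_pos by (intro le_bm_less) simp
  have red: "x - x div bm * bm = x mod bm" for x by (rule minus_div_mult_eq_mod)
  have mL: "x mod bm < 2 ^ L" for x using bm_pos by (intro le_bm_less) (simp add: less_imp_le)
  note c = consts_okD[of s]
  have c: "consts_ok s" using assms(1) by (simp add: ready_def)
  show "wp L (''e'' ::= digit_exp ''pu'' [*] digit_exp ''pv'' ;;
    If (var ''e'')
      (If (differ (var ''e'') (Const 4)) (''z'' ::= Const 0) (''z'' ::= var ''U'' [*] var ''U''))
      (''z'' ::= Const 1) ;;
    Store ''T'' (cell ''i'' (var ''k'')) (reduced ''z'')) (\<lambda>s'. agree {''e'', ''z'', ''T''} s s' \<and>
    s' ''T'' = (s ''T'')(t * bQ + k := label_factor bU t (decode (B t) k) mod bm)) s"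
    using assms(2-4) eL UL one bm_pos
    by (simp add: lf consts_okD[OF c] red mL agree_upd minus_div_mult_eq_mod flip: e_def)
qed (simp_all add: differ_def)

text \<open>\<open>k\<close> is the front of the loop. The last clause thus protects other rows and
  also the entries of row \<open>t\<close> still to come, whose old values an update in place will
  read.\<close>

definition row_updated :: "nat \<Rightarrow> nat \<Rightarrow> (nat \<Rightarrow> nat) \<Rightarrow> state \<Rightarrow> state \<Rightarrow> bool" where
  "row_updated t k g s s' \<longleftrightarrow> (\<forall>a. s' ''T'' a < bm) \<and> (\<forall>x<k. s' ''T'' (t * bQ + x) = g x) \<and>
     (\<forall>a. (\<forall>x<k. a \<noteq> t * bQ + x) \<longrightarrow> s' ''T'' a = s ''T'' a)"

lemma row_updated_0: "(\<And>a. s ''T'' a < bm) \<Longrightarrow> s' ''T'' = s ''T'' \<Longrightarrow> row_updated t 0 g s s'"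
  by (simp add: row_updated_def)

lemma row_updated_Suc:
  "row_updated t k g s s' \<Longrightarrow> s'' ''T'' = (s' ''T'')(t * bQ + k := g k) \<Longrightarrow> g k < bm \<Longrightarrow>
    row_updated t (Suc k) g s s''"
  by (simp add: row_updated_def less_Suc_eq)

lemma init_node_spec:
  assumes "ready s" "s ''i'' 0 = t" "t < N" "\<And>a. s ''T'' a < bm"
  shows "timed L (2000 * (n + 3 ^ card (B t))) init_node s (\<lambda>s'.
    agree {''pw'', ''pu'', ''pv'', ''x'', ''k'', ''e'', ''z'', ''T''} s s' \<and>
    row_updated t (3 ^ card (B t)) (\<lambda>x. label_factor bU t (decode (B t) x) mod bm) s s')"
proof -
  let ?g = "\<lambda>x. label_factor bU t (decode (B t) x) mod bm"
  let ?A = "{''pw'', ''pu'', ''pv'', ''x'', ''k'', ''e'', ''z'', ''T''}"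
  define P where "P s' \<longleftrightarrow> agree {''pw'', ''pu'', ''pv'', ''x''} s s'" for s'
  define R where "R s' \<longleftrightarrow> agree ?A s s' \<and> s' ''pw'' 0 = 3 ^ card (B t) \<and> (s' ''pu'' 0, s' ''pv'' 0) = marks t n" for s'
  have Pr: "ready s'" "s' ''i'' 0 = t" "s' ''T'' = s ''T''" if "P s'" for s'
    using that ready_agree[OF _ assms(1)] agreeD[of _ s s'] assms(2) by (auto simp: P_def)
  have Rr: "ready s'" "s' ''i'' 0 = t" if "R s'" for s'
    using that ready_agree[OF _ assms(1)] agreeD[of _ s s'] assms(2) by (auto simp: R_def)
  have n1: "s' ''n'' 0 = n" if "ready s'" for s'
    using that by (simp add: ready_def input_ok_def)
  have 1: "timed L 60 (''pw'' ::= Const 1 ;; ''pu'' ::= Const 0 ;; ''pv'' ::= Const 0) s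
      (\<lambda>s'. P s' \<and> s' ''pw'' 0 = 1 \<and> s' ''pu'' 0 = 0 \<and> s' ''pv'' 0 = 0)"
    by (rule timed_weaken[OF timed_wp])
      (use le_bm_less[of 1] bm_pos in \<open>auto simp: P_def agree_upd\<close>)
  have 2: "timed L ((n + 1) * 150) (For ''x'' (var ''n'') label_step) s1
      (\<lambda>s'. P s' \<and> s' ''pw'' 0 = 3 ^ card (B t) \<and> (s' ''pu'' 0, s' ''pv'' 0) = marks t n)"
    if "P s1 \<and> s1 ''pw'' 0 = 1 \<and> s1 ''pu'' 0 = 0 \<and> s1 ''pv'' 0 = 0" for s1
  proof (rule timed_For[where m = n and T = 100 and I = "\<lambda>k s'. P s' \<and>
        s' ''pw'' 0 = 3 ^ rank (B t) k \<and> (s' ''pu'' 0, s' ''pv'' 0) = marks t k"])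
    fix k s' assume k: "k < n" and I: "P s' \<and> s' ''pw'' 0 = 3 ^ rank (B t) k \<and>
      (s' ''pu'' 0, s' ''pv'' 0) = marks t k" and sk: "s' ''x'' 0 = k"
    show "timed L 100 label_step s' (\<lambda>s'. s' ''x'' 0 = k \<and> P (set_var s' ''x'' (Suc k)) \<and>
        set_var s' ''x'' (Suc k) ''pw'' 0 = 3 ^ rank (B t) (Suc k) \<and>
        (set_var s' ''x'' (Suc k) ''pu'' 0, set_var s' ''x'' (Suc k) ''pv'' 0) = marks t (Suc k))"
    proof (rule timed_weaken[OF label_step_spec[where s = s' and k = k, OF _ _ assms(3) sk k]])
      show "input_ok s'" "s' ''i'' 0 = t" using Pr[of s'] I by (simp_all add: ready_def)
      fix s'' assume a: "agree {''pw'', ''pu'', ''pv''} s' s'' \<and>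
        s'' ''pw'' 0 = 3 ^ rank (B t) (Suc k) \<and> (s'' ''pu'' 0, s'' ''pv'' 0) = marks t (Suc k)"
      moreover have "P (set_var s'' ''x'' (Suc k))" using a I by (auto simp: P_def agree_def)
      moreover have "s'' ''x'' = s' ''x''" using a by (intro agreeD) auto
      ultimately show "s'' ''x'' 0 = k \<and> P (set_var s'' ''x'' (Suc k)) \<and>
        set_var s'' ''x'' (Suc k) ''pw'' 0 = 3 ^ rank (B t) (Suc k) \<and>
        (set_var s'' ''x'' (Suc k) ''pu'' 0, set_var s'' ''x'' (Suc k) ''pv'' 0) = marks t (Suc k)"
        using sk by simp
    qed (use I in auto)
  next
    have "B t \<subseteq> {..<n}" using bag_less[OF assms(3)] by auto
    then show "P s' \<and> s' ''pw'' 0 = 3 ^ card (B t) \<and> (s' ''pu'' 0, s' ''pv'' 0) = marks t n"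
      if "P s' \<and> s' ''pw'' 0 = 3 ^ rank (B t) n \<and> (s' ''pu'' 0, s' ''pv'' 0) = marks t n" for s'
      using that by (simp add: rank_card)
  qed (use that n1 Pr n_less in \<open>auto simp: P_def agree_upd\<close>)
  have 3: "timed L ((3 ^ card (B t) + 1) * 450) (For ''k'' (var ''pw'') entry_step) s1 (\<lambda>s'.
    agree ?A s s' \<and> row_updated t (3 ^ card (B t)) ?g s s')"
    if s1: "P s1 \<and> s1 ''pw'' 0 = 3 ^ card (B t) \<and> (s1 ''pu'' 0, s1 ''pv'' 0) = marks t n" for s1
  proof (rule timed_For[where m = "3 ^ card (B t)" and T = 400 and
        I = "\<lambda>k s'. R s' \<and> row_updated t k ?g s s'"])
    have "R (set_var s1 ''k'' 0)" using s1 by (auto simp: R_def P_def agree_def)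
    then show "R (set_var s1 ''k'' 0) \<and> row_updated t 0 ?g s (set_var s1 ''k'' 0)"
      using Pr(3)[of s1] s1 assms(4) by (simp add: row_updated_0)
  next
    fix k s' assume k: "k < 3 ^ card (B t)" and I: "R s' \<and> row_updated t k ?g s s'"
      and sk: "s' ''k'' 0 = k"
    show "timed L 400 entry_step s' (\<lambda>s'. s' ''k'' 0 = k \<and> R (set_var s' ''k'' (Suc k)) \<and>
      row_updated t (Suc k) ?g s (set_var s' ''k'' (Suc k)))"
    proof (rule timed_weaken[OF entry_step_spec[where s = s' and k = k, OF _ _ assms(3) sk]])
      show "ready s'" "s' ''i'' 0 = t" using Rr[of s'] I by simp_all
      show "(s' ''pu'' 0, s' ''pv'' 0) = marks t n" using I by (simp add: R_def)
      show "s' ''T'' a < bm" for a using I by (simp add: row_updated_def)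
      fix s'' assume a: "agree {''e'', ''z'', ''T''} s' s'' \<and> s'' ''T'' = (s' ''T'')(t * bQ + k := ?g k)"
      have "s'' ''pw'' = s' ''pw''" "s'' ''pu'' = s' ''pu''" "s'' ''pv'' = s' ''pv''"
        using a by (auto intro!: agreeD)
      moreover have "agree ?A s (set_var s'' ''k'' (Suc k))"
        using a I by (auto simp: R_def agree_def)
      ultimately have "R (set_var s'' ''k'' (Suc k))" using I by (simp add: R_def)
      moreover have "s'' ''k'' = s' ''k''" using a by (intro agreeD) auto
      moreover have "row_updated t (Suc k) ?g s (set_var s'' ''k'' (Suc k))"
        using a bm_pos by (intro row_updated_Suc[OF conjunct2[OF I]]) auto
      ultimately show "s'' ''k'' 0 = k \<and> R (set_var s'' ''k'' (Suc k)) \<and>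
        row_updated t (Suc k) ?g s (set_var s'' ''k'' (Suc k))"
        using sk by simp
    qed simp
  next
    show "(3::nat) ^ card (B t) < 2 ^ L" using pow_card_le[OF assms(3)] by (rule le_bQ_less)
  qed (auto simp: R_def)
  have c1: "1 \<le> (3::nat) ^ card (B t)" by simp
  show ?thesis
    unfolding init_node_def
    by (rule timed_weaken, (rule timed_Seq 1 2 3 | assumption)+) (use n_pos c1 in auto)
qed


definition diff_bag :: "nat \<Rightarrow> nat \<Rightarrow> nat set" where
  "diff_bag t j = B t - B j \<union> (B j - B t)"

text \<open>The parameter registers after the scan of the vertices below \<open>k\<close>. A later
  difference would overwrite an earlier one, but adjacent bags differ in at most one vertex.\<close>

primrec params :: "nat set \<Rightarrow> nat \<Rightarrow> nat \<Rightarrow> nat \<Rightarrow> nat \<times> nat \<times> nat \<times> nat \<times> nat \<times> nat" where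
  "params M t j 0 = (1, 1, 1, 1, 0, 0)"
| "params M t j (Suc k) = (if k \<in> diff_bag t j then gather_params bX bU M t k else params M t j k)"

lemma params_outside: "(\<And>v. v < k \<Longrightarrow> v \<notin> diff_bag t j) \<Longrightarrow> params M t j k = (1, 1, 1, 1, 0, 0)"
  by (induction k) auto

lemma params_inside:
  assumes "j \<in> children D t" "t < N" "v \<in> diff_bag t j" "v < k"
  shows "params M t j k = gather_params bX bU M t v"
  using assms(4)
proof (induction k)
  case (Suc k)
  have "k \<in> diff_bag t j \<Longrightarrow> k = v"
    using bag_diff_unique[OF assms(1,2), of k v] assms(3) by (simp add: diff_bag_def)
  then show ?case using Suc assms(3) by (cases "k = v") (auto simp del: gather_params.simps)
qed simp

lemma gather_params_transfer:
  assumes "j \<in> children D t" "t < N" "x < 3 ^ card (B t)"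
    and "\<And>y. y < 3 ^ card (B j) \<Longrightarrow> T y = table bX bU M j (decode (B j) y) mod m"
  shows "gather T x (params M t j n) mod m = transfer bX bU M t j (decode (B t) x) mod m"
proof (rule gather_transfer[OF assms])
  fix v assume v: "v \<in> B t - B j \<union> (B j - B t)"
  then have "v < n" using bag_less assms(2) child_less[OF assms(1)] by blast
  then show "params M t j n = gather_params bX bU M t v"
    using v by (intro params_inside[OF assms(1,2)]) (simp_all add: diff_bag_def)
next
  assume "B t = B j"
  then show "params M t j n = (1, 1, 1, 1, 0, 0)"
    by (intro params_outside) (simp add: diff_bag_def)
qed

definition params_of :: "state \<Rightarrow> nat \<times> nat \<times> nat \<times> nat \<times> nat \<times> nat" where
  "params_of s = (s ''A'' 0, s ''B'' 0, s ''P'' 0, s ''w0'' 0, s ''w1'' 0, s ''w2'' 0)"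

definition forced :: "state \<Rightarrow> nat set" where
  "forced s = {v. s ''F'' v \<noteq> 0}"

text \<open>Truncation makes \<open>1 - F v\<close> the indicator of an unforced vertex, whatever
  nonzero value marks the forced ones.\<close>

lemma vertex_weight_forced:
  "(1 - s ''F'' v) * (X * (U - 1)) = vertex_weight X U (forced s) v 1"
  "(1 - s ''F'' v) * X = vertex_weight X U (forced s) v 2"
  by (cases "s ''F'' v"; simp add: vertex_weight_def forced_def)+

lemma vertex_weight_le: "d \<noteq> 0 \<Longrightarrow> vertex_weight bX bU M v d \<le> bm"
proof -
  have "bX * (bU - 1) \<le> bX * bU" by (intro mult_le_mono) auto
  then show "d \<noteq> 0 \<Longrightarrow> vertex_weight bX bU M v d \<le> bm"
    using order_trans[OF \<open>bX * (bU - 1) \<le> bX * bU\<close> bXU_le_bm] bX_le_bU bU_le_bm bm_pos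
    by (auto simp: vertex_weight_def)
qed

lemma params_weights_le:
  "params M t j k = (a, b, p, w0, w1, w2) \<Longrightarrow> w0 \<le> bm \<and> w1 \<le> bm \<and> w2 \<le> bm"
proof (induction k)
  case (Suc k)
  then show ?case
    using bU_le_bm bm_pos vertex_weight_le[of 1 M k] vertex_weight_le[of 2 M k]
    by (auto simp: Let_def split: if_splits)
qed (use bm_pos in auto)

lemma params_step_spec:
  assumes "ready s" "s ''i'' 0 = j" "j < N" "s ''t'' 0 = t" "t < N" "s ''x'' 0 = k" "k < n"
    "s ''pw'' 0 = 3 ^ rank (B t) k" "params_of s = params (forced s) t j k"
  shows "timed L 300 params_step s (\<lambda>s'.
    agree {''pw'', ''A'', ''B'', ''P'', ''w0'', ''w1'', ''w2''} s s' \<and>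
    s' ''pw'' 0 = 3 ^ rank (B t) (Suc k) \<and> params_of s' = params (forced s) t j (Suc k))"
  unfolding params_step_def
proof (rule timed_weaken[OF timed_wp])
  have i: "input_ok s" and c: "consts_ok s" using assms(1) by (simp_all add: ready_def)
  have pw: "s ''pw'' 0 < 2 ^ L" "3 * s ''pw'' 0 < 2 ^ L"
    using le_bQ_less[OF pow_rank_le[OF assms(5)]] assms(8) by (simp_all add: mult.commute)
  have r: "rank (B t) (Suc k) = (if k \<in> B t then Suc (rank (B t) k) else rank (B t) k)"
    by (rule rank_Suc[OF finite_bag[OF assms(5)]])
  have w: "vertex_weight bX bU (forced s) k 1 < 2 ^ L" "vertex_weight bX bU (forced s) k 2 < 2 ^ L"
    by (rule le_bm_less, rule vertex_weight_le, simp)+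
  have F: "(Suc 0 - s ''F'' k) * (bX * (bU - Suc 0)) = vertex_weight bX bU (forced s) k 1"
    "(Suc 0 - s ''F'' k) * bX = vertex_weight bX bU (forced s) k 2"
    using vertex_weight_forced[of s k] by simp_all
  have UL: "bU < 2 ^ L" "1 < (2::nat) ^ L" by (rule le_bm_less, use bU_le_bm bm_pos in simp)+
  have m: "params (forced s) t j k = (s ''A'' 0, s ''B'' 0, s ''P'' 0, s ''w0'' 0, s ''w1'' 0, s ''w2'' 0)"
    using assms(9) by (simp add: params_of_def)
  show "wp L (If (matrix ''bag'' (var ''t'') (var ''x''))
      (If (matrix ''bag'' (var ''i'') (var ''x'')) Skip
         (''A'' ::= Const 3 [*] var ''pw'' ;; ''B'' ::= var ''pw'' ;; ''P'' ::= var ''pw'' ;;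
          ''w0'' ::= Const 1 ;; ''w1'' ::= Const 0 ;; ''w2'' ::= Const 0) ;;
       ''pw'' ::= var ''pw'' [*] Const 3)
      (If (matrix ''bag'' (var ''i'') (var ''x''))
         (''A'' ::= var ''pw'' ;; ''B'' ::= Const 3 [*] var ''pw'' ;; ''P'' ::= var ''pw'' ;;
          ''w0'' ::= var ''U'' ;;
          ''w1'' ::= (Const 1 [-] Load ''F'' (var ''x'')) [*] (var ''X'' [*] (var ''U'' [-] Const 1)) ;;
          ''w2'' ::= (Const 1 [-] Load ''F'' (var ''x'')) [*] var ''X'')
         Skip)) (\<lambda>s'.
    agree {''pw'', ''A'', ''B'', ''P'', ''w0'', ''w1'', ''w2''} s s' \<and>
    s' ''pw'' 0 = 3 ^ rank (B t) (Suc k) \<and> params_of s' = params (forced s) t j (Suc k)) s"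
    using pw w UL assms(2-8)
    by (cases "k \<in> B t"; cases "k \<in> B j")
      (simp_all add: input_okD[OF i] consts_okD[OF c] r m agree_upd F diff_bag_def params_of_def Let_def)
qed simp_all

lemma push_step_spec:
  assumes "ready s" "s ''i'' 0 = j" "s ''t'' 0 = t" "s ''k'' 0 = k"
    "params_of s = params M t j n" "\<And>a. s ''T'' a < bm"
  shows "timed L 400 push_step s (\<lambda>s'. agree {''z'', ''T''} s s' \<and>
    s' ''T'' = (s ''T'')(t * bQ + k :=
      (s ''T'' (t * bQ + k) * gather (\<lambda>y. s ''T'' (j * bQ + y)) k (params M t j n)) mod bm))"
  unfolding push_step_def
proof (rule timed_weaken[OF timed_wp])
  have c: "consts_ok s" using assms(1) by (simp add: ready_def)
  obtain a b p w0 w1 w2 where ps: "params M t j n = (a, b, p, w0, w1, w2)"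
    by (metis prod_cases6)
  have st: "s ''A'' 0 = a" "s ''B'' 0 = b" "s ''P'' 0 = p" "s ''w0'' 0 = w0" "s ''w1'' 0 = w1" "s ''w2'' 0 = w2"
    using assms(5) unfolding ps params_of_def by simp_all
  define g where "g = gather (\<lambda>y. s ''T'' (j * bQ + y)) k (params M t j n)"
  let ?y = "k div a * b + (k - k div p * p)"
  have g: "g = w0 * s ''T'' (j * bQ + ?y) + w1 * s ''T'' (j * bQ + (?y + p)) + w2 * s ''T'' (j * bQ + (?y + 2 * p))"
    by (simp add: g_def ps Let_def)
  have Tm: "s ''T'' x \<le> bm" for x using assms(6) less_imp_le by blast
  have "g \<le> bm * bm + bm * bm + bm * bm"
    unfolding g using params_weights_le[OF ps] Tm by (intro add_mono mult_le_mono) auto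
  then have "s ''T'' (t * bQ + k) * g \<le> bm * (bm * bm + bm * bm + bm * bm)"
    using Tm by (intro mult_le_mono)
  also have "\<dots> \<le> 4 * bm ^ 3" by (simp add: power3_eq_cube)
  finally have zL: "s ''T'' (t * bQ + k) * g < 2 ^ L" by (rule less_bound)
  have mL: "x mod bm < 2 ^ L" for x using bm_pos by (intro le_bm_less) (simp add: less_imp_le)
  show "wp L (''z'' ::= Load ''T'' (cell ''t'' (var ''k'')) [*]
      (var ''w0'' [*] Load ''T'' (cell ''i'' base_exp) [+]
       var ''w1'' [*] Load ''T'' (cell ''i'' (base_exp [+] var ''P'')) [+]
       var ''w2'' [*] Load ''T'' (cell ''i'' (base_exp [+] Const 2 [*] var ''P''))) ;;
    Store ''T'' (cell ''t'' (var ''k'')) (reduced ''z'')) (\<lambda>s'. agree {''z'', ''T''} s s' \<and>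
    s' ''T'' = (s ''T'')(t * bQ + k := (s ''T'' (t * bQ + k) *
      gather (\<lambda>y. s ''T'' (j * bQ + y)) k (params M t j n)) mod bm)) s"
    using zL mL
    by (simp add: assms(2-4) st consts_okD[OF c] agree_upd minus_div_mult_eq_mod flip: g_def)
      (simp add: g add.assoc minus_div_mult_eq_mod)
qed simp_all

text \<open>The common stride \<open>3 ^ n\<close> is at least the length of any row, so rows of
  different lengths do not overlap.\<close>

lemma cell_inject:
  assumes "t < N" "j < N" "x < 3 ^ card (B t)" "y < 3 ^ card (B j)" "t * bQ + x = j * bQ + y"
  shows "t = j \<and> x = y"
proof -
  have xy: "x < bQ" "y < bQ" using pow_card_le assms(1-4) by (meson less_le_trans)+
  have "(t * bQ + x) div bQ = t" "(t * bQ + x) mod bQ = x" using xy by simp_all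
  moreover have "(j * bQ + y) div bQ = j" "(j * bQ + y) mod bQ = y" using xy by simp_all
  ultimately show ?thesis using assms(5) by metis
qed

lemma push_node_spec:
  assumes "ready s" "s ''i'' 0 = j" "j < N" "j \<noteq> rt" "\<And>a. s ''T'' a < bm"
    and t: "t = par j" and M: "M = forced s"
    and Tj: "\<And>y. y < 3 ^ card (B j) \<Longrightarrow> s ''T'' (j * bQ + y) = table bX bU M j (decode (B j) y) mod bm"
  shows "timed L (3000 * (n + 3 ^ card (B t))) push_node s (\<lambda>s'.
    agree {''t'', ''A'', ''B'', ''P'', ''w0'', ''w1'', ''w2'', ''pw'', ''x'', ''k'', ''z'', ''T''} s s' \<and>
    row_updated t (3 ^ card (B t))
      (\<lambda>x. s ''T'' (t * bQ + x) * transfer bX bU M t j (decode (B t) x) mod bm) s s')"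
proof -
  let ?g = "\<lambda>x. s ''T'' (t * bQ + x) * transfer bX bU M t j (decode (B t) x) mod bm"
  let ?A = "{''t'', ''A'', ''B'', ''P'', ''w0'', ''w1'', ''w2'', ''pw'', ''x'', ''k'', ''z'', ''T''}"
  define P where "P s' \<longleftrightarrow> agree {''t'', ''A'', ''B'', ''P'', ''w0'', ''w1'', ''w2'', ''pw'', ''x''} s s' \<and>
    s' ''t'' 0 = t" for s'
  define R where "R s' \<longleftrightarrow> agree ?A s s' \<and> s' ''t'' 0 = t \<and> s' ''pw'' 0 = 3 ^ card (B t) \<and>
    params_of s' = params M t j n" for s'
  have tN: "t < N" using assms(3) t par_less by simp
  have jt: "j \<in> children D t" using assms(3,4) t by (simp add: children_eq)
  have ne: "t \<noteq> j" using child_height[OF jt] by auto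
  have Pr: "ready s'" "s' ''i'' 0 = j" "s' ''T'' = s ''T''" "forced s' = M" if "P s'" for s'
  proof -
    have a: "agree {''t'', ''A'', ''B'', ''P'', ''w0'', ''w1'', ''w2'', ''pw'', ''x''} s s'"
      using that by (simp add: P_def)
    have "s' ''F'' = s ''F''" using a by (intro agreeD) auto
    then show "forced s' = M" by (simp add: M forced_def)
    show "ready s'" "s' ''i'' 0 = j" "s' ''T'' = s ''T''"
      using ready_agree[OF a assms(1)] agreeD[OF a] assms(2) by auto
  qed
  have Rr: "ready s'" "s' ''i'' 0 = j" if "R s'" for s'
    using that ready_agree[OF _ assms(1)] agreeD[of ?A s s'] assms(2) by (auto simp: R_def)
  have 1: "timed L 100 (''t'' ::= Load ''parent'' (var ''i'') ;;
     ''A'' ::= Const 1 ;; ''B'' ::= Const 1 ;; ''P'' ::= Const 1 ;;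
     ''w0'' ::= Const 1 ;; ''w1'' ::= Const 0 ;; ''w2'' ::= Const 0 ;; ''pw'' ::= Const 1) s
      (\<lambda>s'. P s' \<and> s' ''pw'' 0 = 1 \<and> params_of s' = (1, 1, 1, 1, 0, 0))"
  proof (rule timed_weaken[OF timed_wp])
    have "s ''parent'' j = t" using assms(1,3) t by (simp add: ready_def input_ok_def)
    moreover have "t < 2 ^ L" "1 < (2::nat) ^ L"
      using tN N_bound by (simp, intro le_bm_less) (use bm_pos in simp)
    ultimately show "wp L (''t'' ::= Load ''parent'' (var ''i'') ;;
     ''A'' ::= Const 1 ;; ''B'' ::= Const 1 ;; ''P'' ::= Const 1 ;;
     ''w0'' ::= Const 1 ;; ''w1'' ::= Const 0 ;; ''w2'' ::= Const 0 ;; ''pw'' ::= Const 1)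
      (\<lambda>s'. P s' \<and> s' ''pw'' 0 = 1 \<and> params_of s' = (1, 1, 1, 1, 0, 0)) s"
      using assms(2) by (simp add: P_def agree_upd params_of_def)
  qed simp_all
  have 2: "timed L ((n + 1) * 350) (For ''x'' (var ''n'') params_step) s1
      (\<lambda>s'. P s' \<and> s' ''pw'' 0 = 3 ^ card (B t) \<and> params_of s' = params M t j n)"
    if "P s1 \<and> s1 ''pw'' 0 = 1 \<and> params_of s1 = (1, 1, 1, 1, 0, 0)" for s1
  proof (rule timed_For[where m = n and T = 300 and I = "\<lambda>k s'. P s' \<and>
        s' ''pw'' 0 = 3 ^ rank (B t) k \<and> params_of s' = params M t j k"])
    show "P (set_var s1 ''x'' 0) \<and> set_var s1 ''x'' 0 ''pw'' 0 = 3 ^ rank (B t) 0 \<and>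
        params_of (set_var s1 ''x'' 0) = params M t j 0"
      using that by (simp add: P_def agree_upd params_of_def)
  next
    fix k s' assume k: "k < n" and I: "P s' \<and> s' ''pw'' 0 = 3 ^ rank (B t) k \<and>
      params_of s' = params M t j k" and sk: "s' ''x'' 0 = k"
    have st: "s' ''t'' 0 = t" using I by (simp add: P_def)
    show "timed L 300 params_step s' (\<lambda>s'. s' ''x'' 0 = k \<and> P (set_var s' ''x'' (Suc k)) \<and>
        set_var s' ''x'' (Suc k) ''pw'' 0 = 3 ^ rank (B t) (Suc k) \<and>
        params_of (set_var s' ''x'' (Suc k)) = params M t j (Suc k))"
    proof (rule timed_weaken[OF params_step_spec[where s = s' and k = k, OF _ _ assms(3) st tN sk k]])
      show "ready s'" "s' ''i'' 0 = j" using Pr[of s'] I by simp_all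
      show "params_of s' = params (forced s') t j k" using Pr[of s'] I by simp
      fix s'' assume a: "agree {''pw'', ''A'', ''B'', ''P'', ''w0'', ''w1'', ''w2''} s' s'' \<and>
        s'' ''pw'' 0 = 3 ^ rank (B t) (Suc k) \<and> params_of s'' = params (forced s') t j (Suc k)"
      have "P (set_var s'' ''x'' (Suc k))" using a I by (auto simp: P_def agree_def)
      moreover have "s'' ''x'' = s' ''x''" using a by (intro agreeD) auto
      moreover have "params_of (set_var s'' ''x'' (Suc k)) = params_of s''"
        by (simp add: params_of_def)
      ultimately show "s'' ''x'' 0 = k \<and> P (set_var s'' ''x'' (Suc k)) \<and>
        set_var s'' ''x'' (Suc k) ''pw'' 0 = 3 ^ rank (B t) (Suc k) \<and>
        params_of (set_var s'' ''x'' (Suc k)) = params M t j (Suc k)"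
        using sk a Pr(4)[of s'] I by (simp del: params.simps)
    qed (use I in auto)
  next
    have "B t \<subseteq> {..<n}" using bag_less[OF tN] by auto
    then show "P s' \<and> s' ''pw'' 0 = 3 ^ card (B t) \<and> params_of s' = params M t j n"
      if "P s' \<and> s' ''pw'' 0 = 3 ^ rank (B t) n \<and> params_of s' = params M t j n" for s'
      using that by (simp add: rank_card)
  next
    fix k s' assume "P s' \<and> s' ''pw'' 0 = 3 ^ rank (B t) k \<and> params_of s' = params M t j k"
    then show "exp_val (var ''n'') s' = n" using Pr(1)[of s'] by (simp add: ready_def input_ok_def)
  qed (use n_less in simp_all)
  have 3: "timed L ((3 ^ card (B t) + 1) * 450) (For ''k'' (var ''pw'') push_step) s1 (\<lambda>s'.
    agree ?A s s' \<and> row_updated t (3 ^ card (B t)) ?g s s')"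
    if s1: "P s1 \<and> s1 ''pw'' 0 = 3 ^ card (B t) \<and> params_of s1 = params M t j n" for s1
  proof (rule timed_For[where m = "3 ^ card (B t)" and T = 400 and
        I = "\<lambda>k s'. R s' \<and> row_updated t k ?g s s'"])
    have "R (set_var s1 ''k'' 0)" using s1 by (auto simp: R_def P_def agree_def params_of_def)
    then show "R (set_var s1 ''k'' 0) \<and> row_updated t 0 ?g s (set_var s1 ''k'' 0)"
      using Pr(3)[of s1] s1 assms(5) by (simp add: row_updated_0)
  next
    fix k s' assume k: "k < 3 ^ card (B t)" and I: "R s' \<and> row_updated t k ?g s s'"
      and sk: "s' ''k'' 0 = k"
    \<comment> \<open>Row \<open>t\<close> is overwritten while row \<open>j\<close> is being read.
      What matters is that the row of the child and the current entry of row \<open>t\<close> are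
      still untouched, by disjointness of rows and because every entry is treated only once.\<close>
    have old: "s' ''T'' a = s ''T'' a" if "\<forall>x<k. a \<noteq> t * bQ + x" for a
      using I that unfolding row_updated_def by blast
    have Tj': "s' ''T'' (j * bQ + y) = table bX bU M j (decode (B j) y) mod bm"
      if y: "y < 3 ^ card (B j)" for y
    proof -
      have "\<forall>x<k. j * bQ + y \<noteq> t * bQ + x"
        using cell_inject[OF assms(3) tN y] k ne less_trans by blast
      then show ?thesis using Tj[OF y] old by simp
    qed
    have Tt: "s' ''T'' (t * bQ + k) = s ''T'' (t * bQ + k)"
      by (rule old) auto
    have new: "s' ''T'' (t * bQ + k) * gather (\<lambda>y. s' ''T'' (j * bQ + y)) k (params M t j n) mod bm = ?g k"
      unfolding Tt by (rule mod_mult_cong[OF refl gather_params_transfer[OF jt tN k Tj']])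
    show "timed L 400 push_step s' (\<lambda>s'. s' ''k'' 0 = k \<and> R (set_var s' ''k'' (Suc k)) \<and>
      row_updated t (Suc k) ?g s (set_var s' ''k'' (Suc k)))"
    proof (rule timed_weaken[OF push_step_spec[where s = s' and k = k and M = M and t = t and j = j, OF _ _ _ sk]])
      show "ready s'" "s' ''i'' 0 = j" using Rr[of s'] I by simp_all
      show "params_of s' = params M t j n" "s' ''t'' 0 = t" using I by (simp_all add: R_def)
      show "s' ''T'' a < bm" for a using I by (simp add: row_updated_def)
      fix s'' assume "agree {''z'', ''T''} s' s'' \<and> s'' ''T'' = (s' ''T'')(t * bQ + k :=
          s' ''T'' (t * bQ + k) * gather (\<lambda>y. s' ''T'' (j * bQ + y)) k (params M t j n) mod bm)"
      then have a: "agree {''z'', ''T''} s' s''" "s'' ''T'' = (s' ''T'')(t * bQ + k := ?g k)"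
        by (simp_all only: new)
      have "s'' ''pw'' = s' ''pw''" "s'' ''t'' = s' ''t''" "params_of s'' = params_of s'"
        using agreeD[OF a(1)] by (simp_all add: params_of_def)
      moreover have "agree ?A s (set_var s'' ''k'' (Suc k))"
        using a(1) I by (auto simp: R_def agree_def)
      moreover have "params_of (set_var s'' ''k'' (Suc k)) = params_of s''"
        by (simp add: params_of_def)
      ultimately have "R (set_var s'' ''k'' (Suc k))" using I by (simp add: R_def)
      moreover have "s'' ''k'' = s' ''k''" using a by (intro agreeD) auto
      moreover have "row_updated t (Suc k) ?g s (set_var s'' ''k'' (Suc k))"
        using a(2) bm_pos by (intro row_updated_Suc[OF conjunct2[OF I]]) auto
      ultimately show "s'' ''k'' 0 = k \<and> R (set_var s'' ''k'' (Suc k)) \<and>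
        row_updated t (Suc k) ?g s (set_var s'' ''k'' (Suc k))"
        using sk by simp
    qed simp
  next
    show "(3::nat) ^ card (B t) < 2 ^ L" using pow_card_le[OF tN] by (rule le_bQ_less)
  qed (auto simp: R_def)
  have c1: "1 \<le> (3::nat) ^ card (B t)" by simp
  show ?thesis
    unfolding push_node_def
    by (rule timed_weaken, (rule timed_Seq 1 2 3 | assumption)+) (use n_pos c1 in auto)
qed

text \<open>The nodes whose pair of height and number is lexicographically below
  \<open>(d, i)\<close>, that is, those handled when pass \<open>d\<close> arrives at index
  \<open>i\<close>. One notion serves as invariant for both nested loops.\<close>

definition pushed :: "nat \<Rightarrow> nat \<Rightarrow> nat set" where
  "pushed d i = {j. j < N \<and> (height j < d \<or> height j = d \<and> j < i)}"

text \<open>The meaning of a row when just the children in \<open>A\<close> have been pushed; it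
  interpolates between the label factor and the full table.\<close>

definition partial_table :: "nat set \<Rightarrow> nat set \<Rightarrow> nat \<Rightarrow> (nat \<Rightarrow> nat) \<Rightarrow> nat" where
  "partial_table M A t f =
     label_factor bU t f * (\<Prod>j\<in>children D t \<inter> A. transfer bX bU M t j f)"

definition tables :: "nat set \<Rightarrow> nat set \<Rightarrow> state \<Rightarrow> bool" where
  "tables M A s \<longleftrightarrow> (\<forall>a. s ''T'' a < bm) \<and>
     (\<forall>t<N. \<forall>x<3 ^ card (B t). s ''T'' (t * bQ + x) = partial_table M A t (decode (B t) x) mod bm)"

lemma partial_table_complete:
  "t < N \<Longrightarrow> children D t \<subseteq> A \<Longrightarrow> partial_table M A t f = table bX bU M t f"
  by (simp add: partial_table_def table_rec Int_absorb2)

lemma partial_table_insert: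
  assumes "j \<notin> A" "j < N" "j \<noteq> rt"
  shows "partial_table M (insert j A) t f =
    (if t = par j then partial_table M A t f * transfer bX bU M t j f else partial_table M A t f)"
proof (cases "t = par j")
  case True
  then have "children D t \<inter> insert j A = insert j (children D t \<inter> A)"
    using assms by (auto simp: children_eq)
  then show ?thesis using True assms(1) by (simp add: partial_table_def mult_ac)
next
  case False
  then have "children D t \<inter> insert j A = children D t \<inter> A" by (auto simp: children_eq)
  then show ?thesis using False by (simp add: partial_table_def)
qed

text \<open>Children are exactly one level lower and belong to an earlier pass, so the row of a node
  is complete when its turn comes.\<close>

lemma children_pushed: "height j = d \<Longrightarrow> children D j \<subseteq> pushed d i"
  using child_height child_less by (fastforce simp: pushed_def)

lemma pushed_Suc:
  "i < N \<Longrightarrow> pushed d (Suc i) = (if height i = d then insert i (pushed d i) else pushed d i)"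
  by (auto simp: pushed_def less_Suc_eq)

lemma pushed_N: "pushed d N = pushed (Suc d) 0"
  by (auto simp: pushed_def)

lemma pushed_0: "pushed 0 0 = {}"
  by (auto simp: pushed_def)

definition work_vars :: "string set" where
  "work_vars = {''t'', ''A'', ''B'', ''P'', ''w0'', ''w1'', ''w2'', ''pw'', ''pu'', ''pv'', ''e'',
     ''x'', ''k'', ''z'', ''T'', ''i'', ''d''}"

lemma work_trans: "agree work_vars s s' \<Longrightarrow> agree A s' s'' \<Longrightarrow> A \<subseteq> work_vars \<Longrightarrow> agree work_vars s s''"
  by (rule agree_trans[of work_vars s s' A s'']) auto

lemma work_set_var: "agree work_vars s s' \<Longrightarrow> a \<in> work_vars \<Longrightarrow> agree work_vars s (set_var s' a x)"
  by (rule agree_upd)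

lemma work_ready: "agree work_vars s s' \<Longrightarrow> ready s \<Longrightarrow> ready s'"
  by (rule ready_agree) (auto simp: work_vars_def)

lemma work_forced: "agree work_vars s s' \<Longrightarrow> forced s' = forced s"
  using agreeD[of work_vars s s' "''F''"] by (simp add: work_vars_def forced_def)

lemma readyD: "ready s \<Longrightarrow> s ''N'' 0 = N" "ready s \<Longrightarrow> i < N \<Longrightarrow> s ''h'' i = height i"
  by (simp_all add: ready_def input_ok_def)

lemma tables_upd: "a \<noteq> ''T'' \<Longrightarrow> tables M A (s(a := f)) = tables M A s"
  by (simp add: tables_def)

lemma init_spec:
  assumes "ready s" "\<And>a. s ''T'' a < bm" and E3: "\<And>t. t < N \<Longrightarrow> 3 ^ card (B t) \<le> E3" "E3 \<ge> 1"
  shows "timed L (4200 * (N * (n + E3))) (For ''i'' (var ''N'') init_node) s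
    (\<lambda>s'. agree work_vars s s' \<and> tables M {} s')"
proof (rule timed_For[where m = N and T = "2000 * (n + E3)" and I = "\<lambda>k s'. agree work_vars s s' \<and>
      (\<forall>a. s' ''T'' a < bm) \<and> (\<forall>t<k. \<forall>x<3 ^ card (B t).
        s' ''T'' (t * bQ + x) = label_factor bU t (decode (B t) x) mod bm)"])
  show "agree work_vars s (set_var s ''i'' 0) \<and> (\<forall>a. set_var s ''i'' 0 ''T'' a < bm) \<and>
      (\<forall>t<0. \<forall>x<3 ^ card (B t). set_var s ''i'' 0 ''T'' (t * bQ + x) = label_factor bU t (decode (B t) x) mod bm)"
    using assms(2) by (simp add: agree_upd work_vars_def)
next
  fix k s' assume k: "k < N" and I: "agree work_vars s s' \<and>
      (\<forall>a. s' ''T'' a < bm) \<and> (\<forall>t<k. \<forall>x<3 ^ card (B t).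
        s' ''T'' (t * bQ + x) = label_factor bU t (decode (B t) x) mod bm)" and sk: "s' ''i'' 0 = k"
  show "timed L (2000 * (n + E3)) init_node s' (\<lambda>s'. s' ''i'' 0 = k \<and>
      agree work_vars s (set_var s' ''i'' (Suc k)) \<and> (\<forall>a. set_var s' ''i'' (Suc k) ''T'' a < bm) \<and>
      (\<forall>t<Suc k. \<forall>x<3 ^ card (B t). set_var s' ''i'' (Suc k) ''T'' (t * bQ + x) =
        label_factor bU t (decode (B t) x) mod bm))"
  proof (rule timed_weaken[OF init_node_spec[where s = s' and t = k, OF _ sk k]])
    show "ready s'" using I work_ready assms(1) by blast
    show "s' ''T'' a < bm" for a using I by simp
    show "2000 * (n + 3 ^ card (B k)) \<le> 2000 * (n + E3)" using E3(1)[OF k] by simp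
    fix s'' assume a: "agree {''pw'', ''pu'', ''pv'', ''x'', ''k'', ''e'', ''z'', ''T''} s' s'' \<and>
      row_updated k (3 ^ card (B k)) (\<lambda>x. label_factor bU k (decode (B k) x) mod bm) s' s''"
    note u = conjunct2[OF a, unfolded row_updated_def]
    have "s'' ''T'' (t * bQ + x) = label_factor bU t (decode (B t) x) mod bm"
      if "t < Suc k" "x < 3 ^ card (B t)" for t x
    proof (cases "t = k")
      case True
      then show ?thesis using u that by blast
    next
      case False
      then have t: "t < k" "t < N" using that k by auto
      have "\<forall>y<3 ^ card (B k). t * bQ + x \<noteq> k * bQ + y"
        using cell_inject[OF t(2) k that(2)] False by blast
      then have "s'' ''T'' (t * bQ + x) = s' ''T'' (t * bQ + x)" using u by blast
      then show ?thesis using I t that by simp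
    qed
    moreover have "agree work_vars s s''"
      by (rule work_trans[OF conjunct1[OF I] conjunct1[OF a]]) (simp add: work_vars_def)
    then have "agree work_vars s (set_var s'' ''i'' (Suc k))"
      by (rule work_set_var) (simp add: work_vars_def)
    moreover have "s'' ''i'' = s' ''i''" using a by (intro agreeD) auto
    ultimately show "s'' ''i'' 0 = k \<and>
      agree work_vars s (set_var s'' ''i'' (Suc k)) \<and> (\<forall>a. set_var s'' ''i'' (Suc k) ''T'' a < bm) \<and>
      (\<forall>t<Suc k. \<forall>x<3 ^ card (B t). set_var s'' ''i'' (Suc k) ''T'' (t * bQ + x) =
        label_factor bU t (decode (B t) x) mod bm)"
      using sk u by simp
  qed
next
  fix k s' assume "agree work_vars s s' \<and>
      (\<forall>a. s' ''T'' a < bm) \<and> (\<forall>t<k. \<forall>x<3 ^ card (B t).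
        s' ''T'' (t * bQ + x) = label_factor bU t (decode (B t) x) mod bm)"
  then show "exp_val (var ''N'') s' = N" using work_ready[of s s'] assms(1) readyD(1) by simp
next
  fix s' assume "agree work_vars s s' \<and>
      (\<forall>a. s' ''T'' a < bm) \<and> (\<forall>t<N. \<forall>x<3 ^ card (B t).
        s' ''T'' (t * bQ + x) = label_factor bU t (decode (B t) x) mod bm)"
  then show "agree work_vars s s' \<and> tables M {} s'"
    by (simp add: tables_def partial_table_def)
next
  obtain N' where N': "N = Suc N'" using root_less by (metis gr0_implies_Suc gr_zeroI not_less0)
  show "(N + 1) * (2000 * (n + E3) + exp_time (var ''N'') + exp_width (var ''N'') + 20) \<le> 4200 * (N * (n + E3))"
  proof -
    have "2000 * (n + E3) + exp_time (var ''N'') + exp_width (var ''N'') + 20 \<le> 2023 * (n + E3)"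
      using E3(2) by simp
    then have "(N + 1) * (2000 * (n + E3) + exp_time (var ''N'') + exp_width (var ''N'') + 20) \<le>
        (N + 1) * (2023 * (n + E3))" by (rule mult_le_mono2)
    also have "\<dots> \<le> (2 * N) * (2023 * (n + E3))" by (intro mult_le_mono) (simp_all add: N')
    also have "\<dots> \<le> 4200 * (N * (n + E3))" by simp
    finally show ?thesis .
  qed
qed (rule N_bound)

text \<open>The expensive summand is charged only if the height matches the pass. Over all passes
  each node pays for at most one push, which keeps the quadratic part of the time free of table
  sizes.\<close>

lemma push_level_step:
  assumes "ready s" "tables M (pushed d i) s" "M = forced s" "s ''i'' 0 = i" "i < N" "s ''d'' 0 = d" "d < N"
    and E3: "3 ^ card (B (par i)) \<le> E3"
  shows "timed L (100 + (if height i = d then 3000 * (n + E3) else 0))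
    (If (differ (Load ''h'' (var ''i'')) (var ''d'')) Skip push_node) s
    (\<lambda>s'. agree (work_vars - {''i'', ''d''}) s s' \<and> tables M (pushed d (Suc i)) s')"
proof (cases "height i = d")
  case False
  have "timed L (exp_time (differ (Load ''h'' (var ''i'')) (var ''d'')) + 1 + 0)
    (If (differ (Load ''h'' (var ''i'')) (var ''d'')) Skip push_node) s
    (\<lambda>s'. agree (work_vars - {''i'', ''d''}) s s' \<and> tables M (pushed d (Suc i)) s')"
  proof (rule timed_If)
    show "timed L 1 Skip s (\<lambda>s'. agree (work_vars - {''i'', ''d''}) s s' \<and> tables M (pushed d (Suc i)) s')"
      using False assms(2,5) by (intro timed_Skip) (simp add: pushed_Suc)
  qed (use False assms readyD in simp)
  then show ?thesis by (rule timed_weaken) (simp_all add: differ_def)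
next
  case True
  \<comment> \<open>The root has height \<open>N\<close>, beyond the last pass, so a node to be
    pushed has a genuine parent.\<close>
  have rt: "i \<noteq> rt" using True assms(7) height_root by auto
  have "timed L (exp_time (differ (Load ''h'' (var ''i'')) (var ''d'')) + 0 + 3000 * (n + E3))
    (If (differ (Load ''h'' (var ''i'')) (var ''d'')) Skip push_node) s
    (\<lambda>s'. agree (work_vars - {''i'', ''d''}) s s' \<and> tables M (pushed d (Suc i)) s')"
  proof (rule timed_If)
    show "timed L (3000 * (n + E3)) push_node s
      (\<lambda>s'. agree (work_vars - {''i'', ''d''}) s s' \<and> tables M (pushed d (Suc i)) s')"
    proof (rule timed_weaken[OF push_node_spec[OF assms(1,4,5) rt _ refl assms(3)]])
      show "s ''T'' a < bm" for a using assms(2) by (simp add: tables_def)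
      show "s ''T'' (i * bQ + y) = table bX bU M i (decode (B i) y) mod bm"
        if "y < 3 ^ card (B i)" for y
        using assms(2,5) that partial_table_complete[OF assms(5) children_pushed[OF True]]
        by (simp add: tables_def)
      show "3000 * (n + 3 ^ card (B (par i))) \<le> 3000 * (n + E3)" using E3 by simp
      fix s' assume a: "agree {''t'', ''A'', ''B'', ''P'', ''w0'', ''w1'', ''w2'', ''pw'', ''x'', ''k'', ''z'', ''T''} s s' \<and>
        row_updated (par i) (3 ^ card (B (par i))) (\<lambda>x. s ''T'' (par i * bQ + x) *
          transfer bX bU M (par i) i (decode (B (par i)) x) mod bm) s s'"
      note u = conjunct2[OF a, unfolded row_updated_def]
      have "i \<notin> pushed d i" using True by (simp add: pushed_def)
      note ins = partial_table_insert[OF this assms(5) rt]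
      have "s' ''T'' (t * bQ + x) = partial_table M (pushed d (Suc i)) t (decode (B t) x) mod bm"
        if t: "t < N" "x < 3 ^ card (B t)" for t x
      proof (cases "t = par i")
        case tp: True
        have "s ''T'' (t * bQ + x) = partial_table M (pushed d i) t (decode (B t) x) mod bm"
          using assms(2) t by (simp add: tables_def)
        then have "s' ''T'' (t * bQ + x) = (partial_table M (pushed d i) t (decode (B t) x) mod bm) *
            transfer bX bU M t i (decode (B t) x) mod bm"
          using u t tp by simp
        then show ?thesis
          using ins[of M t] tp True assms(5) by (simp add: pushed_Suc mod_mult_left_eq)
      next
        case tp: False
        have "\<forall>y<3 ^ card (B (par i)). t * bQ + x \<noteq> par i * bQ + y"
          using cell_inject[OF t(1) par_less[OF assms(5)] t(2)] tp by blast
        then have "s' ''T'' (t * bQ + x) = s ''T'' (t * bQ + x)" using u by blast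
        then show ?thesis
          using assms(2) t ins[of M t] tp True assms(5) by (simp add: tables_def pushed_Suc)
      qed
      moreover have "agree (work_vars - {''i'', ''d''}) s s'"
        by (rule agree_trans[OF agree_refl conjunct1[OF a], of "{}"]) (simp add: work_vars_def)
      ultimately show "agree (work_vars - {''i'', ''d''}) s s' \<and> tables M (pushed d (Suc i)) s'"
        using u by (simp add: tables_def)
    qed
  qed (use True assms readyD in simp)
  then show ?thesis by (rule timed_weaken) (simp_all add: differ_def True)
qed

lemma table_spec:
  assumes "ready s" "\<And>a. s ''T'' a < bm" and E3: "\<And>t. t < N \<Longrightarrow> 3 ^ card (B t) \<le> E3" "E3 \<ge> 1"
  shows "timed L (10000 * (N * (n + E3) + N * N)) table_prog s
    (\<lambda>s'. agree work_vars s s' \<and> (\<forall>a. s' ''T'' a < bm) \<and>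
      exp_val result s' = bU ^ n * dissociation_poly bX E ({..<n} - forced s))"
proof -
  define M where "M = forced s"
  define PC where "PC = 3000 * (n + E3)"
  obtain N' where N': "N = Suc N'" using root_less by (metis gr0_implies_Suc gr_zeroI not_less0)
  let ?body = "If (differ (Load ''h'' (var ''i'')) (var ''d'')) Skip push_node"
  have inner: "timed L (200 * N + (\<Sum>i<N. if height i = d then PC else 0)) (For ''i'' (var ''N'') ?body) s1
    (\<lambda>s'. agree work_vars s s' \<and> s' ''d'' 0 = d \<and> tables M (pushed (Suc d) 0) s')"
    if s1: "agree work_vars s s1" "s1 ''d'' 0 = d" "tables M (pushed d 0) s1" and d: "d < N" for s1 d
  proof (rule timed_For_sum[where m = N and T = "\<lambda>i. 100 + (if height i = d then PC else 0)" and
        I = "\<lambda>i s'. agree work_vars s s' \<and> s' ''d'' 0 = d \<and> tables M (pushed d i) s'"])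
    show "agree work_vars s (set_var s1 ''i'' 0) \<and> set_var s1 ''i'' 0 ''d'' 0 = d \<and>
        tables M (pushed d 0) (set_var s1 ''i'' 0)"
      using s1 by (simp add: tables_upd work_set_var) (simp add: work_vars_def agree_upd)
  next
    fix i s' assume I: "agree work_vars s s' \<and> s' ''d'' 0 = d \<and> tables M (pushed d i) s'"
      and i: "i < N" and si: "s' ''i'' 0 = i"
    show "timed L (100 + (if height i = d then PC else 0)) ?body s' (\<lambda>s'. s' ''i'' 0 = i \<and>
        agree work_vars s (set_var s' ''i'' (Suc i)) \<and> set_var s' ''i'' (Suc i) ''d'' 0 = d \<and>
        tables M (pushed d (Suc i)) (set_var s' ''i'' (Suc i)))"
      unfolding PC_def
    proof (rule timed_weaken[OF push_level_step[where s = s' and i = i and d = d and M = M and ?E3.0 = E3]])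
      show "ready s'" using I work_ready assms(1) by blast
      show "M = forced s'" using I work_forced[of s s'] by (simp add: M_def)
      show "3 ^ card (B (par i)) \<le> E3" using E3(1) par_less i by blast
      fix s'' assume a: "agree (work_vars - {''i'', ''d''}) s' s'' \<and> tables M (pushed d (Suc i)) s''"
      have "agree work_vars s s''"
        by (rule work_trans[OF conjunct1[OF I] conjunct1[OF a]]) auto
      then have "agree work_vars s (set_var s'' ''i'' (Suc i))"
        by (rule work_set_var) (simp add: work_vars_def)
      moreover have "s'' ''i'' = s' ''i''" "s'' ''d'' = s' ''d''" using a by (auto intro!: agreeD)
      ultimately show "s'' ''i'' 0 = i \<and>
        agree work_vars s (set_var s'' ''i'' (Suc i)) \<and> set_var s'' ''i'' (Suc i) ''d'' 0 = d \<and>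
        tables M (pushed d (Suc i)) (set_var s'' ''i'' (Suc i))"
        using a I si by (simp add: tables_upd)
    qed (use I i si d in auto)
  next
    fix i s' assume "agree work_vars s s' \<and> s' ''d'' 0 = d \<and> tables M (pushed d i) s'"
    then show "exp_val (var ''N'') s' = N" using work_ready[of s s'] assms(1) readyD(1) by simp
  next
    show "(N + 1) * (exp_time (var ''N'') + exp_width (var ''N'') + 20) +
      (\<Sum>i<N. 100 + (if height i = d then PC else 0)) \<le> 200 * N + (\<Sum>i<N. if height i = d then PC else 0)"
      unfolding sum.distrib by (simp add: N')
  qed (use N_bound in \<open>auto simp: pushed_N\<close>)
  have 1: "timed L (4200 * (N * (n + E3))) (For ''i'' (var ''N'') init_node) s
    (\<lambda>s'. agree work_vars s s' \<and> tables M {} s')"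
    by (rule init_spec[OF assms])
  have 2: "timed L (300 * (N * N) + N * PC) (For ''d'' (var ''N'') (For ''i'' (var ''N'') ?body)) s1
    (\<lambda>s'. agree work_vars s s' \<and> (\<forall>a. s' ''T'' a < bm) \<and>
      exp_val result s' = bU ^ n * dissociation_poly bX E ({..<n} - forced s))"
    if s1: "agree work_vars s s1 \<and> tables M {} s1" for s1
  proof (rule timed_For_sum[where m = N and T = "\<lambda>d. 200 * N + (\<Sum>i<N. if height i = d then PC else 0)" and
        I = "\<lambda>d s'. agree work_vars s s' \<and> tables M (pushed d 0) s'"])
    show "agree work_vars s (set_var s1 ''d'' 0) \<and> tables M (pushed 0 0) (set_var s1 ''d'' 0)"
      using s1 by (simp add: tables_upd pushed_0) (simp add: work_vars_def agree_upd)
  next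
    fix d s' assume I: "agree work_vars s s' \<and> tables M (pushed d 0) s'" and d: "d < N" "s' ''d'' 0 = d"
    show "timed L (200 * N + (\<Sum>i<N. if height i = d then PC else 0)) (For ''i'' (var ''N'') ?body) s'
      (\<lambda>s'. s' ''d'' 0 = d \<and> agree work_vars s (set_var s' ''d'' (Suc d)) \<and>
        tables M (pushed (Suc d) 0) (set_var s' ''d'' (Suc d)))"
    proof (rule timed_weaken[OF inner[of s' d]])
      fix s'' assume a: "agree work_vars s s'' \<and> s'' ''d'' 0 = d \<and> tables M (pushed (Suc d) 0) s''"
      moreover have "agree work_vars s (set_var s'' ''d'' (Suc d))"
        by (rule work_set_var[OF conjunct1[OF a]]) (simp add: work_vars_def)
      ultimately show "s'' ''d'' 0 = d \<and> agree work_vars s (set_var s'' ''d'' (Suc d)) \<and>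
        tables M (pushed (Suc d) 0) (set_var s'' ''d'' (Suc d))" by (simp add: tables_upd)
    qed (use I d in auto)
  next
    fix d s' assume "agree work_vars s s' \<and> tables M (pushed d 0) s'"
    then show "exp_val (var ''N'') s' = N" using work_ready[of s s'] assms(1) readyD(1) by simp
  next
    fix s' assume a: "agree work_vars s s' \<and> tables M (pushed N 0) s'"
    then have r: "ready s'" using work_ready assms(1) by blast
    \<comment> \<open>All heights except that of the root are below \<open>N\<close>, so after the
      last pass the row of the root is complete.\<close>
    have ch: "children D rt \<subseteq> pushed N 0"
      using height_less by (auto simp: pushed_def children_eq)
    have "s' ''T'' (rt * bQ + 0) = partial_table M (pushed N 0) rt (decode (B rt) 0) mod bm"
      using a root_less unfolding tables_def by (metis zero_less_numeral zero_less_power)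
    also have "\<dots> = table bX bU M rt (decode (B rt) 0) mod bm"
      by (simp add: partial_table_complete[OF root_less ch])
    also have "\<dots> = bU ^ n * dissociation_poly bX E ({..<n} - M)"
    proof -
      have "2 ^ n < bX" by (simp add: bX)
      from table_root[OF this bU] show ?thesis by (simp add: bm)
    qed
    finally have "s' ''T'' (rt * bQ) = bU ^ n * dissociation_poly bX E ({..<n} - M)" by simp
    then have "exp_val result s' = bU ^ n * dissociation_poly bX E ({..<n} - forced s)"
      using r by (simp add: ready_def input_ok_def consts_ok_def M_def)
    then show "agree work_vars s s' \<and> (\<forall>a. s' ''T'' a < bm) \<and>
      exp_val result s' = bU ^ n * dissociation_poly bX E ({..<n} - forced s)"
      using a by (simp add: tables_def)
  next
    \<comment> \<open>After exchanging the sums, a fixed node contributes in the pass of its own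
      height only.\<close>
    have "(\<Sum>d<N. \<Sum>i<N. if height i = d then PC else 0) = (\<Sum>i<N. \<Sum>d<N. if height i = d then PC else 0)"
      by (rule sum.swap)
    also have "\<dots> \<le> (\<Sum>i<N. PC)"
      by (rule sum_mono) (simp add: sum.delta)
    finally have "(\<Sum>d<N. \<Sum>i<N. if height i = d then PC else 0) \<le> N * PC" by simp
    moreover have "(N + 1) * 23 + N * (200 * N) \<le> 300 * (N * N)" by (simp add: N' algebra_simps)
    ultimately show "(N + 1) * (exp_time (var ''N'') + exp_width (var ''N'') + 20) +
      (\<Sum>d<N. 200 * N + (\<Sum>i<N. if height i = d then PC else 0)) \<le> 300 * (N * N) + N * PC"
      unfolding sum.distrib by simp
  qed (rule N_bound)
  show ?thesis
    unfolding table_prog_def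
    by (rule timed_weaken, (rule timed_Seq 1 2 | assumption)+) (auto simp: PC_def algebra_simps)
qed

text \<open>The sum for a forced set \<open>M\<close> tells whether a dissociation set of the
  maximum size \<open>j\<close> avoids \<open>M\<close>. This decision oracle is enough to construct
  an optimal cover vertex by vertex.\<close>

lemma main_spec:
  assumes "input_ok s" "s ''T'' = (\<lambda>_. 0)" "s ''F'' = (\<lambda>_. 0)"
    and E3: "\<And>t. t < N \<Longrightarrow> 3 ^ card (B t) \<le> E3" "E3 \<ge> 1"
  shows "timed L (40000 * (n * (N * (n + E3) + N * N))) main_prog s
    (\<lambda>s'. minimum_vcp3_set G (output_set n s'))"
proof -
  let ?V = "{..<n}"
  define Y where "Y = N * (n + E3) + N * N"
  define sizes where "sizes = card ` {S. S \<subseteq> ?V \<and> dissociation E S}"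
  define j where "j = Max sizes"
  have fin: "finite sizes" unfolding sizes_def by simp
  have "card ({} :: nat set) \<in> sizes" unfolding sizes_def by (intro imageI) (simp add: dissociation_def)
  then have "j \<in> sizes" using fin unfolding j_def by (intro Max_in) auto
  then obtain S0 where S0: "S0 \<subseteq> ?V" "dissociation E S0" "card S0 = j" by (auto simp: sizes_def)
  have max: "card S \<le> j" if "S \<subseteq> ?V" "dissociation E S" for S
    unfolding j_def using fin that by (intro Max_ge) (auto simp: sizes_def)
  have jn: "j \<le> n" using S0 card_mono[of ?V S0] by simp
  have X: "2 ^ card (?V - M) < bX" for M :: "nat set"
  proof -
    have "card (?V - M) \<le> n" using card_mono[of ?V "?V - M"] by simp
    then have "(2::nat) ^ card (?V - M) \<le> 2 ^ n" by (intro power_increasing) auto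
    also have "\<dots> < bX" by (simp add: bX)
    finally show ?thesis .
  qed
  define poly where "poly M = dissociation_poly bX E (?V - M)" for M
  have poly_ge: "bX ^ i \<le> poly M \<longleftrightarrow> (\<exists>S\<subseteq>?V - M. dissociation E S \<and> i \<le> card S)" for i M
    unfolding poly_def by (rule dissociation_poly_ge_iff[OF _ X]) simp
  define I where "I M s' \<longleftrightarrow> ready s' \<and> (\<forall>a. s' ''T'' a < bm) \<and> forced s' = M" for M s'
  have bUn: "bU ^ n > 0" using bU_ge by simp
  have bXj: "bX ^ i > 0" for i using bX_ge by simp
  have 1: "timed L (600 * n) setup_prog s (\<lambda>s'. input_ok s' \<and> consts_ok s' \<and> s' ''T'' = (\<lambda>_. 0) \<and> s' ''F'' = (\<lambda>_. 0))"
  proof (rule timed_weaken[OF setup_spec[OF assms(1)]])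
    fix s' assume a: "agree {''X'', ''U'', ''W'', ''m'', ''Q'', ''i''} s s' \<and> consts_ok s'"
    then show "input_ok s' \<and> consts_ok s' \<and> s' ''T'' = (\<lambda>_. 0) \<and> s' ''F'' = (\<lambda>_. 0)"
      using input_ok_agree[OF conjunct1[OF a] _ assms(1)] agreeD[OF conjunct1[OF a]] assms(2,3) by simp
  qed simp
  have 2: "timed L (700 * (N * N)) height_prog s1 (I {})"
    if s1: "input_ok s1 \<and> consts_ok s1 \<and> s1 ''T'' = (\<lambda>_. 0) \<and> s1 ''F'' = (\<lambda>_. 0)" for s1
  proof (rule timed_weaken[OF height_spec])
    fix s' assume a: "agree {''i'', ''j'', ''c'', ''k'', ''h''} s1 s' \<and> (\<forall>t<N. s' ''h'' t = height t)"
    have "input_ok s'" "consts_ok s'"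
      using s1 by (auto intro: input_ok_agree[OF conjunct1[OF a]] consts_ok_agree[OF conjunct1[OF a]])
    moreover have "s' ''T'' = s1 ''T''" "s' ''F'' = s1 ''F''" by (rule agreeD[OF conjunct1[OF a]], simp)+
    ultimately show "I {} s'" using a s1 bm_pos by (simp add: I_def ready_def forced_def)
  qed (use s1 in auto)
  have table: "timed L (10000 * Y) table_prog s1
    (\<lambda>s'. I M s' \<and> exp_val result s' = bU ^ n * poly M \<and> agree work_vars s1 s')"
    if s1: "I M s1" for s1 M
  proof (rule timed_weaken[OF table_spec[of s1 E3]])
    fix s' assume a: "agree work_vars s1 s' \<and> (\<forall>a. s' ''T'' a < bm) \<and>
      exp_val result s' = bU ^ n * dissociation_poly bX E (?V - forced s1)"
    then show "I M s' \<and> exp_val result s' = bU ^ n * poly M \<and> agree work_vars s1 s'"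
      using s1 work_ready[OF conjunct1[OF a]] work_forced[OF conjunct1[OF a]]
      by (simp add: I_def poly_def)
  qed (use s1 E3 in \<open>simp_all add: I_def Y_def\<close>)
  have In: "exp_val (var ''n'') s' = n" if "I M s'" for M s'
    using that by (simp add: I_def ready_def input_ok_def)
  have Iupd: "I M (s'(a := f)) = I M s'" if "a \<in> {''v'', ''q''}" for M s' a f
  proof -
    have ag: "agree {''v'', ''q''} s' (s'(a := f))" "agree {''v'', ''q''} (s'(a := f)) s'"
      using that by (auto simp: agree_def)
    have "ready (s'(a := f)) = ready s'"
      using ready_agree[OF ag(1)] ready_agree[OF ag(2)] by auto
    then show ?thesis using that by (auto simp: I_def forced_def)
  qed
  have qL: "bU ^ n * bX ^ i \<le> bm" if "i \<le> Suc n" for i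
  proof -
    have "bX ^ i \<le> bU" using that bX_ge unfolding bU by (intro power_increasing) auto
    then have "bU ^ n * bX ^ i \<le> bU ^ n * bU" by simp
    then show ?thesis by (simp add: bm)
  qed
  have 3: "timed L 20 (''q'' ::= var ''W'') s1
    (\<lambda>s'. I {} s' \<and> exp_val result s' = bU ^ n * poly {} \<and> s' ''q'' 0 = bU ^ n)"
    if s1: "I {} s1 \<and> exp_val result s1 = bU ^ n * poly {} \<and> agree work_vars s0 s1" for s1 s0
  proof (rule timed_weaken[OF timed_wp])
    have W: "s1 ''W'' 0 = bU ^ n" using s1 by (simp add: I_def ready_def consts_ok_def)
    have "bU ^ n < 2 ^ L" using qL[of 0] by (intro le_bm_less) simp
    then show "wp L (''q'' ::= var ''W'') (\<lambda>s'. I {} s' \<and> exp_val result s' = bU ^ n * poly {} \<and> s' ''q'' 0 = bU ^ n) s1"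
      using s1 W by (simp add: Iupd)
  qed simp_all
  let ?body1 = "If (result [div] (var ''q'' [*] var ''X'')) (''q'' ::= var ''q'' [*] var ''X'') Skip"
  have 4: "timed L ((n + 1) * 100) (For ''v'' (var ''n'') ?body1) s1
    (\<lambda>s'. I {} s' \<and> s' ''q'' 0 = bU ^ n * bX ^ j)"
    if s1: "I {} s1 \<and> exp_val result s1 = bU ^ n * poly {} \<and> s1 ''q'' 0 = bU ^ n" for s1
  \<comment> \<open>The exponent grows by one per round until it reaches \<open>j\<close> and stays
    there; \<open>n\<close> rounds are enough because \<open>j\<close> is at most
    \<open>n\<close>.\<close>
  proof (rule timed_For[where m = n and I = "\<lambda>k s'. I {} s' \<and> exp_val result s' = bU ^ n * poly {} \<and>
        s' ''q'' 0 = bU ^ n * bX ^ min k j"])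
    fix k s' assume k: "k < n" and I: "I {} s' \<and> exp_val result s' = bU ^ n * poly {} \<and>
        s' ''q'' 0 = bU ^ n * bX ^ min k j" and sk: "s' ''v'' 0 = k"
    have X': "s' ''X'' 0 = bX" using I by (simp add: I_def ready_def consts_ok_def)
    define r where "r = exp_val result s'"
    have r: "s' ''T'' (s' ''root'' 0 * s' ''Q'' 0) = r" by (simp add: r_def)
    have q: "s' ''q'' 0 * s' ''X'' 0 = bU ^ n * bX ^ Suc (min k j)"
      using I X' by (simp add: mult_ac)
    \<comment> \<open>The common factor \<open>bU ^ n\<close> cancels in the quotient, so the test
      compares the generating function with a power of \<open>bX\<close>.\<close>
    have "r div (s' ''q'' 0 * s' ''X'' 0) = poly {} div bX ^ Suc (min k j)"
    proof -
      have "r = bU ^ n * poly {}" using I by (simp add: r_def)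
      then show ?thesis unfolding q using bUn by (simp only: div_mult_mult1 neq0_conv)
    qed
    then have "r div (s' ''q'' 0 * s' ''X'' 0) = 0 \<longleftrightarrow> \<not> bX ^ Suc (min k j) \<le> poly {}"
      using bXj[of "Suc (min k j)"] by (simp add: div_eq_0_iff not_le)
    also have "\<dots> \<longleftrightarrow> \<not> Suc (min k j) \<le> j"
      unfolding poly_ge using S0 max by (auto intro: order_trans)
    finally have cond: "r div (s' ''q'' 0 * s' ''X'' 0) = 0 \<longleftrightarrow> j \<le> k" by auto
    define y where "y = s' ''q'' 0 * s' ''X'' 0"
    have yL: "y < 2 ^ L"
      unfolding y_def q using k by (intro le_bm_less qL) simp
    have y: "y = bU ^ n * bX ^ min (Suc k) j" if "\<not> j \<le> k"
      using that by (simp add: y_def q del: power_Suc)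
    have qk: "s' ''q'' 0 = bU ^ n * bX ^ min (Suc k) j" if "j \<le> k"
      using that I by (simp add: min_def)
    have I': "I {} s'" "exp_val result s' = bU ^ n * poly {}" using I by auto
    have rr: "r = bU ^ n * poly {}" using I' by (simp add: r_def)
    have "wp L ?body1 (\<lambda>s''. s'' ''v'' 0 = k \<and> I {} s'' \<and> exp_val result s'' = bU ^ n * poly {} \<and>
        s'' ''q'' 0 = bU ^ n * bX ^ min (Suc k) j) s'"
    proof (cases "j \<le> k")
      case True
      then show ?thesis using cond I'(1) rr qk sk by (simp add: r)
    next
      case False
      then have c: "exp_val (result [div] (var ''q'' [*] var ''X'')) s' \<noteq> 0"
        using cond by (simp add: r)
      have "wp L (''q'' ::= var ''q'' [*] var ''X'') (\<lambda>s''. s'' ''v'' 0 = k \<and> I {} s'' \<and>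
          exp_val result s'' = bU ^ n * poly {} \<and> s'' ''q'' 0 = bU ^ n * bX ^ min (Suc k) j) s'"
        using yL y[OF False] I'(1) rr sk by (simp add: r Iupd flip: y_def)
      then show ?thesis by (simp only: wp.simps(4) if_P[OF c])
    qed
    then show "timed L (com_time ?body1) ?body1 s' (\<lambda>s''. s'' ''v'' 0 = k \<and> I {} (set_var s'' ''v'' (Suc k)) \<and>
        exp_val result (set_var s'' ''v'' (Suc k)) = bU ^ n * poly {} \<and>
        set_var s'' ''v'' (Suc k) ''q'' 0 = bU ^ n * bX ^ min (Suc k) j)"
      by (intro timed_weaken[OF timed_wp]) (auto simp: Iupd)
  qed (use s1 In n_less jn in \<open>auto simp: Iupd\<close>)
  \<comment> \<open>The greedy invariant: an optimal set avoiding \<open>M\<close> still exists, and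
    every such set contains all vertices that were tried and rejected. A rejection stays valid when
    \<open>M\<close> grows, since fewer sets avoid the larger \<open>M\<close>.\<close>
  define good where "good v M \<longleftrightarrow> M \<subseteq> {..<v} \<and> (\<exists>S\<subseteq>?V - M. dissociation E S \<and> card S = j) \<and>
    (\<forall>u<v. u \<notin> M \<longrightarrow> (\<forall>S\<subseteq>?V - M. dissociation E S \<and> card S = j \<longrightarrow> u \<in> S))" for v M
  have good_0: "good 0 {}" using S0 by (auto simp: good_def)
  have ex_j: "(\<exists>S\<subseteq>?V - M. dissociation E S \<and> j \<le> card S) \<longleftrightarrow>
      (\<exists>S\<subseteq>?V - M. dissociation E S \<and> card S = j)" for M
    using max by (metis Diff_subset order_antisym order_refl subset_trans)
  have good_Suc: "good (Suc v) (if bX ^ j \<le> poly (insert v M) then insert v M else M)" if "good v M" for v M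
  proof (cases "bX ^ j \<le> poly (insert v M)")
    case True
    then have "\<exists>S\<subseteq>?V - insert v M. dissociation E S \<and> card S = j" unfolding poly_ge ex_j .
    moreover have "S \<subseteq> ?V - M" if "S \<subseteq> ?V - insert v M" for S using that by blast
    moreover have "insert v M \<subseteq> {..<Suc v}" using that by (auto simp: good_def)
    ultimately show ?thesis using True that unfolding good_def
      by (auto simp: less_Suc_eq)
  next
    case False
    then have no: "\<not> (\<exists>S\<subseteq>?V - insert v M. dissociation E S \<and> card S = j)" unfolding poly_ge ex_j .
    have "v \<in> S" if "S \<subseteq> ?V - M" "dissociation E S \<and> card S = j" for S
    proof (rule ccontr)
      assume "v \<notin> S"
      then have "S \<subseteq> ?V - insert v M" using that by blast
      then show False using no that by blast
    qed
    moreover have "M \<subseteq> {..<Suc v}" using that by (auto simp: good_def)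
    ultimately show ?thesis using False that unfolding good_def by (auto simp: less_Suc_eq)
  qed
  have good_n: "minimum_vcp3_set G M" if good: "good n M" for M
  proof -
    have M: "M \<subseteq> ?V" using that by (simp add: good_def)
    obtain S where S: "S \<subseteq> ?V - M" "dissociation E S" "card S = j"
      using good unfolding good_def by blast
    \<comment> \<open>With all vertices tried, an optimal set avoiding \<open>M\<close> contains
      everything outside \<open>M\<close>, so it is the complement of \<open>M\<close>.\<close>
    have "?V - M \<subseteq> S" using that S by (auto simp: good_def)
    then have SM: "S = ?V - M" using S by blast
    have cM: "card M + j = n" using S(3) card_Diff_subset[of M ?V] M card_mono[of ?V M] finite_subset[OF M]
      unfolding SM by simp
    show ?thesis
      unfolding minimum_vcp3_set_def is_arg_min_def
    proof (intro conjI notI)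
      show "vcp3_set G M" using S M unfolding SM by (simp add: vcp3_set_iff_dissociation[OF simple] verts)
      assume "\<exists>F. vcp3_set G F \<and> card F < card M"
      then obtain F where F: "F \<subseteq> ?V" "dissociation E (?V - F)" "card F < card M"
        by (auto simp: vcp3_set_iff_dissociation[OF simple] verts)
      have "card (?V - F) \<le> j" using F by (intro max) auto
      moreover have "card (?V - F) + card F = n"
        using card_Diff_subset[of F ?V] F(1) card_mono[of ?V F] finite_subset[OF F(1)] by simp
      ultimately show False using F(3) cM by linarith
    qed
  qed
  let ?body2 = "Store ''F'' (var ''v'') (Const 1) ;; table_prog ;;
      If (result [div] var ''q'') Skip (Store ''F'' (var ''v'') (Const 0))"
  have IF: "I (if x = 0 then M - {v} else insert v M) (s'(''F'' := (s' ''F'')(v := x)))"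
    if "I M s'" for M s' v x
  proof -
    have "agree {''F''} s' (s'(''F'' := (s' ''F'')(v := x)))" by (simp add: agree_def)
    then have "ready (s'(''F'' := (s' ''F'')(v := x)))"
      by (rule ready_agree) (use that in \<open>auto simp: I_def\<close>)
    then show ?thesis using that by (auto simp: I_def forced_def)
  qed
  have body2: "timed L (10000 * Y + 100) ?body2 s1
    (\<lambda>s'. I (if bX ^ j \<le> poly (insert v M) then insert v M else M) s' \<and>
      s' ''q'' 0 = bU ^ n * bX ^ j \<and> s' ''v'' 0 = v)"
    if s1: "I M s1" "s1 ''q'' 0 = bU ^ n * bX ^ j" "s1 ''v'' 0 = v" and v: "v \<notin> M" for s1 v M
  proof -
    have a: "timed L 20 (Store ''F'' (var ''v'') (Const 1)) s1
      (\<lambda>s'. I (insert v M) s' \<and> s' ''q'' 0 = bU ^ n * bX ^ j \<and> s' ''v'' 0 = v)"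
    proof (rule timed_weaken[OF timed_wp])
      have "1 < (2::nat) ^ L" by (rule le_bm_less) (use bm_pos in simp)
      then show "wp L (Store ''F'' (var ''v'') (Const 1))
        (\<lambda>s'. I (insert v M) s' \<and> s' ''q'' 0 = bU ^ n * bX ^ j \<and> s' ''v'' 0 = v) s1"
        using s1 IF[OF s1(1), of 1 v] by simp
    qed simp_all
    have b: "timed L (10000 * Y) table_prog s2 (\<lambda>s'. I (insert v M) s' \<and>
        exp_val result s' = bU ^ n * poly (insert v M) \<and> s' ''q'' 0 = bU ^ n * bX ^ j \<and> s' ''v'' 0 = v)"
      if s2: "I (insert v M) s2 \<and> s2 ''q'' 0 = bU ^ n * bX ^ j \<and> s2 ''v'' 0 = v" for s2
    proof (rule timed_weaken[OF table[OF conjunct1[OF s2]]])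
      fix s' assume t: "I (insert v M) s' \<and> exp_val result s' = bU ^ n * poly (insert v M) \<and> agree work_vars s2 s'"
      then have "s' ''q'' = s2 ''q''" "s' ''v'' = s2 ''v''" by (auto intro!: agreeD simp: work_vars_def)
      then show "I (insert v M) s' \<and>
        exp_val result s' = bU ^ n * poly (insert v M) \<and> s' ''q'' 0 = bU ^ n * bX ^ j \<and> s' ''v'' 0 = v"
        using t s2 by simp
    qed simp
    have c: "timed L 60 (If (result [div] var ''q'') Skip (Store ''F'' (var ''v'') (Const 0))) s2
      (\<lambda>s'. I (if bX ^ j \<le> poly (insert v M) then insert v M else M) s' \<and>
        s' ''q'' 0 = bU ^ n * bX ^ j \<and> s' ''v'' 0 = v)"
      if s2: "I (insert v M) s2 \<and> exp_val result s2 = bU ^ n * poly (insert v M) \<and>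
        s2 ''q'' 0 = bU ^ n * bX ^ j \<and> s2 ''v'' 0 = v" for s2
    proof (rule timed_weaken[OF timed_wp])
      define r where "r = exp_val result s2"
      have r: "s2 ''T'' (s2 ''root'' 0 * s2 ''Q'' 0) = r" by (simp add: r_def)
      have "r div s2 ''q'' 0 = poly (insert v M) div bX ^ j"
        using s2 bUn by (simp only: r_def div_mult_mult1 neq0_conv)
      then have cond: "r div s2 ''q'' 0 = 0 \<longleftrightarrow> \<not> bX ^ j \<le> poly (insert v M)"
        using bX_ge by (auto simp: div_eq_0_iff not_le)
      have "I M (s2(''F'' := (s2 ''F'')(v := 0)))"
        using IF[of "insert v M" s2 0 v] s2 v by simp
      then show "wp L (If (result [div] var ''q'') Skip (Store ''F'' (var ''v'') (Const 0)))
        (\<lambda>s'. I (if bX ^ j \<le> poly (insert v M) then insert v M else M) s' \<and>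
        s' ''q'' 0 = bU ^ n * bX ^ j \<and> s' ''v'' 0 = v) s2"
        using cond s2 by (cases "bX ^ j \<le> poly (insert v M)") (simp_all add: r)
    qed simp_all
    show ?thesis
      by (rule timed_weaken, (rule timed_Seq a b c | assumption)+) auto
  qed
  have 5: "timed L ((n + 1) * (10000 * Y + 130)) (For ''v'' (var ''n'') ?body2) s1
    (\<lambda>s'. minimum_vcp3_set G (output_set n s'))"
    if s1: "I {} s1 \<and> s1 ''q'' 0 = bU ^ n * bX ^ j" for s1
  proof (rule timed_For[where m = n and T = "10000 * Y + 100" and
        I = "\<lambda>v s'. (\<exists>M. I M s' \<and> good v M) \<and> s' ''q'' 0 = bU ^ n * bX ^ j"])
    show "(\<exists>M. I M (set_var s1 ''v'' 0) \<and> good 0 M) \<and> set_var s1 ''v'' 0 ''q'' 0 = bU ^ n * bX ^ j"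
      using s1 good_0 by (auto simp: Iupd)
  next
    fix v s' assume h: "(\<exists>M. I M s' \<and> good v M) \<and> s' ''q'' 0 = bU ^ n * bX ^ j" and sv: "s' ''v'' 0 = v"
    then obtain M where M: "I M s'" "good v M" by blast
    have "v \<notin> M" using M(2) by (auto simp: good_def)
    show "timed L (10000 * Y + 100) ?body2 s' (\<lambda>s'. s' ''v'' 0 = v \<and>
        (\<exists>M. I M (set_var s' ''v'' (Suc v)) \<and> good (Suc v) M) \<and>
        set_var s' ''v'' (Suc v) ''q'' 0 = bU ^ n * bX ^ j)"
      by (rule timed_weaken[OF body2[OF M(1) conjunct2[OF h] sv \<open>v \<notin> M\<close>]])
        (use good_Suc[OF M(2)] in \<open>auto simp: Iupd\<close>)
  next
    fix s' assume "(\<exists>M. I M s' \<and> good n M) \<and> s' ''q'' 0 = bU ^ n * bX ^ j"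
    then obtain M where M: "I M s'" "good n M" by blast
    have "output_set n s' = M"
      using M by (auto simp: output_set_def I_def forced_def good_def)
    then show "minimum_vcp3_set G (output_set n s')" using good_n M by simp
  qed (use In n_less in \<open>auto simp: add_mult_distrib2\<close>)
  \<comment> \<open>One initial evaluation and the loop bound give
    \<open>10000 * (n + 2) * Y\<close>, at most \<open>30000 * (n * Y)\<close> as \<open>n\<close>
    is positive. The remaining 10000 absorb the terms of lower order.\<close>
  have time: "600 * n + (700 * (N * N) + (10000 * Y + (20 + ((n + 1) * 100 + (n + 1) * (10000 * Y + 130)))))
      \<le> 40000 * (n * Y)"
  proof -
    have "1 \<le> N" using root_less by simp
    then have N1: "1 \<le> N * (n + E3)" "N * N \<le> Y" using E3(2) by (auto simp: Y_def)
    then have Y1: "1 \<le> Y" unfolding Y_def by linarith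
    obtain n' where n': "n = Suc n'" using n_pos gr0_implies_Suc by blast
    define z where "z = n' * Y"
    have z: "n' \<le> z" using Y1 by (simp add: z_def)
    have e: "(n + 1) * (10000 * Y + 130) = 10000 * z + 130 * n' + 20000 * Y + 260" "n * Y = Y + z"
      by (simp_all add: n' z_def algebra_simps)
    have "600 * Suc n' + (700 * w + (10000 * Y + (20 + ((Suc n' + 1) * 100 +
        (10000 * z + 130 * n' + 20000 * Y + 260))))) \<le> 40000 * (Y + z)" if "w \<le> Y" for w
      using z Y1 that by simp
    from this[OF N1(2)] show ?thesis unfolding e unfolding n' .
  qed
  show ?thesis
    unfolding main_prog_def Y_def[symmetric]
    by (rule timed_weaken, (rule timed_Seq 1 2 table 3 4 5 | assumption)+)
      (use time in simp_all)
qed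

end

section \<open>Arithmetic of the time bound\<close>

lemma power_bounds:
  fixes p n k :: nat
  assumes "k \<le> n" "k \<le> p + 1" "n \<ge> 1"
  shows "3 ^ k * p \<le> 3 * 3 ^ p * n"
proof (cases "p \<le> n")
  case True
  have "(3::nat) ^ k \<le> 3 ^ (p + 1)" using assms(2) by (intro power_increasing) auto
  then have "3 ^ k * p \<le> 3 ^ (p + 1) * n" using True by (intro mult_le_mono)
  then show ?thesis by simp
next
  \<comment> \<open>\<open>p\<close> only bounds the width and may exceed \<open>n\<close>. In that
    case \<open>3 ^ k\<close> is at most \<open>3 ^ n\<close>, and the gap \<open>3 ^ d\<close> up
    to \<open>3 ^ p\<close> pays for the excess \<open>d\<close>.\<close>
  case False
  then obtain d where d: "p = n + d" using le_Suc_ex nat_le_linear by blast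
  have "d < 3 ^ d" by (rule less_le_trans[OF less_exp]) (simp add: power_mono)
  then have "n + d \<le> n * 3 ^ d + n * 3 ^ d" using assms(3)
    by (intro add_mono) (auto intro: le_trans[of d "3 ^ d"])
  then have "n + d \<le> 3 * (n * 3 ^ d)" by simp
  moreover have "(3::nat) ^ k \<le> 3 ^ n" using assms(1) by (intro power_increasing) auto
  ultimately have "3 ^ k * p \<le> 3 ^ n * (3 * (n * 3 ^ d))" unfolding d by (intro mult_le_mono)
  then show ?thesis by (simp add: d power_add mult_ac)
qed

lemma square_le_pow3: "p * p \<le> (3::nat) ^ p"
proof (induction p)
  case (Suc p)
  consider "p = 0" | "p = 1" | "p \<ge> 2" by linarith
  then show ?case
  proof cases
    case 3
    then have "2 * p \<le> p * p" "4 \<le> p * p" using mult_le_mono[of 2 p p p] mult_le_mono[of 2 p 2 p] by auto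
    moreover have "Suc p * Suc p = p * p + 2 * p + 1" "(3::nat) ^ Suc p = 3 * 3 ^ p" by simp_all
    ultimately show ?thesis using Suc by linarith
  qed auto
qed simp

text \<open>The word length contains a summand \<open>p\<close>, because the number of nodes grows
  with \<open>p\<close>. Each part of the time has to absorb it into \<open>3 ^ p\<close> without an
  extra factor: the scans by \<open>p \<le> 3 ^ p\<close>, the table entries by
  \<open>power_bounds\<close>, the quadratic part by \<open>square_le_pow3\<close>.\<close>

lemma time_bound:
  fixes K p n N k :: nat
  assumes "N \<le> K * p * n" "k \<le> n" "k \<le> p + 1" "n \<ge> 1"
    and L: "L \<le> (33 + K) * n ^ 3 + p"
  shows "40000 * (n * (N * (n + 3 ^ k) + N * N)) * L \<le>
    40000 * (34 + K) * (4 * K + K * K) * (3 ^ p * p * n ^ 6)"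
proof -
  let ?a = "(34 + K) * n ^ 3" and ?e = "3 ^ p :: nat"
  have n3: "1 \<le> n ^ 3" "n \<le> n ^ 3" using assms(4) by (simp_all add: self_le_power)
  have "(2::nat) ^ p \<le> 3 ^ p" by (rule power_mono) auto
  then have pe: "p \<le> ?e" using less_exp[of p] by linarith
  have pp: "p * p \<le> ?e" by (rule square_le_pow3)
  have e3: "3 ^ k \<le> 3 * ?e" using assms(3) power_increasing[of k "p + 1" "3::nat"] by simp
  have ep: "3 ^ k * p \<le> 3 * ?e * n" by (rule power_bounds[OF assms(2-4)])
  have L1: "L \<le> ?a * ?e"
  proof -
    have "p \<le> n ^ 3 * ?e" using mult_le_mono[OF n3(1) pe] by simp
    moreover have "(33 + K) * n ^ 3 * 1 \<le> (33 + K) * n ^ 3 * ?e" by (intro mult_le_mono2) simp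
    ultimately show ?thesis using L by (simp add: algebra_simps)
  qed
  have L2: "3 ^ k * L \<le> 3 * (?a * ?e)"
  proof -
    have "3 ^ k * L \<le> 3 ^ k * ((33 + K) * n ^ 3) + 3 ^ k * p"
      using mult_le_mono2[OF L, of "3 ^ k"] by (simp only: distrib_left)
    also have "\<dots> \<le> 3 * ?e * ((33 + K) * n ^ 3) + 3 * ?e * n ^ 3"
      using e3 ep n3(2) by (intro add_mono mult_le_mono order_trans[OF ep] order_refl)
    also have "\<dots> = 3 * (?a * ?e)" by (simp add: algebra_simps)
    finally show ?thesis .
  qed
  have L3: "p * L \<le> ?a * ?e"
  proof -
    have "p * L \<le> p * ((33 + K) * n ^ 3) + p * p" using mult_le_mono2[OF L, of p] by (simp only: distrib_left)
    also have "\<dots> \<le> ?e * ((33 + K) * n ^ 3) + ?e * n ^ 3"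
      using pe mult_le_mono[OF pp n3(1)] by (intro add_mono mult_le_mono1) (simp_all only: mult_1_right)
    also have "\<dots> = ?a * ?e" by (simp add: algebra_simps)
    finally show ?thesis .
  qed
  define c where "c = ?a * ?e * (p * n ^ 3)"
  have "n * (N * n) * L \<le> n * ((K * p * n) * n) * (?a * ?e)"
    using assms(1) L1 by (intro mult_le_mono order_refl)
  also have "\<dots> = K * c" by (simp add: c_def power3_eq_cube mult_ac)
  finally have A: "n * (N * n) * L \<le> K * c" .
  have "n * (N * 3 ^ k) * L = n * N * (3 ^ k * L)" by (simp add: mult_ac)
  also have "\<dots> \<le> n * (K * p * n) * (3 * (?a * ?e))"
    by (rule mult_le_mono[OF mult_le_mono2[OF assms(1)] L2])
  \<comment> \<open>The table entries need \<open>n ^ 5\<close> only; a spare factor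
    \<open>n\<close> brings this part into the common form \<open>c\<close>.\<close>
  also have "\<dots> \<le> n * (K * p * n) * (3 * (?a * ?e)) * n" using assms(4) by simp
  also have "\<dots> = 3 * K * c" by (simp add: c_def power3_eq_cube mult_ac)
  finally have B: "n * (N * 3 ^ k) * L \<le> 3 * K * c" .
  have "n * (N * N) * L \<le> n * ((K * p * n) * (K * p * n)) * L"
    using assms(1) by (intro mult_le_mono order_refl)
  also have "\<dots> = K * K * (p * n ^ 3) * (p * L)" by (simp add: power3_eq_cube mult_ac)
  also have "\<dots> \<le> K * K * (p * n ^ 3) * (?a * ?e)" by (rule mult_le_mono2[OF L3])
  also have "\<dots> = K * K * c" by (simp add: c_def mult_ac)
  finally have C: "n * (N * N) * L \<le> K * K * c" .
  have "n * (N * (n + 3 ^ k) + N * N) * L = n * (N * n) * L + n * (N * 3 ^ k) * L + n * (N * N) * L"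
    by (simp add: algebra_simps)
  also have "\<dots> \<le> K * c + 3 * K * c + K * K * c" using A B C by (intro add_mono)
  also have "\<dots> = (4 * K + K * K) * c" by (simp add: algebra_simps)
  finally have "40000 * (n * (N * (n + 3 ^ k) + N * N) * L) \<le> 40000 * ((4 * K + K * K) * c)" by simp
  also have "c = (34 + K) * (?e * p * n ^ 6)"
    by (simp add: c_def mult_ac flip: power_add)
  finally show ?thesis by (simp only: mult_ac)
qed

text \<open>\<open>K\<close> is the constant hidden in the assumption of O(pn) nodes. It is chosen
  after the program, so one program serves all such constants and only \<open>C\<close> depends on
  them.\<close>

theorem theorem2:
  shows "\<exists>prog. \<forall>K :: nat. \<exists>C :: nat.
    \<forall>(G :: nat graph) (D :: (nat, nat) tree_decomp) (n :: nat) (N :: nat) (p :: nat).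
      simple_graph G \<and> verts G = {..<n} \<and>
      refined_nice_tree_decomposition G D \<and> nodes D = {..<N} \<and>
      td_width D \<le> int p \<and> N \<le> K * p * n \<longrightarrow>
      (\<exists>t s. runs prog (input_state n N G D) t s \<and>
             minimum_vcp3_set G (output_set n s) \<and>
             t \<le> C * (3 ^ p * p * n ^ 6))"
proof (rule exI, rule allI, rule exI, (rule allI)+, rule impI, elim conjE)
  fix K :: nat and G :: "nat graph" and D :: "(nat, nat) tree_decomp" and n N p :: nat
  assume G: "simple_graph G" "verts G = {..<n}" "refined_nice_tree_decomposition G D" "nodes D = {..<N}"
    and width: "td_width D \<le> int p" and NK: "N \<le> K * p * n"
  interpret decomposed_graph G D n N by unfold_locales (fact G)+
  \<comment> \<open>For \<open>n = 0\<close> the bound on \<open>N\<close> would leave no node,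
    whereas the root is one.\<close>
  have n1: "n \<ge> 1" using NK root_less by (cases n) auto
  define k where "k = min n (p + 1)"
  define c where "c = (n + 1) ^ 3"
  \<comment> \<open>\<open>4 * c\<close> covers the intermediate values, since
    \<open>4 * bm ^ 3 = 2 ^ (2 + 3 * c)\<close> and \<open>c\<close> is at least 8. The other
    summands cover node numbers, by \<open>K * p * n < 2 ^ (K + p + n)\<close>.\<close>
  define L where "L = 4 * c + (K + p + n)"
  have c8: "8 \<le> c" "n + 1 \<le> c"
    using n1 power_mono[of 2 "n + 1" 3] self_le_power[of "n + 1" 3] by (simp_all add: c_def)
  define bX bU bm where "bX = (2::nat) ^ Suc n" and "bU = bX ^ Suc n" and "bm = bU ^ Suc n"
  have bm2: "bm = 2 ^ c"
    by (simp only: bm_def bU_def bX_def c_def power_mult[symmetric] power3_eq_cube Suc_eq_plus1)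
  have NL: "N < 2 ^ L"
  proof -
    have "K * p * n < 2 ^ K * 2 ^ p * 2 ^ n"
      by (intro mult_strict_mono' less_exp) auto
    also have "\<dots> = 2 ^ (K + p + n)" by (simp add: power_add)
    also have "\<dots> \<le> 2 ^ L" by (rule power_increasing) (simp_all add: L_def)
    finally show ?thesis using NK by simp
  qed
  interpret dp_run G D n N L bX bU bm "3 ^ n"
  proof
    have "4 * bm ^ 3 = 2 ^ (2 + 3 * c)" by (simp add: bm2 power_add mult.commute flip: power_mult)
    also have "\<dots> < 2 ^ L" using c8 by (intro power_strict_increasing) (simp_all add: L_def)
    finally show "4 * bm ^ 3 < 2 ^ L" .
    have "3 * 3 ^ n \<le> (4::nat) ^ Suc n" using power_mono[of "3::nat" 4 "Suc n"] by simp
    also have "\<dots> = 2 ^ (2 * Suc n)" by (simp add: power_mult)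
    also have "\<dots> < 2 ^ L" using c8 by (intro power_strict_increasing) (simp_all add: L_def)
    finally show "3 * 3 ^ n < (2::nat) ^ L" .
  qed (use n1 NL in \<open>simp_all add: bX_def bU_def bm_def\<close>)
  let ?s = "input_state n N G D"
  have card: "card (B t) \<le> k" if "t < N" for t
  proof -
    have "card (B t) \<le> Max ((\<lambda>i. card (B i)) ` nodes D)"
      using that by (intro Max_ge) (simp_all add: G(4))
    then have "card (B t) \<le> p + 1" using width by (simp add: td_width_def)
    then show ?thesis using card_bag_le[OF that] by (simp add: k_def)
  qed
  have inp: "input_ok ?s"
  proof -
    have *: "t * n + x < N * n" "(t * n + x) div n = t" "(t * n + x) mod n = x" if "t < N" "x < n" for t x
    proof -
      have "t * n + x < Suc t * n" using that by simp
      also have "\<dots> \<le> N * n" using that by (intro mult_le_mono1) simp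
      finally show "t * n + x < N * n" .
    qed (use that in simp_all)
    show ?thesis
      unfolding input_ok_def by (simp add: input_state_def * par_def)
  qed
  have bnd: "bounded L ?s"
  proof -
    have "1 < (2::nat) ^ L" using le_bm_less bm_pos by (metis Suc_leI One_nat_def)
    moreover have "i < N \<Longrightarrow> i \<noteq> rt \<Longrightarrow> parent D i < 2 ^ L" "rt < 2 ^ L" for i
      using less_trans[OF par_less NL, of i] less_trans[OF root_less NL] by (simp_all add: par_def)
    ultimately show ?thesis using NL n_less less_trans[OF _ NL]
      by (auto simp: bounded_def input_state_def)
  qed
  have "timed L (40000 * (n * (N * (n + 3 ^ k) + N * N))) main_prog ?s
    (\<lambda>s'. minimum_vcp3_set G (output_set n s'))"
  proof (rule main_spec[OF inp])
    show "3 ^ card (B t) \<le> (3::nat) ^ k" if "t < N" for t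
      using card[OF that] by (intro power_increasing) auto
  qed (simp_all add: input_state_def)
  from this bnd obtain t s where ts: "runs main_prog ?s t s"
    "t \<le> 40000 * (n * (N * (n + 3 ^ k) + N * N)) * L" "minimum_vcp3_set G (output_set n s)"
    by (rule timedE) (use c8 in \<open>auto simp: L_def\<close>)
  \<comment> \<open>Since \<open>n + 1 \<le> 2 * n\<close>, the part \<open>4 * c\<close> costs 32
    cubes. The 33rd pays for the summand \<open>n\<close> of \<open>L\<close>, and \<open>K\<close>
    more for the summand \<open>K\<close>.\<close>
  have "c \<le> (2 * n) ^ 3" unfolding c_def using n1 by (intro power_mono) auto
  then have "L \<le> (33 + K) * n ^ 3 + p"
  proof -
    assume "c \<le> (2 * n) ^ 3"
    then have "4 * c \<le> 32 * n ^ 3" by (simp add: power_mult_distrib)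
    moreover have n3: "n \<le> n ^ 3" using n1 by (simp add: self_le_power)
    moreover have "K * 1 \<le> K * n ^ 3" using n1 n3 by (intro mult_le_mono2) linarith
    moreover have "(33 + K) * n ^ 3 = 33 * n ^ 3 + K * n ^ 3" by (rule distrib_right)
    ultimately show ?thesis unfolding L_def by linarith
  qed
  from time_bound[OF NK _ _ n1 this, of k]
  have "t \<le> (40000 * (34 + K) * (4 * K + K * K)) * (3 ^ p * p * n ^ 6)"
    using ts(2) by (simp add: k_def)
  then show "\<exists>t s. runs main_prog ?s t s \<and> minimum_vcp3_set G (output_set n s) \<and>
      t \<le> (40000 * (34 + K) * (4 * K + K * K)) * (3 ^ p * p * n ^ 6)"
    using ts by blast
qed
end
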